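(* Let $d=2$ or $d=3$, let $\Omega$ be a rotation vector, let $V\in C^\infty(\mathbb{R}^d;\mathbb{R})$ satisfy $\partial_x^{\alpha}V\in L^\infty(\mathbb{R}^d)$ for all multi-indices $|\alpha|\ge2$, let $(q,p)\in C^\infty(\mathbb{R};\mathbb{R}^d)^2$ solve $\dot q=p+\Omega\wedge q$, $\dot p=-\nabla V(q)+\Omega\wedge p$ with $q(0)=q_0\in\mathbb{R}^d$, $p(0)=p_0\in\mathbb{R}^d$, and put $Q_V(t)=\nabla^2V(q(t))$. Let $A_0,B_0\in\mathbb{C}^{d\times d}$ satisfy property (M) (defined in the context), and let $$v_0(y)=\frac{1}{(\det A_0)^{1/2}}\exp\Big(-\frac12\,y\cdot\big(B_0A_0^{-1}\big)y\Big).$$ Let $v\in C(\mathbb{R};\Sigma^k)$ be the solution of $$i\partial_tv=-\tfrac12\Delta v+\tfrac12\big(y\cdot Q_V(t)y\big)v+(\Omega\cdot L)v,\qquad v_{|t=0}=v_0.$$ Let $A(t),B(t)\in\mathbb{C}^{d\times d}$ solve $$\begin{cases}\dot A(t)=iB(t)-[R_\Omega,A(t)],& A(0)=A_0,\\ \dot B(t)=iQ_V(t)A(t)-[R_\Omega,B(t)],& B(0)=B_0.\end{cases}$$ Then $A(t)$ and $B(t)$ satisfy property (M) for all $t\in\mathbb{R}$, and for all $t\in\mathbb{R}$ $$v(t,y)=\frac{1}{(\det A(t))^{1/2}}\exp\Big(-\frac12\,y\cdot\big(B(t)A(t)^{-1}\big)y\Big).$$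
   Context: Property (M) for a pair of complex $d\times d$ matrices $(A,B)$: $A$ and $B$ are invertible; $BA^{-1}$ is symmetric (i.e. equal to its transpose), so $BA^{-1}=M_1+iM_2$ with $M_1,M_2$ real symmetric; $\mathrm{Re}(BA^{-1})=M_1$ is strictly positive definite; and $(\mathrm{Re}(BA^{-1}))^{-1}=AA^*$, where $A^*$ is the conjugate transpose. $[X,Y]=XY-YX$. For $d=3$ and $\Omega=(\Omega_1,\Omega_2,\Omega_3)\in\mathbb{R}^3$, $$R_\Omega=\begin{bmatrix}0&\Omega_3&-\Omega_2\\-\Omega_3&0&\Omega_1\\ \Omega_2&-\Omega_1&0\end{bmatrix}.$$ For $d=2$, $\mathbb{R}^2$ is identified with $\mathbb{R}^2\times\{0\}\subset\mathbb{R}^3$, $\Omega=(0,0,\Omega_3)$, and $R_\Omega$ is the upper-left $2\times2$ block $\begin{bmatrix}0&\Omega_3\\-\Omega_3&0\end{bmatrix}$. $\wedge$ is the cross product in $\mathbb{R}^3$ and $L=-i\,y\wedge\nabla$, so $\Omega\cdot L=-i(\Omega\wedge y)\cdot\nabla$; for $d=2$, $\Omega\wedge y=\Omega_3(-y_2,y_1)$ and $\Omega\cdot L=-i\Omega_3(y_1\partial_2-y_2\partial_1)$. $y\cdot My=\sum_{j,l}y_jM_{jl}y_l$ (bilinear, no conjugation). The branch of the square root $(\det A(t))^{1/2}$ is the one continuous in $t$ which at $t=0$ agrees with the choice made in $v_0$. $\nabla^2V$ is the Hessian of $V$. For $k\in\mathbb{N}$, $\Sigma^k=\{f\in L^2(\mathbb{R}^d):\sum_{|\alpha|+|\beta|\le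 k}\|x^\alpha\partial_x^\beta f\|_{L^2}<\infty\}$. The Hamiltonian system for $(q,p)$ has a unique global smooth solution, and it is known (Kitada) that for every $k\in\mathbb{N}$ and $v_0\in\Sigma^k$ the amplitude equation has a unique global solution $v\in C(\mathbb{R};\Sigma^k)$. *)

theory Defs
  imports "HOL-Analysis.Analysis"
begin

section \<open>Smooth functions and multi-indices\<close>

primrec iter_deriv ::
  "'a list \<Rightarrow> ('a::euclidean_space \<Rightarrow> 'b::real_normed_vector) \<Rightarrow> 'a \<Rightarrow> 'b" where
  "iter_deriv [] f = f"
| "iter_deriv (b # bs) f = (\<lambda>x. frechet_derivative (iter_deriv bs f) (at x) b)"

text \<open>All iterated partial derivatives exist and are differentiable (hence continuous);
  this is \<open>C\<^sup>\<infinity>\<close> on the whole space. It is also used on \<^typ>\<open>real\<close> and on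
  space-time \<^typ>\<open>real \<times> real ^ 'd\<close>.\<close>

definition smooth :: "('a::euclidean_space \<Rightarrow> 'b::real_normed_vector) \<Rightarrow> bool" where
  "smooth f \<longleftrightarrow> (\<forall>bs. set bs \<subseteq> Basis \<longrightarrow> (\<forall>x. iter_deriv bs f differentiable (at x)))"

type_synonym 'd multi_index = "'d \<Rightarrow> nat"

definition mi_order :: "'d::finite multi_index \<Rightarrow> nat" where
  "mi_order \<alpha> = (\<Sum>j\<in>UNIV. \<alpha> j)"

definition mi_power :: "real ^ 'd \<Rightarrow> 'd multi_index \<Rightarrow> real" where
  "mi_power x \<alpha> = (\<Prod>j\<in>UNIV. (x $ j) ^ \<alpha> j)"

text \<open>The linear order on the index type only fixes the order in which the partial
  derivatives are taken, which is immaterial for smooth functions.\<close>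

definition mi_deriv :: "'d::{finite,linorder} multi_index
    \<Rightarrow> (real ^ 'd::{finite,linorder} \<Rightarrow> 'b::real_normed_vector) \<Rightarrow> real ^ 'd::{finite,linorder} \<Rightarrow> 'b" where
  "mi_deriv \<alpha> f =
     iter_deriv (concat (map (\<lambda>j. replicate (\<alpha> j) (axis j 1)) (sorted_list_of_set UNIV))) f"

definition partial_deriv ::
    "'d \<Rightarrow> (real ^ 'd \<Rightarrow> 'b::real_normed_vector) \<Rightarrow> real ^ 'd \<Rightarrow> 'b" where
  "partial_deriv j f = iter_deriv [axis j 1] f"

definition gradient :: "(real ^ 'd \<Rightarrow> real) \<Rightarrow> real ^ 'd \<Rightarrow> real ^ 'd" where
  "gradient f x = (\<chi> j. partial_deriv j f x)"

definition hessian :: "(real ^ 'd \<Rightarrow> real) \<Rightarrow> real ^ 'd \<Rightarrow> real ^ 'd ^ 'd" where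
  "hessian f x = (\<chi> j l. partial_deriv j (partial_deriv l f) x)"

definition laplacian :: "(real ^ 'd \<Rightarrow> complex) \<Rightarrow> real ^ 'd \<Rightarrow> complex" where
  "laplacian f x = (\<Sum>j\<in>UNIV. partial_deriv j (partial_deriv j f) x)"

text \<open>For the continuous functions \<open>\<partial>\<^sup>\<alpha>V\<close>, membership in \<open>L\<^sup>\<infinity>\<close> is boundedness.\<close>

definition subquadratic :: "(real ^ 'd::{finite,linorder} \<Rightarrow> real) \<Rightarrow> bool" where
  "subquadratic V \<longleftrightarrow>
     smooth V \<and> (\<forall>\<alpha>. mi_order \<alpha> \<ge> 2 \<longrightarrow> bounded (range (mi_deriv \<alpha> V)))"

section \<open>Rotation\<close>

definition rot3 :: "real ^ 3 \<Rightarrow> real ^ 3 ^ 3" where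
  "rot3 \<Omega> = vector [vector [0, \<Omega> $ 3, - \<Omega> $ 2],
                     vector [- \<Omega> $ 3, 0, \<Omega> $ 1],
                     vector [\<Omega> $ 2, - \<Omega> $ 1, 0]]"

text \<open>In dimension 2 the rotation vector is \<open>\<Omega> = (0, 0, \<Omega>\<^sub>3)\<close>, and \<open>\<real>\<^sup>2\<close> is identified with
  \<open>\<real>\<^sup>2 \<times> {0}\<close> in \<open>\<real>\<^sup>3\<close>.\<close>

definition rot2 :: "real ^ 3 \<Rightarrow> real ^ 2 ^ 2" where
  "rot2 \<Omega> = vector [vector [0, \<Omega> $ 3],
                     vector [- \<Omega> $ 3, 0]]"

definition wedge2 :: "real ^ 3 \<Rightarrow> real ^ 2 \<Rightarrow> real ^ 2" where
  "wedge2 \<Omega> y = vector [- \<Omega> $ 3 * y $ 2, \<Omega> $ 3 * y $ 1]"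

text \<open>\<open>\<Omega>\<cdot>L = -i (\<Omega> \<wedge> y)\<cdot>\<nabla>\<close>, with \<open>W y\<close> standing for \<open>\<Omega> \<wedge> y\<close>.\<close>

definition Omega_L :: "(real ^ 'd \<Rightarrow> real ^ 'd)
    \<Rightarrow> (real ^ 'd \<Rightarrow> complex) \<Rightarrow> real ^ 'd \<Rightarrow> complex" where
  "Omega_L W f y = - \<i> * (\<Sum>j\<in>UNIV. of_real (W y $ j) * partial_deriv j f y)"

section \<open>Matrices\<close>

definition conj_transpose :: "complex ^ 'n ^ 'm \<Rightarrow> complex ^ 'm ^ 'n" where
  "conj_transpose A = transpose (map_matrix cnj A)"

definition commutator :: "'a::ring_1 ^ 'n ^ 'n \<Rightarrow> 'a ^ 'n ^ 'n \<Rightarrow> 'a ^ 'n ^ 'n" where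
  "commutator X Y = X ** Y - Y ** X"

definition positive_definite :: "real ^ 'n ^ 'n \<Rightarrow> bool" where
  "positive_definite S \<longleftrightarrow> (\<forall>x. x \<noteq> 0 \<longrightarrow> x \<bullet> (S *v x) > 0)"

definition property_M :: "complex ^ 'n ^ 'n \<Rightarrow> complex ^ 'n ^ 'n \<Rightarrow> bool" where
  "property_M A B \<longleftrightarrow>
     (let M = B ** matrix_inv A in
        invertible A \<and> invertible B \<and>
        transpose M = M \<and>
        positive_definite (map_matrix Re M) \<and>
        map_matrix complex_of_real (matrix_inv (map_matrix Re M)) = A ** conj_transpose A)"

definition hamiltonian_solution :: "(real ^ 'd \<Rightarrow> real ^ 'd) \<Rightarrow> (real ^ 'd \<Rightarrow> real)
    \<Rightarrow> real ^ 'd \<Rightarrow> real ^ 'd \<Rightarrow> (real \<Rightarrow> real ^ 'd) \<Rightarrow> (real \<Rightarrow> real ^ 'd) \<Rightarrow> bool" where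
  "hamiltonian_solution W V q0 p0 q p \<longleftrightarrow>
     smooth q \<and> smooth p \<and> q 0 = q0 \<and> p 0 = p0 \<and>
     (\<forall>t. (q has_vector_derivative (p t + W (q t))) (at t)) \<and>
     (\<forall>t. (p has_vector_derivative (- gradient V (q t) + W (p t))) (at t))"

definition matrix_solution :: "real ^ 'd ^ 'd \<Rightarrow> (real \<Rightarrow> real ^ 'd ^ 'd)
    \<Rightarrow> complex ^ 'd ^ 'd \<Rightarrow> complex ^ 'd ^ 'd
    \<Rightarrow> (real \<Rightarrow> complex ^ 'd ^ 'd) \<Rightarrow> (real \<Rightarrow> complex ^ 'd ^ 'd) \<Rightarrow> bool" where
  "matrix_solution R Q A0 B0 A B \<longleftrightarrow>
     A 0 = A0 \<and> B 0 = B0 \<and>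
     (\<forall>t. (A has_vector_derivative
        (map_matrix (\<lambda>z. \<i> * z) (B t)
          - commutator (map_matrix complex_of_real R) (A t))) (at t)) \<and>
     (\<forall>t. (B has_vector_derivative
        (map_matrix (\<lambda>z. \<i> * z) (map_matrix complex_of_real (Q t) ** A t)
          - commutator (map_matrix complex_of_real R) (B t))) (at t))"

text \<open>\<open>y\<cdot>My\<close> is bilinear: there is no conjugation.\<close>

definition cquad :: "complex ^ 'd ^ 'd \<Rightarrow> real ^ 'd \<Rightarrow> complex" where
  "cquad M y = (\<Sum>j\<in>UNIV. \<Sum>l\<in>UNIV. of_real (y $ j) * M $ j $ l * of_real (y $ l))"

text \<open>The argument \<open>s\<close> is the chosen value of \<open>(det A)\<^sup>1\<^sup>/\<^sup>2\<close>.\<close>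

definition gaussian :: "complex \<Rightarrow> complex ^ 'd ^ 'd \<Rightarrow> complex ^ 'd ^ 'd
    \<Rightarrow> real ^ 'd \<Rightarrow> complex" where
  "gaussian s A B y = 1 / s * exp (- (1/2) * cquad (B ** matrix_inv A) y)"

definition sqrt_branch :: "complex \<Rightarrow> (real \<Rightarrow> complex) \<Rightarrow> (real \<Rightarrow> complex) \<Rightarrow> bool" where
  "sqrt_branch s0 f s \<longleftrightarrow> continuous_on UNIV s \<and> (\<forall>t. (s t)\<^sup>2 = f t) \<and> s 0 = s0"

section \<open>The spaces \<open>\<Sigma>\<^sup>k\<close>\<close>

definition test_function :: "('a::euclidean_space \<Rightarrow> complex) \<Rightarrow> bool" where
  "test_function \<phi> \<longleftrightarrow> smooth \<phi> \<and> compact (closure {x. \<phi> x \<noteq> 0})"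

definition L2 :: "('a::euclidean_space \<Rightarrow> complex) \<Rightarrow> bool" where
  "L2 f \<longleftrightarrow> f \<in> borel_measurable lebesgue \<and> integrable lebesgue (\<lambda>x. (cmod (f x))\<^sup>2)"

definition L2_norm :: "('a::euclidean_space \<Rightarrow> complex) \<Rightarrow> real" where
  "L2_norm f = sqrt (\<integral>x. (cmod (f x))\<^sup>2 \<partial>lebesgue)"

definition locally_integrable :: "('a::euclidean_space \<Rightarrow> complex) \<Rightarrow> bool" where
  "locally_integrable f \<longleftrightarrow> (\<forall>K. compact K \<longrightarrow> set_integrable lebesgue K f)"

definition has_weak_deriv :: "(real ^ 'd::{finite,linorder} \<Rightarrow> complex) \<Rightarrow> 'd::{finite,linorder} multi_index
    \<Rightarrow> (real ^ 'd::{finite,linorder} \<Rightarrow> complex) \<Rightarrow> bool" where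
  "has_weak_deriv f \<beta> g \<longleftrightarrow> locally_integrable f \<and> locally_integrable g \<and>
     (\<forall>\<phi>. test_function \<phi> \<longrightarrow>
        (\<integral>x. f x * mi_deriv \<beta> \<phi> x \<partial>lebesgue)
          = (-1) ^ mi_order \<beta> * (\<integral>x. g x * \<phi> x \<partial>lebesgue))"

text \<open>The weak derivative is determined up to a null set.\<close>

definition weak_deriv :: "'d::{finite,linorder} multi_index
    \<Rightarrow> (real ^ 'd::{finite,linorder} \<Rightarrow> complex) \<Rightarrow> real ^ 'd::{finite,linorder} \<Rightarrow> complex" where
  "weak_deriv \<beta> f = (SOME g. has_weak_deriv f \<beta> g)"

definition in_Sigma :: "nat \<Rightarrow> (real ^ 'd::{finite,linorder} \<Rightarrow> complex) \<Rightarrow> bool" where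
  "in_Sigma k f \<longleftrightarrow> L2 f \<and>
     (\<forall>\<alpha> \<beta>. mi_order \<alpha> + mi_order \<beta> \<le> k \<longrightarrow>
        (\<exists>g. has_weak_deriv f \<beta> g) \<and> L2 (\<lambda>x. of_real (mi_power x \<alpha>) * weak_deriv \<beta> f x))"

definition Sigma_norm :: "nat \<Rightarrow> (real ^ 'd::{finite,linorder} \<Rightarrow> complex) \<Rightarrow> real" where
  "Sigma_norm k f = (\<Sum>(\<alpha>, \<beta>) | mi_order \<alpha> + mi_order \<beta> \<le> k.
     L2_norm (\<lambda>x. of_real (mi_power x \<alpha>) * weak_deriv \<beta> f x))"

lemma finite_mi_order_le: "finite {(\<alpha>::'d::finite multi_index, \<beta>::'d multi_index).
    mi_order \<alpha> + mi_order \<beta> \<le> k}"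
proof (rule finite_subset)
  let ?F = "{\<alpha>::'d multi_index. \<forall>j. (j \<in> UNIV \<longrightarrow> \<alpha> j \<in> {..k}) \<and> (j \<notin> UNIV \<longrightarrow> \<alpha> j = 0)}"
  have le: "\<alpha> j \<le> mi_order \<alpha>" for \<alpha> :: "'d multi_index" and j
    unfolding mi_order_def by (rule member_le_sum) auto
  show "{(\<alpha>::'d::finite multi_index, \<beta>::'d multi_index). mi_order \<alpha> + mi_order \<beta> \<le> k} \<subseteq> ?F \<times> ?F"
    by (auto intro: order_trans[OF le])
  show "finite (?F \<times> ?F)"
    by (intro finite_cartesian_product finite_set_of_finite_funs) auto
qed

text \<open>\<open>v \<in> C(\<real>; \<Sigma>\<^sup>k)\<close>, elements of \<open>\<Sigma>\<^sup>k\<close> being represented by functions.\<close>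

definition continuous_in_Sigma ::
    "nat \<Rightarrow> (real \<Rightarrow> real ^ 'd::{finite,linorder} \<Rightarrow> complex) \<Rightarrow> bool" where
  "continuous_in_Sigma k v \<longleftrightarrow> (\<forall>t. in_Sigma k (v t)) \<and>
     (\<forall>t. ((\<lambda>s. Sigma_norm k (\<lambda>y. v s y - v t y)) \<longlongrightarrow> 0) (at t))"

section \<open>The amplitude equation\<close>

text \<open>The equation \<open>i \<partial>\<^sub>tv = - \<Delta>v/2 + (y\<cdot>Qy)v/2 + (\<Omega>\<cdot>L)v\<close> in the sense of distributions on
  space-time \<open>\<real> \<times> \<real>\<^sup>d\<close>, paired bilinearly with test functions. The transposes of \<open>\<partial>\<^sub>t\<close> and
  \<open>\<Omega>\<cdot>L\<close> are \<open>- \<partial>\<^sub>t\<close> and \<open>- \<Omega>\<cdot>L\<close>; the latter because the field \<open>y \<mapsto> \<Omega> \<wedge> y\<close> is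
  divergence free.\<close>

definition amplitude_equation :: "(real ^ 'd \<Rightarrow> real ^ 'd) \<Rightarrow> (real \<Rightarrow> real ^ 'd ^ 'd)
    \<Rightarrow> (real \<Rightarrow> real ^ 'd \<Rightarrow> complex) \<Rightarrow> bool" where
  "amplitude_equation W Q v \<longleftrightarrow>
     (\<forall>\<phi>. test_function (\<lambda>(t, y). \<phi> t y) \<longrightarrow>
        (\<integral>t. (\<integral>y. v t y * (- \<i> * vector_derivative (\<lambda>s. \<phi> s y) (at t)) \<partial>lebesgue) \<partial>lebesgue)
        = (\<integral>t. (\<integral>y. v t y *
              (- (1/2) * laplacian (\<phi> t) y
               + (1/2) * of_real (y \<bullet> (Q t *v y)) * \<phi> t y
               - Omega_L W (\<phi> t) y) \<partial>lebesgue) \<partial>lebesgue))"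

definition amplitude_solution :: "nat
    \<Rightarrow> (real ^ 'd::{finite,linorder} \<Rightarrow> real ^ 'd::{finite,linorder})
    \<Rightarrow> (real \<Rightarrow> real ^ 'd::{finite,linorder} ^ 'd::{finite,linorder})
    \<Rightarrow> (real ^ 'd::{finite,linorder} \<Rightarrow> complex)
    \<Rightarrow> (real \<Rightarrow> real ^ 'd::{finite,linorder} \<Rightarrow> complex) \<Rightarrow> bool" where
  "amplitude_solution k W Q v0 v \<longleftrightarrow>
     continuous_in_Sigma k v \<and> amplitude_equation W Q v \<and> (AE y in lebesgue. v 0 y = v0 y)"

end

theory Submission
  imports Defs "HOL-Computational_Algebra.Polynomial"
begin

text \<open>The relations \<open>A\<^sup>T B = B\<^sup>T A\<close> and \<open>A\<^sup>* B + B\<^sup>* A = 2\<close> are equivalent to property (M). The flow changes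
  the defects of both relations by a commutator with the real skew matrix \<open>R\<^sub>\<Omega>\<close>, which preserves their
  Frobenius norm; hence (M) propagates. The matrix \<open>M = B A\<^sup>-\<^sup>1\<close> then solves a Riccati equation and
  \<open>(det A)\<^sup>-\<^sup>1\<^sup>/\<^sup>2\<close> a scalar one, so that the Gaussian is a classical solution.

  Since \<open>v\<close> is only a distributional solution in \<open>C(\<real>; L\<^sup>2)\<close>, its uniqueness is proved by duality. For every
  time \<open>T\<close> and frequency \<open>\<beta>\<close> there is an explicit Gaussian wave packet with the same \<open>M\<close> which solves the
  equation and equals the Gaussian times \<open>exp (- i \<beta>\<cdot>y)\<close> at time \<open>T\<close>: its linear exponent is
  \<open>A\<^sup>-\<^sup>T z\<close> with \<open>z' = - R\<^sub>\<Omega> z\<close>. The pairing of a solution with the conjugate of such a packet is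
  constant in time. Therefore \<open>v(T)\<close> minus the Gaussian, multiplied by a Gaussian, has vanishing Fourier
  transform, and is zero.\<close>

section \<open>Smooth functions\<close>

text \<open>The weak form of the equation leaves no room for an energy estimate: \<open>v\<close>
  has no time derivative that could be paired with \<open>v\<close> itself. What duality needs
  instead is a family of smooth, rapidly decaying solutions of the transposed equation whose data at
  time \<open>T\<close> determine a square integrable function. Gaussians stay Gaussians under a
  quadratic Hamiltonian, so each such solution costs only ordinary differential equations, and given
  \<open>A\<close> and \<open>B\<close> these are solved explicitly: conjugating a packet solves the
  transposed equation, the rotation is explicit because \<open>R\<close> satisfies
  \<open>R^3 = - \<omega>^2 R\<close>, and the amplitude is the exponential of an antiderivative.
  Sharing one \<open>M\<close> is what makes the quotient of two packets at time \<open>T\<close> a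
  constant times a character. The identity \<open>Re (y . M y) = |A^-1 y|^2\<close> gives decay
  locally uniformly in time, so packets may be cut off to admissible test functions with an error
  that vanishes. Building the amplitude by an exponential also yields the continuous square root of
  \<open>det A\<close> without a lifting argument.\<close>

primrec differentiable_upto :: "nat \<Rightarrow> ('a::euclidean_space \<Rightarrow> 'b::real_normed_vector) \<Rightarrow> bool" where
  "differentiable_upto 0 f \<longleftrightarrow> (\<forall>x. f differentiable (at x))"
| "differentiable_upto (Suc n) f \<longleftrightarrow> (\<forall>x. f differentiable (at x)) \<and>
     (\<forall>b\<in>Basis. differentiable_upto n (\<lambda>x. frechet_derivative f (at x) b))"

lemma iter_deriv_append: "iter_deriv (bs @ cs) f = iter_deriv bs (iter_deriv cs f)"
  by (induction bs) simp_all

text \<open>Closure under products and compositions is proved by induction on the order with the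
  functions generalized, and the recursive predicate is made for this. Order 0 already asks for
  differentiability, so \<open>n\<close> counts derivatives that are themselves
  differentiable.\<close>

lemma differentiable_upto_iff:
  "differentiable_upto n f \<longleftrightarrow>
     (\<forall>bs. set bs \<subseteq> Basis \<longrightarrow> length bs \<le> n \<longrightarrow> (\<forall>x. iter_deriv bs f differentiable (at x)))"
proof (induction n arbitrary: f)
  case (Suc n)
  show ?case (is "_ \<longleftrightarrow> ?R")
  proof
    assume l: "differentiable_upto (Suc n) f"
    show ?R
    proof (intro allI impI)
      fix bs :: "'a list" and x assume bs: "set bs \<subseteq> Basis" "length bs \<le> Suc n"
      show "iter_deriv bs f differentiable at x"
      \<comment> \<open>The head of \<open>bs\<close> is the derivative taken last, whereas the
        recursion of \<open>differentiable_upto\<close> differentiates \<open>f\<close> first; hence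
        the list is split at its end.\<close>
      proof (cases bs rule: rev_cases)
        case Nil then show ?thesis using l by simp
      next
        case (snoc cs b)
        with bs l Suc have "iter_deriv cs (\<lambda>x. frechet_derivative f (at x) b) differentiable at x"
          by simp
        then show ?thesis by (simp add: snoc iter_deriv_append)
      qed
    qed
  next
    assume r: ?R
    have "differentiable_upto n (\<lambda>x. frechet_derivative f (at x) b)" if "b \<in> Basis" for b
      unfolding Suc
    proof (intro allI impI)
      fix bs :: "'a list" and x assume "set bs \<subseteq> Basis" "length bs \<le> n"
      then show "iter_deriv bs (\<lambda>x. frechet_derivative f (at x) b) differentiable at x"
        using r[rule_format, of "bs @ [b]" x] that by (simp add: iter_deriv_append)
    qed
    then show "differentiable_upto (Suc n) f"
      using r[rule_format, of "[]"] by simp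
  qed
qed auto

lemma smooth_iff: "smooth f \<longleftrightarrow> (\<forall>n. differentiable_upto n f)"
  unfolding smooth_def differentiable_upto_iff by blast

lemma differentiable_uptoD: "differentiable_upto n f \<Longrightarrow> f differentiable (at x)"
  by (cases n) auto

lemma differentiable_upto_has_derivative:
  "differentiable_upto n f \<Longrightarrow> (f has_derivative frechet_derivative f (at x)) (at x)"
  by (meson differentiable_uptoD frechet_derivative_works)

lemma differentiable_upto_Suc_imp: "differentiable_upto (Suc n) f \<Longrightarrow> differentiable_upto n f"
  by (auto simp: differentiable_upto_iff)

lemma differentiable_upto_SucI:
  assumes "\<And>x. (f has_derivative f' x) (at x)"
    and "\<And>b. b \<in> Basis \<Longrightarrow> differentiable_upto n (\<lambda>x. f' x b)"
  shows "differentiable_upto (Suc n) f"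
proof -
  have "frechet_derivative f (at x) = f' x" for x
    using frechet_derivative_at[OF assms(1)] by simp
  then show ?thesis using assms by (auto simp: differentiable_def)
qed

lemma differentiable_upto_const [intro!, simp]: "differentiable_upto n (\<lambda>x. c)"
proof (induction n arbitrary: c)
  case (Suc n)
  show ?case by (rule differentiable_upto_SucI[where f' = "\<lambda>_ _. 0"]) (auto simp: Suc)
qed simp

lemma bounded_linear_differentiable_upto: "bounded_linear f \<Longrightarrow> differentiable_upto n f"
proof (cases n)
  case (Suc m)
  assume "bounded_linear f"
  then show ?thesis unfolding Suc
    by (intro differentiable_upto_SucI[where f' = "\<lambda>_. f"]) (auto intro: bounded_linear_imp_has_derivative)
qed (auto intro: bounded_linear_imp_has_derivative simp: differentiable_def)

lemma differentiable_upto_linear: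
  assumes L: "bounded_linear L"
  shows "differentiable_upto n f \<Longrightarrow> differentiable_upto n (\<lambda>x. L (f x))"
proof (induction n arbitrary: f)
  case 0
  then show ?case
    using bounded_linear.has_derivative[OF L] by (auto simp: differentiable_def) blast
next
  case (Suc n)
  have "((\<lambda>x. L (f x)) has_derivative (\<lambda>h. L (frechet_derivative f (at x) h))) (at x)" for x
    by (rule bounded_linear.has_derivative[OF L differentiable_upto_has_derivative[OF Suc.prems]])
  then show ?case
    by (rule differentiable_upto_SucI) (use Suc in auto)
qed

lemma differentiable_upto_add:
  "differentiable_upto n f \<Longrightarrow> differentiable_upto n g \<Longrightarrow> differentiable_upto n (\<lambda>x. f x + g x)"
proof (induction n arbitrary: f g)
  case (Suc n)
  have "((\<lambda>x. f x + g x) has_derivative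
      (\<lambda>h. frechet_derivative f (at x) h + frechet_derivative g (at x) h)) (at x)" for x
    by (rule has_derivative_add[OF differentiable_upto_has_derivative[OF Suc.prems(1)] differentiable_upto_has_derivative[OF Suc.prems(2)]])
  then show ?case
    by (rule differentiable_upto_SucI) (use Suc in auto)
qed auto

lemma differentiable_upto_bilinear:
  assumes L: "bounded_bilinear L"
  shows "differentiable_upto n f \<Longrightarrow> differentiable_upto n g \<Longrightarrow> differentiable_upto n (\<lambda>x. L (f x) (g x))"
proof (induction n arbitrary: f g)
  case 0
  then show ?case
    using bounded_bilinear.FDERIV[OF L] by (auto simp: differentiable_def) blast
next
  case (Suc n)
  have "((\<lambda>x. L (f x) (g x)) has_derivative
      (\<lambda>h. L (f x) (frechet_derivative g (at x) h) + L (frechet_derivative f (at x) h) (g x))) (at x)" for x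
    by (rule bounded_bilinear.FDERIV[OF L differentiable_upto_has_derivative[OF Suc.prems(1)] differentiable_upto_has_derivative[OF Suc.prems(2)]])
  then show ?case
    by (rule differentiable_upto_SucI)
      (use Suc differentiable_upto_Suc_imp[OF Suc.prems(1)] differentiable_upto_Suc_imp[OF Suc.prems(2)]
        in \<open>auto intro!: differentiable_upto_add\<close>)
qed

lemma differentiable_upto_sum:
  "(\<And>i. i \<in> I \<Longrightarrow> differentiable_upto n (f i)) \<Longrightarrow> differentiable_upto n (\<lambda>x. \<Sum>i\<in>I. f i x)"
  by (induction I rule: infinite_finite_induct) (auto intro: differentiable_upto_add)

lemmas differentiable_upto_mult = differentiable_upto_bilinear[OF bounded_bilinear_mult]
lemmas differentiable_upto_scaleR = differentiable_upto_bilinear[OF bounded_bilinear_scaleR]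
lemmas differentiable_upto_inner = differentiable_upto_bilinear[OF bounded_bilinear_inner]
lemmas differentiable_upto_of_real = differentiable_upto_linear[OF bounded_linear_of_real]
lemmas differentiable_upto_minus = differentiable_upto_linear[OF bounded_linear_minus[OF bounded_linear_ident]]
lemmas differentiable_upto_fst = differentiable_upto_linear[OF bounded_linear_fst]
lemmas differentiable_upto_snd = differentiable_upto_linear[OF bounded_linear_snd]
lemmas differentiable_upto_nth = differentiable_upto_linear[OF bounded_linear_vec_nth]
lemmas differentiable_upto_cnj = differentiable_upto_linear[OF bounded_linear_cnj]
lemmas differentiable_upto_ident = bounded_linear_differentiable_upto[OF bounded_linear_ident]

lemma differentiable_upto_diff:
  "differentiable_upto n f \<Longrightarrow> differentiable_upto n g \<Longrightarrow> differentiable_upto n (\<lambda>x. f x - g x)"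
  using differentiable_upto_add[OF _ differentiable_upto_minus, of n f g] by simp

lemmas differentiable_upto_intros = differentiable_upto_const differentiable_upto_add
  differentiable_upto_diff differentiable_upto_minus differentiable_upto_mult
  differentiable_upto_scaleR differentiable_upto_inner differentiable_upto_of_real
  differentiable_upto_fst differentiable_upto_snd differentiable_upto_nth
  differentiable_upto_cnj differentiable_upto_sum differentiable_upto_ident

lemma differentiable_upto_compose:
  fixes f :: "'b::euclidean_space \<Rightarrow> 'c::real_normed_vector" and g :: "'a::euclidean_space \<Rightarrow> 'b"
  shows "differentiable_upto n f \<Longrightarrow> differentiable_upto n g \<Longrightarrow> differentiable_upto n (\<lambda>x. f (g x))"
proof (induction n arbitrary: f g)
  case 0
  then show ?case using differentiable_chain_at[of g _ f] by (auto simp: o_def)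
next
  case (Suc n)
  let ?f' = "\<lambda>x. frechet_derivative f (at x)" and ?g' = "\<lambda>x. frechet_derivative g (at x)"
  have df: "(f has_derivative ?f' x) (at x)" for x
    by (rule differentiable_upto_has_derivative, rule Suc.prems)
  have dg: "(g has_derivative ?g' x) (at x)" for x
    by (rule differentiable_upto_has_derivative, rule Suc.prems)
  \<comment> \<open>In the chain rule the direction \<open>?g' x h\<close> varies with
    \<open>x\<close>. Expanding it in the basis leaves only derivatives of \<open>f\<close> in fixed
    directions \<open>j\<close>, and these, composed with \<open>g\<close>, fall under the induction
    hypothesis.\<close>
  have "((\<lambda>x. f (g x)) has_derivative (\<lambda>h. \<Sum>j\<in>Basis. (?g' x h \<bullet> j) *\<^sub>R ?f' (g x) j)) (at x)" for x
  proof -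
    have lin: "linear (?f' (g x))" using df has_derivative_linear by blast
    have "((\<lambda>x. f (g x)) has_derivative (\<lambda>h. ?f' (g x) (?g' x h))) (at x)"
      by (rule has_derivative_compose[OF dg df])
    moreover have "?f' (g x) v = (\<Sum>j\<in>Basis. (v \<bullet> j) *\<^sub>R ?f' (g x) j)" for v
    proof -
      have "?f' (g x) v = ?f' (g x) (\<Sum>j\<in>Basis. (v \<bullet> j) *\<^sub>R j)"
        by (simp only: euclidean_representation)
      also have "\<dots> = (\<Sum>j\<in>Basis. (v \<bullet> j) *\<^sub>R ?f' (g x) j)"
        by (simp only: linear_sum[OF lin] linear_cmul[OF lin])
      finally show ?thesis .
    qed
    ultimately show ?thesis by (rule has_derivative_eq_rhs[OF _ ext])
  qed
  then show ?case
    by (rule differentiable_upto_SucI)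
      (use Suc differentiable_upto_Suc_imp[OF Suc.prems(1)] differentiable_upto_Suc_imp[OF Suc.prems(2)]
        in \<open>auto intro!: differentiable_upto_intros\<close>)
qed

text \<open>The bootstrap for solutions of ordinary differential equations: regularity of the
  right-hand side gives one more order.\<close>

lemma differentiable_upto_real_SucI:
  fixes f :: "real \<Rightarrow> 'b::real_normed_vector"
  assumes "\<And>t. (f has_vector_derivative f' t) (at t)" "differentiable_upto n f'"
  shows "differentiable_upto (Suc n) f"
  by (rule differentiable_upto_SucI[where f' = "\<lambda>t h. h *\<^sub>R f' t"])
    (use assms in \<open>auto simp: has_vector_derivative_def\<close>)

lemma differentiable_upto_exp:
  fixes f :: "'a::euclidean_space \<Rightarrow> complex"
  shows "differentiable_upto n f \<Longrightarrow> differentiable_upto n (\<lambda>x. exp (f x))"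
proof (induction n)
  case 0
  then show ?case
    using has_derivative_compose[OF differentiable_upto_has_derivative[OF 0]
      DERIV_exp[unfolded has_field_derivative_def]]
    by (auto simp: differentiable_def)
next
  case (Suc n)
  have "((\<lambda>x. exp (f x)) has_derivative (\<lambda>h. exp (f x) * frechet_derivative f (at x) h)) (at x)" for x
    by (rule has_derivative_compose[OF differentiable_upto_has_derivative[OF Suc.prems]
      DERIV_exp[unfolded has_field_derivative_def]])
  then show ?case
    by (rule differentiable_upto_SucI)
      (use Suc differentiable_upto_Suc_imp[OF Suc.prems] in \<open>auto intro!: differentiable_upto_intros\<close>)
qed

lemma differentiable_upto_inverse:
  fixes f :: "'a::euclidean_space \<Rightarrow> real"
  assumes nz: "\<And>x. f x \<noteq> 0"
  shows "differentiable_upto n f \<Longrightarrow> differentiable_upto n (\<lambda>x. inverse (f x))"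
proof (induction n)
  case 0
  then show ?case using nz differentiable_inverse by fastforce
next
  case (Suc n)
  have "((\<lambda>x. inverse (f x)) has_derivative
      (\<lambda>h. - (inverse (f x) * frechet_derivative f (at x) h * inverse (f x)))) (at x)" for x
    by (rule Deriv.has_derivative_inverse) (use nz differentiable_upto_has_derivative[OF Suc.prems] in auto)
  then show ?case
    by (rule differentiable_upto_SucI)
      (use Suc differentiable_upto_Suc_imp[OF Suc.prems] in \<open>auto intro!: differentiable_upto_intros\<close>)
qed

lemma smooth_frechet_derivative:
  "smooth f \<Longrightarrow> b \<in> Basis \<Longrightarrow> smooth (\<lambda>x. frechet_derivative f (at x) b)"
  unfolding smooth_iff using differentiable_upto.simps(2) by blast

lemma smooth_iter_deriv: "smooth f \<Longrightarrow> set bs \<subseteq> Basis \<Longrightarrow> smooth (iter_deriv bs f)"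
  by (induction bs) (auto intro: smooth_frechet_derivative)

lemma smooth_has_derivative: "smooth f \<Longrightarrow> (f has_derivative frechet_derivative f (at x)) (at x)"
  by (meson differentiable_uptoD frechet_derivative_works smooth_iff)

lemma smooth_continuous: "smooth f \<Longrightarrow> continuous_on A f"
  by (meson continuous_at_imp_continuous_on has_derivative_continuous smooth_has_derivative)

text \<open>The mean value theorem, applied along \<open>a\<close> and then along \<open>b\<close>,
  turns the second difference quotient into \<open>f''\<close> at a nearby point. The quotient is
  symmetric in \<open>a\<close> and \<open>b\<close>, which is why mixed derivatives
  commute.\<close>

lemma second_derivative_as_limit:
  fixes f :: "'a::real_normed_vector \<Rightarrow> real"
  assumes f: "\<And>x. (f has_derivative f' x) (at x)"
    and f'': "\<And>x. ((\<lambda>x. f' x a) has_derivative f'' x) (at x)"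
    and cont: "continuous_on UNIV (\<lambda>x. f'' x b)"
  shows "((\<lambda>h. (f (x + h *\<^sub>R a + h *\<^sub>R b) - f (x + h *\<^sub>R a) - f (x + h *\<^sub>R b) + f x) / (h * h))
           \<longlongrightarrow> f'' x b) (at_right 0)"
proof (rule tendstoI)
  fix e :: real assume e: "e > 0"
  have "continuous (at x) (\<lambda>x. f'' x b)" using cont by (simp add: continuous_on_eq_continuous_at)
  then obtain d where d: "d > 0" "\<And>y. dist y x < d \<Longrightarrow> dist (f'' y b) (f'' x b) < e"
    using e by (metis continuous_at_eps_delta dist_norm dist_commute)
  let ?N = "norm a + norm b + 1"
  have N: "?N > 0" by (simp add: add_nonneg_pos)
  have main: "dist ((f (x + h *\<^sub>R a + h *\<^sub>R b) - f (x + h *\<^sub>R a) - f (x + h *\<^sub>R b) + f x) / (h * h)) (f'' x b) < e"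
    if h: "0 < h" "h < d / ?N" for h
  proof -
    define g where "g s = f (x + s *\<^sub>R a + h *\<^sub>R b) - f (x + s *\<^sub>R a)" for s
    have g: "(g has_real_derivative (f' (x + s *\<^sub>R a + h *\<^sub>R b) a - f' (x + s *\<^sub>R a) a)) (at s)" for s
    proof -
      have *: "((\<lambda>s. f (y + s *\<^sub>R a)) has_real_derivative f' (y + s *\<^sub>R a) a) (at s)" for y
      proof -
        have "((\<lambda>s. y + s *\<^sub>R a) has_derivative (\<lambda>s. s *\<^sub>R a)) (at s)"
          by (auto intro!: derivative_eq_intros)
        from has_derivative_compose[OF this f]
        have "((\<lambda>s. f (y + s *\<^sub>R a)) has_derivative (\<lambda>t. f' (y + s *\<^sub>R a) (t *\<^sub>R a))) (at s)" .
        moreover have "(\<lambda>t. f' (y + s *\<^sub>R a) (t *\<^sub>R a)) = (*) (f' (y + s *\<^sub>R a) a)"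
          using linear_cmul[OF has_derivative_linear[OF f]] by (auto simp: mult.commute)
        ultimately show ?thesis by (simp add: has_field_derivative_def)
      qed
      from DERIV_diff[OF *[of "x + h *\<^sub>R b"] *[of x]] show ?thesis
        by (simp add: g_def[abs_def] algebra_simps)
    qed
    obtain s where s: "0 < s" "s < h" and gs: "g h - g 0 = h * (f' (x + s *\<^sub>R a + h *\<^sub>R b) a - f' (x + s *\<^sub>R a) a)"
      using MVT2[OF h(1) g] by auto
    define k where "k r = f' (x + s *\<^sub>R a + r *\<^sub>R b) a" for r
    have k: "(k has_real_derivative f'' (x + s *\<^sub>R a + r *\<^sub>R b) b) (at r)" for r
    proof -
      have "((\<lambda>r. x + s *\<^sub>R a + r *\<^sub>R b) has_derivative (\<lambda>r. r *\<^sub>R b)) (at r)"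
        by (auto intro!: derivative_eq_intros)
      from has_derivative_compose[OF this f'']
      have "(k has_derivative (\<lambda>t. f'' (x + s *\<^sub>R a + r *\<^sub>R b) (t *\<^sub>R b))) (at r)"
        by (simp add: k_def[abs_def])
      moreover have "(\<lambda>t. f'' (x + s *\<^sub>R a + r *\<^sub>R b) (t *\<^sub>R b)) = (*) (f'' (x + s *\<^sub>R a + r *\<^sub>R b) b)"
        using linear_cmul[OF has_derivative_linear[OF f'']] by (auto simp: mult.commute)
      ultimately show ?thesis by (simp add: has_field_derivative_def)
    qed
    obtain r where r: "0 < r" "r < h" and kr: "k h - k 0 = h * f'' (x + s *\<^sub>R a + r *\<^sub>R b) b"
      using MVT2[OF h(1) k] by auto
    have "f (x + h *\<^sub>R a + h *\<^sub>R b) - f (x + h *\<^sub>R a) - f (x + h *\<^sub>R b) + f x = g h - g 0"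
      by (simp add: g_def)
    also have "\<dots> = h * h * f'' (x + s *\<^sub>R a + r *\<^sub>R b) b"
      using gs kr by (simp add: k_def)
    finally have eq: "(f (x + h *\<^sub>R a + h *\<^sub>R b) - f (x + h *\<^sub>R a) - f (x + h *\<^sub>R b) + f x) / (h * h)
        = f'' (x + s *\<^sub>R a + r *\<^sub>R b) b"
      using h by simp
    have "dist (x + s *\<^sub>R a + r *\<^sub>R b) x = norm (s *\<^sub>R a + r *\<^sub>R b)"
      by (simp add: dist_norm add.assoc)
    also have "\<dots> \<le> s * norm a + r * norm b"
      using norm_triangle_ineq[of "s *\<^sub>R a" "r *\<^sub>R b"] s r by simp
    also have "\<dots> \<le> h * norm a + h * norm b"
      by (intro add_mono mult_right_mono) (use s r in auto)
    also have "\<dots> < h * ?N" using h by (simp add: algebra_simps)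
    also have "\<dots> < d" using h N by (simp add: field_simps)
    finally show ?thesis unfolding eq using d(2) by blast
  qed
  have "\<forall>\<^sub>F h in at_right 0. 0 < h \<and> h < d / ?N"
    using d N by (intro eventually_conj eventually_at_right_less) (auto simp: eventually_at_right_field intro!: exI[of _ "d / ?N"])
  then show "\<forall>\<^sub>F h in at_right 0. dist ((f (x + h *\<^sub>R a + h *\<^sub>R b) - f (x + h *\<^sub>R a) - f (x + h *\<^sub>R b) + f x) / (h * h)) (f'' x b) < e"
    by (rule eventually_mono) (use main in auto)
qed

lemma smooth_second_derivatives_commute:
  fixes f :: "'a::euclidean_space \<Rightarrow> real"
  assumes f: "smooth f" and ab: "a \<in> Basis" "b \<in> Basis"
  shows "iter_deriv [a, b] f x = iter_deriv [b, a] f x"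
proof -
  let ?D = "\<lambda>a x. frechet_derivative f (at x) a"
  have D: "((?D a) has_derivative frechet_derivative (?D a) (at x)) (at x)" if "a \<in> Basis" for a x
    using smooth_frechet_derivative[OF f that] smooth_has_derivative by blast
  have C: "continuous_on UNIV (\<lambda>x. frechet_derivative (?D a) (at x) b)"
    if "a \<in> Basis" "b \<in> Basis" for a b
    using smooth_continuous[OF smooth_iter_deriv[OF f, of "[b, a]"]] that by simp
  let ?q = "\<lambda>a b h. (f (x + h *\<^sub>R a + h *\<^sub>R b) - f (x + h *\<^sub>R a) - f (x + h *\<^sub>R b) + f x) / (h * h)"
  have L: "(?q a b \<longlongrightarrow> iter_deriv [b, a] f x) (at_right 0)" if "a \<in> Basis" "b \<in> Basis" for a b
    using second_derivative_as_limit[OF smooth_has_derivative[OF f] D[OF that(1)] C[OF that]] by simp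
  have "?q b a = ?q a b"
    by (simp add: fun_eq_iff add.assoc add.commute[of "_ *\<^sub>R a" "_ *\<^sub>R b"])
  then have "(?q a b \<longlongrightarrow> iter_deriv [a, b] f x) (at_right 0)"
    using L[OF ab(2,1)] by simp
  moreover have "(?q a b \<longlongrightarrow> iter_deriv [b, a] f x) (at_right 0)"
    by (rule L[OF ab])
  ultimately show ?thesis
    using tendsto_unique trivial_limit_at_right_real by blast
qed

lemma transpose_hessian:
  assumes "smooth V" shows "transpose (hessian V x) = hessian V x"
proof -
  have "hessian V x $ l $ j = hessian V x $ j $ l" for j l
    using smooth_second_derivatives_commute[OF assms, of "axis l 1" "axis j 1" x]
    by (simp add: hessian_def partial_deriv_def)
  then show ?thesis by (simp add: transpose_def vec_eq_iff)
qed

section \<open>A smooth step\<close>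

text \<open>The polynomial parameter closes the family under differentiation: with
  \<open>z = 1/x\<close>, the derivative of \<open>p(z) exp(-z)\<close> is
  \<open>z^2 (p - p')(z) exp(-z)\<close>. Smoothness is then a plain induction.\<close>

definition flat_exp :: "real poly \<Rightarrow> real \<Rightarrow> real" where
  "flat_exp p x = (if x > 0 then poly p (inverse x) * exp (- inverse x) else 0)"

text \<open>The extra power \<open>z ^ k\<close> carries the induction over the coefficients, since
  \<open>pCons\<close> multiplies the remaining polynomial by \<open>z\<close>.\<close>

lemma poly_times_exp_minus_tendsto_0:
  "((\<lambda>z::real. z ^ k * poly p z * exp (- z)) \<longlongrightarrow> 0) at_top"
proof (induction p arbitrary: k)
  case (pCons a p)
  have "((\<lambda>z::real. a * (z ^ k / exp z) + z ^ Suc k * poly p z * exp (- z)) \<longlongrightarrow> a * 0 + 0) at_top"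
    by (intro tendsto_intros tendsto_power_div_exp_0 pCons)
  then show ?case
    by (simp add: algebra_simps exp_minus divide_inverse)
qed simp

lemma flat_exp_DERIV:
  "(flat_exp p has_real_derivative flat_exp ([:0, 0, 1:] * (p - pderiv p)) x) (at x)"
proof -
  consider "x > 0" | "x < 0" | "x = 0" by linarith
  then show ?thesis
  proof cases
    case 1
    have "((\<lambda>x. poly p (inverse x) * exp (- inverse x)) has_real_derivative
        flat_exp ([:0, 0, 1:] * (p - pderiv p)) x) (at x)"
      using 1 by (auto intro!: derivative_eq_intros DERIV_chain2[OF poly_DERIV]
          simp: flat_exp_def algebra_simps power2_eq_square)
    then show ?thesis
      by (rule has_field_derivative_transform_within_open[of _ _ _ "{0<..}"])
        (use 1 in \<open>auto simp: flat_exp_def\<close>)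
  next
    case 2
    have "((\<lambda>x. 0) has_real_derivative flat_exp ([:0, 0, 1:] * (p - pderiv p)) x) (at x)"
      using 2 by (simp add: flat_exp_def)
    then show ?thesis
      by (rule has_field_derivative_transform_within_open[of _ _ _ "{..<0}"])
        (use 2 in \<open>auto simp: flat_exp_def\<close>)
  next
    case 3
    have "((\<lambda>h. flat_exp p h / h) \<longlongrightarrow> 0) (at_left 0)"
      by (rule tendsto_eventually) (auto simp: flat_exp_def eventually_at_left_field intro: exI[of _ "-1"])
    moreover have "((\<lambda>h. flat_exp p h / h) \<longlongrightarrow> 0) (at_right 0)"
    proof (rule Lim_transform_eventually)
      \<comment> \<open>With \<open>z = inverse h\<close> the difference quotient at 0 is
        \<open>z * poly p z * exp (- z)\<close>, the case \<open>k = 1\<close> of the limit at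
        infinity.\<close>
      show "((\<lambda>h. (inverse h) ^ 1 * poly p (inverse h) * exp (- inverse h)) \<longlongrightarrow> 0) (at_right (0::real))"
        by (rule filterlim_compose[OF poly_times_exp_minus_tendsto_0 filterlim_inverse_at_top_right])
      show "\<forall>\<^sub>F h in at_right 0. (inverse h) ^ 1 * poly p (inverse h) * exp (- inverse h) = flat_exp p h / h"
        by (auto simp: eventually_at_right_field flat_exp_def divide_inverse intro: exI[of _ 1])
    qed
    ultimately have "((\<lambda>h. flat_exp p h / h) \<longlongrightarrow> 0) (at 0)"
      by (rule filterlim_split_at)
    then show ?thesis using 3 by (simp add: has_field_derivative_iff flat_exp_def)
  qed
qed

lemma differentiable_upto_flat_exp: "differentiable_upto n (flat_exp p)"
proof (induction n arbitrary: p)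
  case 0
  then show ?case
    using flat_exp_DERIV[of p, unfolded has_field_derivative_def] by (auto simp: differentiable_def)
next
  case (Suc n)
  show ?case
    by (rule differentiable_upto_real_SucI[OF flat_exp_DERIV[unfolded has_real_derivative_iff_has_vector_derivative] Suc])
qed

text \<open>The denominator is positive everywhere because \<open>x > 0\<close> or
  \<open>1 - x > 0\<close>; the quotient is 0 up to 0 and 1 from 1 on.\<close>

definition smooth_step :: "real \<Rightarrow> real" where
  "smooth_step x = flat_exp 1 x * inverse (flat_exp 1 x + flat_exp 1 (1 - x))"

lemma smooth_smooth_step: "smooth smooth_step"
proof -
  have "flat_exp 1 x + flat_exp 1 (1 - x) \<noteq> 0" for x
    by (cases "x > 0"; cases "x < 1") (auto simp: flat_exp_def add_pos_pos less_imp_neq[symmetric])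
  then show ?thesis
    unfolding smooth_step_def[abs_def] smooth_iff
    by (intro allI differentiable_upto_intros differentiable_upto_inverse differentiable_upto_flat_exp
        differentiable_upto_compose[of _ "flat_exp 1" "\<lambda>x. 1 - x"]) auto
qed

lemma smooth_step_eq_0: "x \<le> 0 \<Longrightarrow> smooth_step x = 0"
  by (simp add: smooth_step_def flat_exp_def)

lemma smooth_step_eq_1: "1 \<le> x \<Longrightarrow> smooth_step x = 1"
  by (simp add: smooth_step_def flat_exp_def)

lemma smooth_step_bounds: "0 \<le> smooth_step x" "smooth_step x \<le> 1"
proof -
  have *: "flat_exp 1 x \<ge> 0" for x by (simp add: flat_exp_def)
  show "0 \<le> smooth_step x" "smooth_step x \<le> 1"
    using *[of x] *[of "1 - x"] unfolding smooth_step_def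
    by (auto simp: divide_inverse[symmetric] divide_le_eq_1)
qed

definition smooth_step' :: "real \<Rightarrow> real" where
  "smooth_step' x = frechet_derivative smooth_step (at x) 1"

definition smooth_step'' :: "real \<Rightarrow> real" where
  "smooth_step'' x = frechet_derivative smooth_step' (at x) 1"

lemma smooth_smooth_step': "smooth smooth_step'" "smooth smooth_step''"
  using smooth_frechet_derivative[OF smooth_smooth_step, of 1]
    smooth_frechet_derivative[of smooth_step' 1]
  by (simp_all add: smooth_step'_def[abs_def] smooth_step''_def[abs_def])

lemma smooth_has_real_derivative:
  fixes f :: "real \<Rightarrow> real"
  assumes "smooth f"
  shows "(f has_real_derivative frechet_derivative f (at x) 1) (at x)"
proof -
  have "linear (frechet_derivative f (at x))"
    using smooth_has_derivative[OF assms] has_derivative_linear by blast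
  then have "frechet_derivative f (at x) h = frechet_derivative f (at x) 1 * h" for h
    using linear_cmul[of "frechet_derivative f (at x)" h 1] by (simp add: mult.commute)
  then have "frechet_derivative f (at x) = (*) (frechet_derivative f (at x) 1)" by blast
  with smooth_has_derivative[OF assms, of x] show ?thesis
    by (simp add: has_field_derivative_def)
qed

lemma smooth_step_DERIV:
  "(smooth_step has_real_derivative smooth_step' x) (at x)"
  "(smooth_step' has_real_derivative smooth_step'' x) (at x)"
  unfolding smooth_step'_def[of x] smooth_step''_def
  by (intro smooth_has_real_derivative smooth_smooth_step smooth_smooth_step')+

lemma DERIV_eventually_const:
  fixes f :: "real \<Rightarrow> real"
  assumes "open S" "x \<in> S" "\<And>y. y \<in> S \<Longrightarrow> f y = c" "(f has_real_derivative d) (at x)"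
  shows "d = 0"
proof -
  have "((\<lambda>x. c) has_real_derivative d) (at x)"
    by (rule has_field_derivative_transform_within_open[OF assms(4,1,2)]) (use assms(3) in auto)
  then show ?thesis using DERIV_const DERIV_unique by blast
qed

lemma smooth_step_derivatives_outside:
  assumes "x < 0 \<or> x > 1" shows "smooth_step' x = 0" "smooth_step'' x = 0"
proof -
  have *: "smooth_step' y = 0" if "y < 0 \<or> y > 1" for y
    using that
  proof
    assume "y < 0" then show ?thesis
      by (intro DERIV_eventually_const[of "{..<0}" _ smooth_step 0, OF _ _ _ smooth_step_DERIV(1)])
        (auto simp: smooth_step_eq_0)
  next
    assume "y > 1" then show ?thesis
      by (intro DERIV_eventually_const[of "{1<..}" _ smooth_step 1, OF _ _ _ smooth_step_DERIV(1)])
        (auto simp: smooth_step_eq_1)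
  qed
  from * assms show "smooth_step' x = 0" by blast
  show "smooth_step'' x = 0"
    by (rule DERIV_eventually_const[of "{..<0} \<union> {1<..}" _ smooth_step' 0, OF _ _ _ smooth_step_DERIV(2)])
      (use assms * in auto)
qed

lemma smooth_step_derivatives_bounded:
  obtains C where "C \<ge> 0" "\<And>x. \<bar>smooth_step' x\<bar> \<le> C" "\<And>x. \<bar>smooth_step'' x\<bar> \<le> C"
proof -
  have b: "bounded (f ` {0..1})" if "smooth f" for f :: "real \<Rightarrow> real"
    by (intro compact_imp_bounded compact_continuous_image smooth_continuous that compact_Icc)
  obtain C1 where C1: "\<And>x. x \<in> {0..1} \<Longrightarrow> \<bar>smooth_step' x\<bar> \<le> C1"
    using b[OF smooth_smooth_step'(1)] unfolding bounded_iff by (metis imageI real_norm_def)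
  obtain C2 where C2: "\<And>x. x \<in> {0..1} \<Longrightarrow> \<bar>smooth_step'' x\<bar> \<le> C2"
    using b[OF smooth_smooth_step'(2)] unfolding bounded_iff by (metis imageI real_norm_def)
  have 1: "\<bar>smooth_step' x\<bar> \<le> \<bar>C1\<bar> + \<bar>C2\<bar>" for x
    using C1[of x] smooth_step_derivatives_outside(1)[of x] by (cases "x \<in> {0..1}") auto
  have 2: "\<bar>smooth_step'' x\<bar> \<le> \<bar>C1\<bar> + \<bar>C2\<bar>" for x
    using C2[of x] smooth_step_derivatives_outside(2)[of x] by (cases "x \<in> {0..1}") auto
  show ?thesis by (rule that[OF _ 1 2]) simp
qed

section \<open>Matrices and the flow of property (M)\<close>

abbreviation cmat :: "real ^ 'n ^ 'm \<Rightarrow> complex ^ 'n ^ 'm" where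
  "cmat \<equiv> map_matrix complex_of_real"

definition imat :: "complex ^ 'n ^ 'm \<Rightarrow> complex ^ 'n ^ 'm" where
  "imat = map_matrix (\<lambda>z. \<i> * z)"

lemma imat_nth [simp]: "imat A $ i $ j = \<i> * A $ i $ j"
  by (simp add: imat_def)

lemma matrix_inv_inverse:
  fixes A :: "'a::field ^ 'n ^ 'n"
  assumes "invertible A"
  shows "A ** matrix_inv A = mat 1" "matrix_inv A ** A = mat 1"
  using assms someI_ex[of "\<lambda>A'. A ** A' = mat 1 \<and> A' ** A = mat 1"]
  by (auto simp: invertible_def matrix_inv_def)

lemma matrix_inv_eqI:
  fixes A :: "'a::field ^ 'n ^ 'n"
  assumes "A ** B = mat 1" shows "matrix_inv A = B"
proof -
  have "invertible A" using assms invertible_right_inverse by blast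
  then have "matrix_inv A ** (A ** B) = B"
    by (simp add: matrix_mul_assoc matrix_inv_inverse)
  then show ?thesis using assms by simp
qed

lemma matrix_add_rdistrib:
  fixes A :: "'a::semiring_1 ^ 'n ^ 'm"
  shows "(A + B) ** C = A ** C + B ** C"
  by (simp add: matrix_matrix_mult_def vec_eq_iff sum.distrib distrib_right)

lemma matrix_diff_distribs:
  fixes A :: "'a::ring_1 ^ 'n ^ 'm"
  shows "(A - B) ** C = A ** C - B ** C" "A ** (D - E) = A ** D - A ** E"
  by (simp_all add: matrix_matrix_mult_def vec_eq_iff sum_subtractf left_diff_distrib right_diff_distrib)

lemma matrix_minus_mult:
  fixes A :: "'a::ring_1 ^ 'n ^ 'm"
  shows "(- A) ** C = - (A ** C)" "A ** (- D) = - (A ** D)"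
  by (simp_all add: matrix_matrix_mult_def vec_eq_iff sum_negf)

lemma imat_mult: "imat A ** B = imat (A ** B)" "A ** imat B = imat (A ** B)"
  by (simp_all add: matrix_matrix_mult_def vec_eq_iff sum_distrib_left mult_ac)

lemma imat_add: "imat (A + B) = imat A + imat B" "imat (A - B) = imat A - imat B" "imat (- A) = - imat A"
  by (simp_all add: vec_eq_iff algebra_simps)

lemma imat_imat: "imat (imat A) = - A"
  by (simp add: vec_eq_iff)

lemma transpose_linear:
  fixes A :: "'a::ring_1 ^ 'n ^ 'm"
  shows "transpose (A + B) = transpose A + transpose B" "transpose (A - B) = transpose A - transpose B"
    "transpose (- A) = - transpose A"
  by (simp_all add: vec_eq_iff transpose_def)

lemma transpose_imat: "transpose (imat A) = imat (transpose A)"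
  by (simp add: vec_eq_iff transpose_def)

lemma conj_transpose_nth [simp]: "conj_transpose A $ i $ j = cnj (A $ j $ i)"
  by (simp add: conj_transpose_def transpose_def)

lemma conj_transpose_linear:
  "conj_transpose (A + B) = conj_transpose A + conj_transpose B"
  "conj_transpose (A - B) = conj_transpose A - conj_transpose B"
  "conj_transpose (imat A) = - imat (conj_transpose A)"
  by (simp_all add: vec_eq_iff)

lemma conj_transpose_mult: "conj_transpose (A ** B) = conj_transpose B ** conj_transpose A"
  by (simp add: vec_eq_iff matrix_matrix_mult_def mult.commute)

lemma conj_transpose_cmat: "conj_transpose (cmat R) = cmat (transpose R)" "transpose (cmat R) = cmat (transpose R)"
  by (simp_all add: vec_eq_iff transpose_def)

lemma cmat_mult: "cmat (A ** B) = cmat A ** cmat B"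
  by (simp add: vec_eq_iff matrix_matrix_mult_def)

lemma cmat_minus: "cmat (- A) = - cmat A"
  by (simp add: vec_eq_iff)

definition hermitian_inner :: "complex ^ 'n \<Rightarrow> complex ^ 'n \<Rightarrow> complex" where
  "hermitian_inner x y = (\<Sum>i\<in>UNIV. cnj (x $ i) * y $ i)"

lemma hermitian_inner_adjoint:
  "hermitian_inner x (conj_transpose A *v y) = hermitian_inner (A *v x) y"
proof -
  have "hermitian_inner x (conj_transpose A *v y) = (\<Sum>i\<in>UNIV. \<Sum>j\<in>UNIV. cnj (x $ i) * (cnj (A $ j $ i) * y $ j))"
    by (simp add: hermitian_inner_def matrix_vector_mult_def sum_distrib_left)
  also have "\<dots> = (\<Sum>j\<in>UNIV. \<Sum>i\<in>UNIV. cnj (x $ i) * (cnj (A $ j $ i) * y $ j))"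
    by (rule sum.swap)
  also have "\<dots> = hermitian_inner (A *v x) y"
    by (simp add: hermitian_inner_def matrix_vector_mult_def sum_distrib_left sum_distrib_right mult_ac)
  finally show ?thesis .
qed

lemma Re_hermitian_inner_self: "Re (hermitian_inner x x) = (norm x)\<^sup>2"
  by (simp add: hermitian_inner_def norm_vec_def L2_set_def sum_nonneg cmod_power2)
    (simp add: power2_eq_square)

lemma Re_hermitian_inner_commute: "Re (hermitian_inner x y) = Re (hermitian_inner y x)"
  by (simp add: hermitian_inner_def algebra_simps)

text \<open>A polynomial form of property (M), whose defects evolve linearly under the flow.\<close>

definition lagrangian_pair :: "complex ^ 'n ^ 'n \<Rightarrow> complex ^ 'n ^ 'n \<Rightarrow> bool" where
  "lagrangian_pair A B \<longleftrightarrow> transpose A ** B = transpose B ** A \<and>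
     conj_transpose A ** B + conj_transpose B ** A = mat 2"

text \<open>Half the quadratic form of the second relation. Both the injectivity of \<open>A\<close>
  and \<open>B\<close> and the decay of the Gaussian come from it.\<close>

lemma lagrangian_pair_norm:
  assumes "lagrangian_pair A B"
  shows "Re (hermitian_inner (A *v x) (B *v x)) = (norm x)\<^sup>2"
proof -
  have m2: "mat 2 *v x = x + x"
    by (simp add: vec_eq_iff matrix_vector_mult_def mat_def if_distrib[of "\<lambda>a. a * _"] cong: if_cong)
  have add: "hermitian_inner x (y + z) = hermitian_inner x y + hermitian_inner x z" for y z
    by (simp add: hermitian_inner_def sum.distrib algebra_simps)
  have "hermitian_inner x (mat 2 *v x) =
      hermitian_inner x (conj_transpose A *v (B *v x)) + hermitian_inner x (conj_transpose B *v (A *v x))"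
    using assms unfolding lagrangian_pair_def
    by (metis add matrix_vector_mul_assoc matrix_vector_mult_add_rdistrib)
  then have "Re (hermitian_inner x x) + Re (hermitian_inner x x) = Re (hermitian_inner (A *v x) (B *v x)) + Re (hermitian_inner (B *v x) (A *v x))"
    unfolding hermitian_inner_adjoint m2 add by (metis plus_complex.sel(1))
  then show ?thesis
    by (simp add: Re_hermitian_inner_self Re_hermitian_inner_commute[of "B *v x"])
qed

text \<open>A vector annihilated by \<open>A\<close> or by \<open>B\<close> has norm 0 by
  \<open>lagrangian_pair_norm\<close>. Invertibility thus follows from the conserved relations
  alone, at every time.\<close>

lemma lagrangian_pair_invertible:
  fixes A B :: "complex ^ 'n ^ 'n"
  assumes "lagrangian_pair A B" shows "invertible A" "invertible B"
proof -
  have "\<forall>x. A *v x = 0 \<or> B *v x = 0 \<longrightarrow> x = 0"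
  proof (intro allI impI)
    fix x assume "A *v x = 0 \<or> B *v x = 0"
    then have "(norm x)\<^sup>2 = 0"
      unfolding lagrangian_pair_norm[OF assms, symmetric] by (auto simp: hermitian_inner_def)
    then show "x = 0" by simp
  qed
  then show "invertible A" "invertible B"
    unfolding invertible_left_inverse matrix_left_invertible_ker by blast+
qed

abbreviation cvec :: "real ^ 'n \<Rightarrow> complex ^ 'n" where
  "cvec y \<equiv> (\<chi> i. complex_of_real (y $ i))"

text \<open>On real vectors the conjugation in \<open>hermitian_inner\<close> does nothing, so the
  bilinear form may be treated as a sesquilinear one.\<close>

lemma cquad_eq_hermitian_inner: "cquad M y = hermitian_inner (cvec y) (M *v cvec y)"
  by (simp add: cquad_def hermitian_inner_def matrix_vector_mult_def sum_distrib_left mult.assoc)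

lemma Re_cquad: "Re (cquad M y) = y \<bullet> (map_matrix Re M *v y)"
  by (simp add: cquad_def inner_vec_def matrix_vector_mult_def sum_distrib_left mult.assoc)

text \<open>Put \<open>x = A^-1 y\<close> in \<open>lagrangian_pair_norm\<close>: then
  \<open>A x = y\<close> and \<open>B x = M y\<close>.\<close>

lemma lagrangian_pair_Re_cquad:
  fixes A B :: "complex ^ 'n ^ 'n"
  assumes "lagrangian_pair A B"
  shows "Re (cquad (B ** matrix_inv A) y) = (norm (matrix_inv A *v cvec y))\<^sup>2"
proof -
  have "A *v (matrix_inv A *v cvec y) = cvec y"
    by (simp add: matrix_vector_mul_assoc matrix_inv_inverse lagrangian_pair_invertible[OF assms])
  then show ?thesis
    using lagrangian_pair_norm[OF assms, of "matrix_inv A *v cvec y"]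
    by (simp add: cquad_eq_hermitian_inner matrix_vector_mul_assoc)
qed

text \<open>Multiply the first relation by the inverse of \<open>transpose A\<close> from the left
  and by that of \<open>A\<close> from the right.\<close>

lemma lagrangian_pair_symmetric:
  fixes A B :: "complex ^ 'n ^ 'n"
  assumes "lagrangian_pair A B"
  shows "transpose (B ** matrix_inv A) = B ** matrix_inv A"
proof -
  let ?N = "matrix_inv A"
  note N = matrix_inv_inverse[OF lagrangian_pair_invertible(1)[OF assms]]
  have N': "transpose ?N ** transpose A = mat 1"
    using N by (metis matrix_transpose_mul transpose_mat)
  have "B ** ?N = transpose ?N ** (transpose A ** B) ** ?N"
    by (simp add: matrix_mul_assoc N')
  also have "\<dots> = transpose ?N ** (transpose B ** A) ** ?N"
    using assms by (simp add: lagrangian_pair_def)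
  also have "\<dots> = transpose ?N ** transpose B ** (A ** ?N)"
    by (simp add: matrix_mul_assoc)
  also have "\<dots> = transpose (B ** ?N)"
    by (simp add: N matrix_transpose_mul)
  finally show ?thesis by simp
qed

lemma symmetric_double_Re:
  "transpose M = M \<Longrightarrow> cmat (map_matrix Re M) + cmat (map_matrix Re M) = M + conj_transpose M"
  by (simp add: vec_eq_iff complex_eq_iff transpose_def)

lemma positive_definite_invertible: "positive_definite S \<Longrightarrow> invertible S"
  unfolding positive_definite_def invertible_left_inverse matrix_left_invertible_ker
  by (metis inner_zero_right less_irrefl)

lemma mat_double_eq: "X + X = mat 2 \<Longrightarrow> X = (mat 1 :: complex ^ 'n ^ 'n)"
proof -
  assume eq: "X + X = mat 2"
  have "X $ i $ j = (mat 1 :: complex ^ 'n ^ 'n) $ i $ j" for i j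
    using arg_cong[OF eq, of "\<lambda>Z. Z $ i $ j"] by (auto simp: mat_def split: if_splits)
  then show ?thesis by (simp add: vec_eq_iff)
qed

lemma property_M_iff_lagrangian_pair:
  fixes A B :: "complex ^ 'n ^ 'n"
  shows "property_M A B \<longleftrightarrow> lagrangian_pair A B"
proof
  assume M: "property_M A B"
  define M where "M = B ** matrix_inv A"
  define X where "X = cmat (map_matrix Re M)"
  from M have A: "invertible A" and sym: "transpose M = M"
    and pos: "positive_definite (map_matrix Re M)"
    and AA: "cmat (matrix_inv (map_matrix Re M)) = A ** conj_transpose A"
    by (auto simp: property_M_def M_def Let_def)
  have B: "B = M ** A"
    by (simp add: M_def matrix_inv_inverse[OF A] flip: matrix_mul_assoc)
  have "X ** (A ** conj_transpose A) = cmat (map_matrix Re M ** matrix_inv (map_matrix Re M))"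
    by (simp add: X_def cmat_mult AA)
  also have "\<dots> = mat 1"
    by (simp add: matrix_inv_inverse[OF positive_definite_invertible[OF pos]])
      (simp add: vec_eq_iff mat_def)
  \<comment> \<open>\<open>X A\<close> is a left inverse of \<open>A^*\<close>, hence also a right
    inverse, which allows the factors to be cycled.\<close>
  finally have 1: "conj_transpose A ** (X ** A) = mat 1"
    by (simp add: matrix_mul_assoc matrix_left_right_inverse[of "X ** A"])
  have "conj_transpose A ** B + conj_transpose B ** A = conj_transpose A ** (M + conj_transpose M) ** A"
    by (simp add: B conj_transpose_mult matrix_add_ldistrib matrix_add_rdistrib matrix_mul_assoc)
  also have "\<dots> = conj_transpose A ** (X ** A) + conj_transpose A ** (X ** A)"
    unfolding symmetric_double_Re[OF sym, symmetric] X_def[symmetric]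
    by (simp only: matrix_add_ldistrib matrix_add_rdistrib matrix_mul_assoc)
  also have "\<dots> = mat 2" unfolding 1 by (simp add: vec_eq_iff mat_def)
  finally show "lagrangian_pair A B"
    by (simp add: lagrangian_pair_def) (simp add: B matrix_transpose_mul sym matrix_mul_assoc)
next
  assume L: "lagrangian_pair A B"
  define M where "M = B ** matrix_inv A"
  define X where "X = cmat (map_matrix Re M)"
  note A = lagrangian_pair_invertible[OF L]
  have sym: "transpose M = M" using lagrangian_pair_symmetric[OF L] by (simp add: M_def)
  have B: "B = M ** A"
    by (simp add: M_def matrix_inv_inverse[OF A(1)] flip: matrix_mul_assoc)
  have pos: "positive_definite (map_matrix Re M)"
    unfolding positive_definite_def
  proof (intro allI impI)
    fix x :: "real ^ 'n" assume "x \<noteq> 0"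
    have "A *v (matrix_inv A *v cvec x) = cvec x"
      by (simp add: matrix_vector_mul_assoc matrix_inv_inverse A)
    then have "matrix_inv A *v cvec x \<noteq> 0"
      using \<open>x \<noteq> 0\<close>
      by (metis (mono_tags) matrix_vector_mult_0_right of_real_eq_0_iff vec_eq_iff vec_lambda_beta zero_index)
    then show "x \<bullet> (map_matrix Re M *v x) > 0"
      using lagrangian_pair_Re_cquad[OF L, of x] by (simp add: Re_cquad M_def)
  qed
  have "conj_transpose A ** (X ** A) + conj_transpose A ** (X ** A)
      = conj_transpose A ** (M + conj_transpose M) ** A"
    unfolding symmetric_double_Re[OF sym, symmetric] X_def[symmetric]
    by (simp only: matrix_add_ldistrib matrix_add_rdistrib matrix_mul_assoc)
  also have "\<dots> = conj_transpose A ** B + conj_transpose B ** A"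
    by (simp add: B conj_transpose_mult matrix_add_ldistrib matrix_add_rdistrib matrix_mul_assoc)
  finally have "conj_transpose A ** (X ** A) + conj_transpose A ** (X ** A) = mat 2"
    using L by (simp add: lagrangian_pair_def)
  then have "conj_transpose A ** (X ** A) = mat 1" by (rule mat_double_eq)
  then have X1: "X ** (A ** conj_transpose A) = mat 1"
    by (metis matrix_mul_assoc matrix_left_right_inverse)
  have "X ** cmat (matrix_inv (map_matrix Re M)) = cmat (mat 1)"
    by (simp add: X_def matrix_inv_inverse[OF positive_definite_invertible[OF pos]] flip: cmat_mult)
  also have "\<dots> = mat 1" by (simp add: vec_eq_iff mat_def)
  finally have "cmat (matrix_inv (map_matrix Re M)) = A ** conj_transpose A"
    using matrix_inv_eqI X1 by metis
  then show "property_M A B"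
    using A sym pos by (simp add: property_M_def M_def)
qed

section \<open>Derivatives of matrix-valued curves: products, determinants, inverses\<close>

lemma bounded_bilinear_matrix_mult:
  "bounded_bilinear ((**) :: complex ^ 'n ^ 'm \<Rightarrow> complex ^ 'p ^ 'n \<Rightarrow> complex ^ 'p ^ 'm)"
  unfolding bilinear_conv_bounded_bilinear[symmetric] bilinear_def linear_iff
  by (auto simp: vec_eq_iff matrix_matrix_mult_def scaleR_sum_right sum.distrib algebra_simps)

lemma bounded_linear_conj_transpose:
  "bounded_linear (conj_transpose :: complex ^ 'n ^ 'm \<Rightarrow> _)"
  unfolding linear_conv_bounded_linear[symmetric] linear_iff
  by (auto simp: vec_eq_iff)

lemma bounded_linear_transpose:
  "bounded_linear (transpose :: complex ^ 'n ^ 'm \<Rightarrow> _)"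
  unfolding linear_conv_bounded_linear[symmetric] linear_iff
  by (auto simp: vec_eq_iff transpose_def)

lemma bounded_bilinear_matrix_vector_mult:
  "bounded_bilinear ((*v) :: complex ^ 'n ^ 'm \<Rightarrow> complex ^ 'n \<Rightarrow> complex ^ 'm)"
  unfolding bilinear_conv_bounded_bilinear[symmetric] bilinear_def linear_iff
  by (auto simp: vec_eq_iff matrix_vector_mult_def scaleR_sum_right sum.distrib algebra_simps)

lemmas has_vector_derivative_matrix_mult =
  bounded_bilinear.has_vector_derivative[OF bounded_bilinear_matrix_mult]
lemmas has_vector_derivative_matrix_vector_mult =
  bounded_bilinear.has_vector_derivative[OF bounded_bilinear_matrix_vector_mult]
lemmas has_vector_derivative_conj_transpose =
  bounded_linear.has_vector_derivative[OF bounded_linear_conj_transpose]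
lemmas has_vector_derivative_transpose =
  bounded_linear.has_vector_derivative[OF bounded_linear_transpose]

lemma has_vector_derivative_vec_iff:
  fixes f :: "real \<Rightarrow> 'a::real_normed_vector ^ 'n"
  shows "(f has_vector_derivative f') F \<longleftrightarrow> (\<forall>i. ((\<lambda>t. f t $ i) has_vector_derivative f' $ i) F)"
proof
  assume "(f has_vector_derivative f') F"
  then show "\<forall>i. ((\<lambda>t. f t $ i) has_vector_derivative f' $ i) F"
    by (auto intro: bounded_linear.has_vector_derivative[OF bounded_linear_vec_nth])
next
  assume r: "\<forall>i. ((\<lambda>t. f t $ i) has_vector_derivative f' $ i) F"
  have bl: "bounded_linear (axis i :: 'a \<Rightarrow> 'a ^ 'n)" for i
    by (rule bounded_linear_intro[where K = 1])
      (auto simp: axis_def vec_eq_iff norm_vec_def L2_set_def if_distrib[of norm] if_distrib[of "\<lambda>a. a\<^sup>2"] cong: if_cong)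
  have sum: "x = (\<Sum>i\<in>UNIV. axis i (x $ i))" for x :: "'a ^ 'n"
    by (simp add: vec_eq_iff axis_def sum_component if_distrib cong: if_cong)
  have "((\<lambda>t. \<Sum>i\<in>UNIV. axis i (f t $ i)) has_vector_derivative (\<Sum>i\<in>UNIV. axis i (f' $ i))) F"
    using r by (intro has_vector_derivative_sum bounded_linear.has_vector_derivative[OF bl]) auto
  then show "(f has_vector_derivative f') F"
    using sum by simp
qed

text \<open>Row by row for \<open>D R\<close>, and column by column for \<open>R D\<close>, the skew
  \<open>R\<close> is contracted with the symmetric real Gram matrix of the entries of
  \<open>D\<close>.\<close>

lemma inner_matrix_mult_skew:
  fixes D :: "complex ^ 'n ^ 'n" and R :: "real ^ 'n ^ 'n"
  assumes R: "transpose R = - R"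
  shows "inner D (D ** cmat R) = 0" "inner D (cmat R ** D) = 0"
proof -
  have Rji: "R $ j $ k = - R $ k $ j" for j k
    using arg_cong[OF R, of "\<lambda>Z. Z $ k $ j"] by (simp add: transpose_def)
  have scale: "inner z (w * of_real r) = r * inner z w" "inner z (of_real r * w) = r * inner z w" for z w :: complex and r
    by (simp_all add: inner_complex_def algebra_simps)
  have skew: "(\<Sum>k\<in>UNIV. \<Sum>j\<in>UNIV. R $ j $ k * g j k) = 0"
    if "\<And>j k. g j k = g k j" for g :: "'n \<Rightarrow> 'n \<Rightarrow> real"
  proof -
    have "(\<Sum>k\<in>UNIV. \<Sum>j\<in>UNIV. R $ j $ k * g j k) = (\<Sum>k\<in>UNIV. \<Sum>j\<in>UNIV. R $ k $ j * g k j)"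
      by (rule sum.swap)
    also have "\<dots> = (\<Sum>k\<in>UNIV. \<Sum>j\<in>UNIV. - (R $ j $ k * g j k))"
      by (intro sum.cong refl) (metis Rji minus_mult_left that)
    also have "\<dots> = - (\<Sum>k\<in>UNIV. \<Sum>j\<in>UNIV. R $ j $ k * g j k)"
      by (simp add: sum_negf)
    finally show ?thesis by simp
  qed
  have "inner D (D ** cmat R) = (\<Sum>i\<in>UNIV. \<Sum>k\<in>UNIV. \<Sum>j\<in>UNIV. R $ j $ k * inner (D $ i $ k) (D $ i $ j))"
    by (simp add: inner_vec_def matrix_matrix_mult_def inner_sum_right scale)
  also have "\<dots> = 0"
    by (intro sum.neutral ballI skew) (simp add: inner_commute)
  finally show "inner D (D ** cmat R) = 0" .
  have "inner D (cmat R ** D) = (\<Sum>i\<in>UNIV. \<Sum>k\<in>UNIV. \<Sum>j\<in>UNIV. R $ i $ j * inner (D $ i $ k) (D $ j $ k))"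
    by (simp add: inner_vec_def matrix_matrix_mult_def inner_sum_right scale)
  also have "\<dots> = (\<Sum>k\<in>UNIV. \<Sum>i\<in>UNIV. \<Sum>j\<in>UNIV. R $ i $ j * inner (D $ i $ k) (D $ j $ k))"
    by (rule sum.swap)
  also have "\<dots> = (\<Sum>k\<in>UNIV. \<Sum>j\<in>UNIV. \<Sum>i\<in>UNIV. R $ i $ j * inner (D $ i $ k) (D $ j $ k))"
    by (intro sum.cong refl sum.swap)
  also have "\<dots> = 0"
    by (intro sum.neutral ballI skew) (simp add: inner_commute)
  finally show "inner D (cmat R ** D) = 0" .
qed

lemma commutator_flow_zero:
  fixes D :: "real \<Rightarrow> complex ^ 'n ^ 'n" and R :: "real ^ 'n ^ 'n"
  assumes R: "transpose R = - R"
    and D: "\<And>t. (D has_vector_derivative (D t ** cmat R - cmat R ** D t)) (at t)" and "D 0 = 0"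
  shows "D t = 0"
proof -
  have "((\<lambda>t. inner (D t) (D t)) has_vector_derivative 0) (at t)" for t
    using bounded_bilinear.has_vector_derivative[OF bounded_bilinear_inner D D, of t]
    by (simp add: inner_diff_right inner_diff_left inner_matrix_mult_skew[OF R]
        inner_commute[of _ "D t"])
  then have "((\<lambda>t. inner (D t) (D t)) has_real_derivative 0) (at t)" for t
    by (simp add: has_real_derivative_iff_has_vector_derivative)
  then have "inner (D t) (D t) = inner (D 0) (D 0)"
    by (rule DERIV_isconst_all[rule_format])
  then show ?thesis using assms by simp
qed

lemma has_vector_derivative_det:
  fixes A :: "real \<Rightarrow> complex ^ 'n ^ 'n"
  assumes "(A has_vector_derivative A') (at t)"
  shows "((\<lambda>t. det (A t)) has_vector_derivative
    (\<Sum>i\<in>UNIV. det (\<chi> k. if k = i then A' $ i else A t $ k))) (at t)"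
proof -
  have A: "((\<lambda>t. A t $ i $ j) has_derivative (\<lambda>h. h *\<^sub>R A' $ i $ j)) (at t)" for i j
    using assms unfolding has_vector_derivative_vec_iff has_vector_derivative_def by (auto simp: scaleR_vec_def)
  have "((\<lambda>t. det (A t)) has_derivative (\<lambda>h. \<Sum>p | p permutes (UNIV :: 'n set). of_int (sign p) *
      (\<Sum>i\<in>UNIV. (h *\<^sub>R A' $ i $ p i) * (\<Prod>j\<in>UNIV - {i}. A t $ j $ p j)))) (at t)"
    unfolding det_def
    by (intro has_derivative_sum has_derivative_mult_right has_derivative_prod A)
  moreover have "(\<Sum>p | p permutes (UNIV :: 'n set). of_int (sign p) *
      (\<Sum>i\<in>UNIV. (h *\<^sub>R A' $ i $ p i) * (\<Prod>j\<in>UNIV - {i}. A t $ j $ p j)))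
      = h *\<^sub>R (\<Sum>i\<in>UNIV. det (\<chi> k. if k = i then A' $ i else A t $ k))" for h
  proof -
    have prod: "(\<Prod>k\<in>UNIV. (\<chi> k. if k = i then A' $ i else A t $ k) $ k $ p k)
      = A' $ i $ p i * (\<Prod>j\<in>UNIV - {i}. A t $ j $ p j)" for i p
      by (subst prod.remove[of _ i]) (auto intro!: prod.cong)
    have "(\<Sum>i\<in>UNIV. det (\<chi> k. if k = i then A' $ i else A t $ k)) =
      (\<Sum>p | p permutes (UNIV :: 'n set). \<Sum>i\<in>UNIV. of_int (sign p) * (A' $ i $ p i * (\<Prod>j\<in>UNIV - {i}. A t $ j $ p j)))"
      unfolding det_def prod by (rule sum.swap)
    then show ?thesis
      by (simp add: sum_distrib_left scaleR_sum_right mult_ac)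
  qed
  ultimately show ?thesis by (simp add: has_vector_derivative_def)
qed

text \<open>Jacobi's formula. Row \<open>i\<close> of \<open>X A\<close> is the combination of the
  rows of \<open>A\<close> with coefficients \<open>X $ i\<close>; put in the place of row
  \<open>i\<close> of \<open>A\<close>, only its own coefficient \<open>X $ i $ i\<close> survives
  in the determinant.\<close>

lemma has_vector_derivative_det_trace:
  fixes A :: "real \<Rightarrow> complex ^ 'n ^ 'n"
  assumes "(A has_vector_derivative X ** A t) (at t)"
  shows "((\<lambda>t. det (A t)) has_vector_derivative trace X * det (A t)) (at t)"
proof -
  have "det (\<chi> k. if k = i then (X ** A t) $ i else A t $ k) = X $ i $ i * det (A t)" for i
  proof -
    have "(X ** A t) $ i = (\<Sum>k\<in>UNIV. X $ i $ k *s row k (A t))"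
      by (simp add: vec_eq_iff matrix_matrix_mult_def row_def sum_component)
    moreover have "row k (A t) = A t $ k" for k by (simp add: row_def vec_eq_iff)
    ultimately show ?thesis
      using cramer_lemma_transpose[of i "X $ i" "A t"] by (simp cong: if_cong)
  qed
  then show ?thesis
    using has_vector_derivative_det[OF assms] by (simp add: trace_def sum_distrib_right)
qed

text \<open>Cramer's rule shows that the entries of the inverse are differentiable; the value of the
  derivative is then forced by differentiating \<open>A N = 1\<close>.\<close>

lemma has_vector_derivative_matrix_inv:
  fixes A :: "real \<Rightarrow> complex ^ 'n ^ 'n"
  assumes A: "\<And>t. (A has_vector_derivative A' t) (at t)" and inv: "\<And>t. invertible (A t)"
  shows "((\<lambda>t. matrix_inv (A t)) has_vector_derivative
    - (matrix_inv (A t) ** A' t ** matrix_inv (A t))) (at t)"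
proof -
  let ?N = "\<lambda>t. matrix_inv (A t)"
  have det: "det (A t) \<noteq> 0" for t using inv invertible_det_nz by blast
  have N: "?N t $ j $ k = det (\<chi> i l. if l = j then axis k 1 $ i else A t $ i $ l) / det (A t)" for t j k
  proof -
    have "A t *v column k (?N t) = axis k 1"
      using matrix_inv_inverse(1)[OF inv[of t]]
      by (simp add: vec_eq_iff matrix_vector_mult_def matrix_matrix_mult_def column_def mat_def axis_def)
    then have "column k (?N t) $ j = det (\<chi> i l. if l = j then axis k 1 $ i else A t $ i $ l) / det (A t)"
      unfolding cramer[OF det] by simp
    then show ?thesis by (simp add: column_def)
  qed
  have ex: "\<exists>d. ((\<lambda>t. ?N t $ j $ k) has_vector_derivative d) (at t)" for j k
  proof -
    have A: "((\<lambda>t. A t $ i $ j) has_vector_derivative A' t $ i $ j) (at t)" for i j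
      using A unfolding has_vector_derivative_vec_iff by auto
    have "((\<lambda>t. \<chi> i l. if l = j then axis k 1 $ i else A t $ i $ l) has_vector_derivative
        (\<chi> i l. if l = j then 0 else A' t $ i $ l)) (at t)"
      unfolding has_vector_derivative_vec_iff using A by auto
    from has_vector_derivative_det[OF this]
    have "(\<lambda>t. det (\<chi> i l. if l = j then axis k 1 $ i else A t $ i $ l)) differentiable (at t)"
      by (rule differentiableI_vector)
    moreover have "(\<lambda>t. det (A t)) differentiable (at t)"
      using has_vector_derivative_det[OF assms(1)] by (rule differentiableI_vector)
    ultimately have "(\<lambda>t. ?N t $ j $ k) differentiable (at t)"
      unfolding N using det by (intro differentiable_divide)
    then show ?thesis unfolding vector_derivative_works by blast
  qed
  then obtain d where "\<And>j k. ((\<lambda>t. ?N t $ j $ k) has_vector_derivative d j k) (at t)"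
    by metis
  then have N': "(?N has_vector_derivative (\<chi> j k. d j k)) (at t)" (is "(_ has_vector_derivative ?d) _")
    unfolding has_vector_derivative_vec_iff by simp
  have "((\<lambda>t. A t ** ?N t) has_vector_derivative (A t ** ?d + A' t ** ?N t)) (at t)"
    by (rule has_vector_derivative_matrix_mult[OF A N'])
  moreover have "(\<lambda>t. A t ** ?N t) = (\<lambda>t. mat 1)"
    using inv by (simp add: matrix_inv_inverse)
  ultimately have "A t ** ?d + A' t ** ?N t = 0"
    by (metis has_vector_derivative_const vector_derivative_unique_at)
  then have "?N t ** (A t ** ?d + A' t ** ?N t) = 0" by simp
  then have "?d = - (?N t ** A' t ** ?N t)"
    by (simp add: matrix_add_ldistrib matrix_mul_assoc matrix_inv_inverse[OF inv] eq_neg_iff_add_eq_0)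
  with N' show ?thesis by simp
qed

lemma trace_simps: "trace (imat X) = \<i> * trace X" "trace (X - Y) = trace X - trace Y"
  for X Y :: "complex ^ 'n ^ 'n"
  by (simp_all add: trace_def sum_distrib_left sum_subtractf)

section \<open>The matrix flow: conservation of (M), Riccati equation, determinant\<close>

locale matrix_flow =
  fixes R :: "real ^ 'n ^ 'n" and Q :: "real \<Rightarrow> real ^ 'n ^ 'n" and A B :: "real \<Rightarrow> complex ^ 'n ^ 'n"
  assumes skew: "transpose R = - R"
    and symQ: "\<And>t. transpose (Q t) = Q t"
    and sol: "matrix_solution R Q (A 0) (B 0) A B"
    and init: "lagrangian_pair (A 0) (B 0)"
begin

lemma derivative_A: "(A has_vector_derivative (imat (B t) - (cmat R ** A t - A t ** cmat R))) (at t)"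
  using sol by (simp add: matrix_solution_def commutator_def imat_def)

lemma derivative_B: "(B has_vector_derivative (imat (cmat (Q t) ** A t) - (cmat R ** B t - B t ** cmat R))) (at t)"
  using sol by (simp add: matrix_solution_def commutator_def imat_def)

lemmas matrix_algebra = matrix_add_ldistrib matrix_add_rdistrib matrix_diff_distribs matrix_minus_mult
  imat_mult imat_add imat_imat transpose_linear transpose_imat conj_transpose_linear conj_transpose_mult
  matrix_transpose_mul conj_transpose_cmat cmat_minus skew symQ

text \<open>In both defects the terms produced by \<open>imat\<close> cancel, those quadratic in
  \<open>B\<close> among themselves and those with \<open>Q\<close> because \<open>Q\<close> is real
  and symmetric. Only the commutators remain, and skewness of \<open>R\<close> makes them combine
  into a commutator of the whole defect.\<close>

lemma lagrangian_pair: "lagrangian_pair (A t) (B t)"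
proof -
  define D where "D t = transpose (A t) ** B t - transpose (B t) ** A t" for t
  have "(D has_vector_derivative (D t ** cmat R - cmat R ** D t)) (at t)" for t
    unfolding D_def
    by (rule has_vector_derivative_eq_rhs)
      (rule has_vector_derivative_diff has_vector_derivative_matrix_mult has_vector_derivative_transpose derivative_A derivative_B
        | simp add: matrix_algebra matrix_mul_assoc)+
  moreover have "D 0 = 0" using init by (simp add: D_def lagrangian_pair_def)
  ultimately have D: "D t = 0" by (rule commutator_flow_zero[OF skew])
  define E where "E t = conj_transpose (A t) ** B t + conj_transpose (B t) ** A t - mat 2" for t
  \<comment> \<open>The subtracted constant commutes with \<open>R\<close>, so it may be inserted in
    the commutator for free.\<close>
  have m: "mat 2 ** X = X ** mat 2" for X :: "complex ^ 'n ^ 'n"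
    by (simp add: matrix_matrix_mult_def mat_def vec_eq_iff if_distrib[of "\<lambda>a. a * _"] if_distrib[of "\<lambda>a. _ * a"] cong: if_cong)
  have "(E has_vector_derivative (E t ** cmat R - cmat R ** E t)) (at t)" for t
    unfolding E_def
    by (rule has_vector_derivative_eq_rhs)
      (rule has_vector_derivative_diff has_vector_derivative_add has_vector_derivative_const
         has_vector_derivative_matrix_mult has_vector_derivative_conj_transpose derivative_A derivative_B
        | simp add: matrix_algebra matrix_mul_assoc m)+
  moreover have "E 0 = 0" using init by (simp add: E_def lagrangian_pair_def)
  ultimately have E: "E t = 0" by (rule commutator_flow_zero[OF skew])
  show ?thesis using D E by (simp add: lagrangian_pair_def D_def E_def)
qed

lemmas invertible_A = lagrangian_pair_invertible(1)[OF lagrangian_pair]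

definition N where "N t = matrix_inv (A t)"
definition M where "M t = B t ** N t"

lemma N_A [simp]: "N t ** A t = mat 1" "A t ** N t = mat 1"
  by (simp_all add: N_def matrix_inv_inverse invertible_A)

lemma mult_N_A [simp]: "X ** N t ** A t = X" "X ** A t ** N t = X"
  by (simp_all flip: matrix_mul_assoc)

lemma transpose_M: "transpose (M t) = M t"
  unfolding M_def N_def by (rule lagrangian_pair_symmetric[OF lagrangian_pair])

lemma derivative_N: "(N has_vector_derivative (- imat (N t ** M t) + N t ** cmat R - cmat R ** N t)) (at t)"
  using has_vector_derivative_matrix_inv[OF derivative_A invertible_A, of t]
  unfolding N_def[symmetric] by (simp add: matrix_algebra M_def matrix_mul_assoc algebra_simps)

lemma derivative_M: "(M has_vector_derivative
    (imat (cmat (Q t)) - imat (M t ** M t) - (cmat R ** M t - M t ** cmat R))) (at t)"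
  unfolding M_def
  by (rule has_vector_derivative_eq_rhs[OF has_vector_derivative_matrix_mult[OF derivative_B derivative_N]])
     (simp add: matrix_algebra M_def matrix_mul_assoc algebra_simps)

lemma derivative_det_A: "((\<lambda>t. det (A t)) has_vector_derivative (\<i> * trace (M t) * det (A t))) (at t)"
proof -
  \<comment> \<open>The derivative of \<open>A\<close> is written as \<open>?X A\<close> to apply
    Jacobi's formula. The term \<open>A R\<close> becomes \<open>(A R A^-1) A\<close>, and by
    cyclicity its trace cancels that of \<open>R\<close>: rotation does not affect the
    determinant.\<close>
  let ?X = "imat (M t) - (cmat R - A t ** cmat R ** N t)"
  have "?X ** A t = imat (B t) - (cmat R ** A t - A t ** cmat R)"
    by (simp add: matrix_algebra M_def matrix_mul_assoc)
  then have "((\<lambda>t. det (A t)) has_vector_derivative trace ?X * det (A t)) (at t)"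
    using derivative_A[of t] by (intro has_vector_derivative_det_trace) simp
  moreover have "trace (A t ** cmat R ** N t) = trace (N t ** (A t ** cmat R))"
    by (rule trace_mul_sym)
  then have "trace ?X = \<i> * trace (M t)"
    by (simp add: trace_simps matrix_mul_assoc)
  ultimately show ?thesis by simp
qed

lemma det_A_nz: "det (A t) \<noteq> 0"
  using invertible_A invertible_det_nz by blast

end

section \<open>Injectivity of the Fourier transform\<close>

lemma nn_integral_exp_minus_abs_finite:
  assumes "a > 0"
  shows "(\<integral>\<^sup>+x. ennreal (exp (- (a * \<bar>x\<bar>))) \<partial>lborel) < \<infinity>"
proof -
  have half: "(\<integral>\<^sup>+x. ennreal (exp (- (a * x))) * indicator {0..} x \<partial>lborel) = 0 - (- exp (- (a * 0)) / a)"
  proof (rule nn_integral_FTC_atLeast)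
    show "((\<lambda>x. - exp (- (a * x)) / a) has_real_derivative exp (- (a * x))) (at x)" for x
      using assms by (auto intro!: derivative_eq_intros)
    have "filterlim (\<lambda>x. a * x) at_top at_top"
      using assms by (intro filterlim_tendsto_pos_mult_at_top[OF tendsto_const] filterlim_ident)
    then have "((\<lambda>x. exp (- (a * x))) \<longlongrightarrow> 0) at_top"
      by (intro filterlim_compose[OF exp_at_bot] filterlim_compose[OF filterlim_uminus_at_bot_at_top])
    then have "((\<lambda>x. - exp (- (a * x)) / a) \<longlongrightarrow> - 0 / a) at_top"
      by (intro tendsto_intros) (use assms in auto)
    then show "((\<lambda>x. - exp (- (a * x)) / a) \<longlongrightarrow> 0) at_top" by simp
  qed (use assms in auto)
  have "(\<integral>\<^sup>+x. ennreal (exp (- (a * \<bar>x\<bar>))) \<partial>lborel) \<le>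
     (\<integral>\<^sup>+x. ennreal (exp (- (a * x))) * indicator {0..} x + ennreal (exp (a * x)) * indicator {0..} (- x) \<partial>lborel)"
    by (intro nn_integral_mono) (auto simp: indicator_def abs_if)
  also have "\<dots> = (\<integral>\<^sup>+x. ennreal (exp (- (a * x))) * indicator {0..} x \<partial>lborel)
      + (\<integral>\<^sup>+x. ennreal (exp (a * x)) * indicator {0..} (- x) \<partial>lborel)"
    by (rule nn_integral_add) auto
  also have "(\<integral>\<^sup>+x. ennreal (exp (a * x)) * indicator {0..} (- x) \<partial>lborel)
      = (\<integral>\<^sup>+x. ennreal (exp (- (a * x))) * indicator {0..} x \<partial>lborel)"
    by (subst nn_integral_real_affine[where t = 0 and c = "- 1"]) auto
  also have "(\<integral>\<^sup>+x. ennreal (exp (- (a * x))) * indicator {0..} x \<partial>lborel) + \<dots> < \<infinity>"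
    by (simp add: half)
  finally show ?thesis .
qed

text \<open>The sum of the absolute coordinates is at most the dimension times the norm, so the
  function lies below a product of one-dimensional exponentials with rate
  \<open>a / DIM('a)\<close>.\<close>

lemma integrable_exp_minus_norm:
  assumes a: "a > 0"
  shows "integrable lborel (\<lambda>y::'a::euclidean_space. exp (- (a * norm y)))"
proof -
  let ?c = "a / DIM('a)"
  have c: "?c > 0" using a by (simp add: DIM_positive)
  have le: "exp (- (a * norm y)) \<le> (\<Prod>b\<in>Basis. exp (- (?c * \<bar>y \<bullet> b\<bar>)))" for y :: 'a
  proof -
    have "(\<Sum>b\<in>Basis. ?c * \<bar>y \<bullet> b\<bar>) \<le> (\<Sum>b\<in>(Basis :: 'a set). ?c * norm y)"
      using c by (intro sum_mono mult_left_mono) (auto simp: Basis_le_norm)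
    also have "\<dots> = a * norm y" by simp
    finally show ?thesis
      by (subst exp_sum[symmetric]) (simp_all add: sum_negf)
  qed
  have "(\<integral>\<^sup>+y. ennreal (exp (- (a * norm (y::'a)))) \<partial>lborel) \<le>
      (\<integral>\<^sup>+y. (\<Prod>b\<in>Basis. ennreal (exp (- (?c * \<bar>(y::'a) \<bullet> b\<bar>)))) \<partial>lborel)"
    using le by (intro nn_integral_mono) (simp only: prod_ennreal exp_ge_zero ennreal_leI)
  also have "\<dots> = (\<Prod>b\<in>(Basis :: 'a set). \<integral>\<^sup>+x. ennreal (exp (- (?c * \<bar>x\<bar>))) \<partial>lborel)"
    by (rule nn_integral_lborel_prod) auto
  also have "\<dots> < \<infinity>"
    using nn_integral_exp_minus_abs_finite[OF c]
    by (simp add: less_top[symmetric] power_eq_top_ennreal)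
  finally show ?thesis
    by (intro integrableI_bounded) auto
qed

lemma borel_measurable_lebesgue_continuous:
  fixes f :: "'a::euclidean_space \<Rightarrow> 'b::topological_space"
  shows "continuous_on UNIV f \<Longrightarrow> f \<in> borel_measurable lebesgue"
  using borel_measurable_continuous_onI[of f] by (intro measurable_completion) simp

text \<open>Dynkin's argument: the closed sets form a generator stable under intersections.
  Complements work because the whole space is itself closed.\<close>

lemma integral_eq_0_closed_imp_borel:
  fixes h :: "'a::euclidean_space \<Rightarrow> complex"
  assumes h: "integrable lborel h"
    and closed: "\<And>C. closed C \<Longrightarrow> (LINT y:C|lborel. h y) = 0"
    and A: "A \<in> sets borel"
  shows "(LINT y:A|lborel. h y) = 0"
proof -
  have h': "set_integrable lborel X h" if "X \<in> sets borel" for X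
    using integrable_mult_indicator[OF _ h, of X] that by (simp add: set_integrable_def)
  have Int_stable_closed: "Int_stable (Collect closed :: 'a set set)"
    by (auto simp: Int_stable_def)
  have subset_Pow_UNIV: "Collect closed \<subseteq> Pow (UNIV :: 'a set)" by simp
  have "A \<in> sigma_sets UNIV (Collect closed)"
    using A borel_eq_closed[where 'a = 'a] by (metis Collect_mem_eq Pow_UNIV sets_measure_of subset_UNIV)
  with Int_stable_closed subset_Pow_UNIV show ?thesis
  proof (induction rule: sigma_sets_induct_disjoint)
    case (compl X)
    then have X: "X \<in> sets borel" using borel_eq_closed[where 'a = 'a]
      by (metis Pow_UNIV sets_measure_of subset_UNIV)
    have "(LINT y:X \<union> (UNIV - X)|lborel. h y) = (LINT y:X|lborel. h y) + (LINT y:UNIV - X|lborel. h y)"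
      using X by (intro set_integral_Un h') auto
    then show ?case using compl closed[of UNIV] by simp
  next
    case (union X)
    then have X: "X i \<in> sets borel" for i using borel_eq_closed[where 'a = 'a]
      by (metis Pow_UNIV sets_measure_of subset_UNIV rangeI subsetD)
    have "(LINT y:(\<Union>i. X i)|lborel. h y) = (\<Sum>i. (LINT y:X i|lborel. h y))"
      using X union(1) by (intro lebesgue_integral_countable_add h') (auto simp: disjoint_family_on_def)
    then show ?case using union by simp
  qed (auto simp: closed[unfolded set_lebesgue_integral_def] set_lebesgue_integral_def)
qed

text \<open>Indicators of closed sets are dominated limits of continuous functions with values in
  \<open>[0, 1]\<close>; vanishing on closed sets extends to Borel sets and then determines the
  density.\<close>

lemma AE_zero_of_integral_continuous:
  fixes h :: "'a::euclidean_space \<Rightarrow> complex"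
  assumes h: "integrable lborel h"
    and cont: "\<And>f. continuous_on UNIV f \<Longrightarrow> (\<And>y. 0 \<le> f y \<and> f y \<le> 1) \<Longrightarrow>
      (\<integral>y. h y * of_real (f y) \<partial>lborel) = 0"
  shows "AE y in lborel. h y = 0"
proof -
  have closed: "(LINT y:C|lborel. h y) = 0" if C: "closed C" for C :: "'a set"
  proof (cases "C = {}")
    case False
    \<comment> \<open>These functions decrease to the indicator of \<open>C\<close>. The empty set
      was split off because \<open>infdist\<close> to it is 0 by convention, which would give the
      limit 1 everywhere.\<close>
    let ?f = "\<lambda>n y. max 0 (1 - real n * infdist y C)"
    have cf: "continuous_on UNIV (?f n)" for n by (intro continuous_intros)
    have "(\<lambda>n. \<integral>y. h y * of_real (?f n y) \<partial>lborel) \<longlonglongrightarrow> (\<integral>y. indicator C y *\<^sub>R h y \<partial>lborel)"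
    proof (rule integral_dominated_convergence)
      show "integrable lborel (\<lambda>y. norm (h y))" using h by simp
      show "(\<lambda>y. h y * of_real (?f n y)) \<in> borel_measurable lborel" for n
        using h borel_measurable_continuous_onI[OF cf] by measurable
      show "(\<lambda>y. indicator C y *\<^sub>R h y) \<in> borel_measurable lborel"
        using h C by (auto intro: borel_closed)
      show "AE y in lborel. norm (h y * of_real (?f n y)) \<le> norm (h y)" for n
        by (auto simp: norm_mult infdist_nonneg intro!: mult_left_le)
      have "(\<lambda>n. h y * of_real (?f n y)) \<longlonglongrightarrow> indicator C y *\<^sub>R h y" for y
      proof (cases "y \<in> C")
        case False
        then have pos: "infdist y C > 0"
          using infdist_pos_not_in_closed[OF C \<open>C \<noteq> {}\<close>] by auto
        obtain N :: nat where "1 / infdist y C < N" using reals_Archimedean2 by blast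
        have "?f n y = 0" if "n \<ge> N" for n
        proof -
          have "1 < real N * infdist y C" using \<open>1 / infdist y C < N\<close> pos by (simp add: field_simps)
          also have "\<dots> \<le> real n * infdist y C" using that pos by (intro mult_right_mono) auto
          finally show ?thesis by simp
        qed
        then have "\<forall>\<^sub>F n in sequentially. h y * of_real (?f n y) = 0"
          by (auto simp: eventually_sequentially intro!: exI[of _ N])
        then show ?thesis using False by (simp add: tendsto_eventually)
      qed simp
      then show "AE y in lborel. (\<lambda>n. h y * of_real (?f n y)) \<longlonglongrightarrow> indicator C y *\<^sub>R h y" by simp
    qed
    moreover have "(\<integral>y. h y * of_real (?f n y) \<partial>lborel) = 0" for n
      by (rule cont[OF cf]) (auto simp: infdist_nonneg)
    ultimately show ?thesis
      by (simp add: set_lebesgue_integral_def LIMSEQ_const_iff)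
  qed (simp add: set_lebesgue_integral_def)
  have zero: "(LINT y:A|lborel. h y) = 0" if "A \<in> sets lborel" for A
    using integral_eq_0_closed_imp_borel[OF h closed, of A] that by simp
  have int: "integrable lborel (\<lambda>y. indicator A y *\<^sub>R h y)" if "A \<in> sets lborel" for A
    using integrable_mult_indicator[OF that h] .
  have "AE y in lborel. Re (h y) = 0"
  proof (rule density_unique_real)
    fix A :: "'a set" assume A: "A \<in> sets lborel"
    show "(LINT y:A|lborel. Re (h y)) = (LINT y:A|lborel. 0)"
      using arg_cong[OF zero[OF A], of Re] integral_Re[OF int[OF A]]
      by (simp add: set_lebesgue_integral_def)
  qed (use h in auto)
  moreover have "AE y in lborel. Im (h y) = 0"
  proof (rule density_unique_real)
    fix A :: "'a set" assume A: "A \<in> sets lborel"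
    show "(LINT y:A|lborel. Im (h y)) = (LINT y:A|lborel. 0)"
      using arg_cong[OF zero[OF A], of Im] integral_Im[OF int[OF A]]
      by (simp add: set_lebesgue_integral_def)
  qed (use h in auto)
  ultimately show ?thesis by eventually_elim (simp add: complex_eq_iff)
qed

text \<open>The multipliers of the annihilator of the characters form an algebra which contains the
  functions \<open>cos (\<beta> \<bullet> (y - x))\<close>, so that Stone--Weierstrass applies on every ball. Outside of
  the ball the approximation is tamed by composing it with a polynomial that approximates the
  truncation to \<open>[0, 1]\<close> on the range of the first approximation.\<close>

lemma Fourier_injective_lborel:
  fixes h :: "'a::euclidean_space \<Rightarrow> complex"
  assumes h: "integrable lborel h" and F: "\<And>\<beta>. (\<integral>y. h y * cis (\<beta> \<bullet> y) \<partial>lborel) = 0"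
  shows "AE y in lborel. h y = 0"
proof (rule AE_zero_of_integral_continuous[OF h])
  fix f :: "'a \<Rightarrow> real" assume cf: "continuous_on UNIV f" and f01: "\<And>y. 0 \<le> f y \<and> f y \<le> 1"
  define K where "K = {k :: 'a \<Rightarrow> complex. integrable lborel k \<and> (\<forall>\<beta>. (\<integral>y. k y * cis (\<beta> \<bullet> y) \<partial>lborel) = 0)}"
  define \<A> where "\<A> = {g :: 'a \<Rightarrow> real. continuous_on UNIV g \<and> bounded (range g) \<and>
    (\<forall>k\<in>K. (\<lambda>y. k y * of_real (g y)) \<in> K)}"
  have cis_meas [measurable]: "(\<lambda>y. cis (\<beta> \<bullet> y)) \<in> borel_measurable borel" for \<beta> :: 'a
    by (intro borel_measurable_continuous_onI continuous_intros)
  have int_cis: "integrable lborel (\<lambda>y. k y * cis (\<beta> \<bullet> y))" if "integrable lborel k" for k and \<beta> :: 'a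
    by (rule Bochner_Integration.integrable_bound[OF that]) (use that in \<open>auto simp: norm_mult\<close>)
  have int_bd: "integrable lborel (\<lambda>y. k y * of_real (g y))"
    if "integrable lborel k" "continuous_on UNIV g" "bounded (range g)" for k :: "'a \<Rightarrow> complex" and g :: "'a \<Rightarrow> real"
  proof -
    note bd = that(3)
    obtain B where B: "\<And>y. \<bar>g y\<bar> \<le> B" using bd by (metis bounded_iff rangeI real_norm_def)
    have [measurable]: "g \<in> borel_measurable borel" using that(2) by (rule borel_measurable_continuous_onI)
    have bound: "cmod (k y * of_real (g y)) \<le> norm (of_real B * k y)" for y
      using B[of y] mult_left_mono[of "\<bar>g y\<bar>" "\<bar>B\<bar>" "cmod (k y)"] by (auto simp: norm_mult mult.commute)
    show ?thesis
    proof (rule Bochner_Integration.integrable_bound)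
      show "integrable lborel (\<lambda>y. of_real B * k y)" using that(1) by simp
      show "(\<lambda>y. k y * of_real (g y)) \<in> borel_measurable lborel" using that(1) by measurable
      show "AE y in lborel. cmod (k y * of_real (g y)) \<le> norm (of_real B * k y)"
        by (rule AE_I2) (rule bound)
    qed
  qed
  have const: "(\<lambda>_. c) \<in> \<A>" for c
  proof -
    have "(\<integral>y. k y * of_real c * cis (\<beta> \<bullet> y) \<partial>lborel) = of_real c * (\<integral>y. k y * cis (\<beta> \<bullet> y) \<partial>lborel)"
      for k and \<beta> :: 'a
      by (subst integral_mult_right_zero[symmetric]) (simp add: mult_ac)
    then show ?thesis by (auto simp: \<A>_def K_def)
  qed
  have add: "(\<lambda>y. g1 y + g2 y) \<in> \<A>" if "g1 \<in> \<A>" "g2 \<in> \<A>" for g1 g2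
    unfolding \<A>_def
  proof (intro CollectI conjI ballI)
    show "continuous_on UNIV (\<lambda>y. g1 y + g2 y)"
      using that by (auto simp: \<A>_def intro: continuous_intros)
    show "bounded (range (\<lambda>y. g1 y + g2 y))"
      using that by (auto simp: \<A>_def intro: bounded_plus_comp)
    fix k assume "k \<in> K"
    then have "(\<lambda>y. k y * of_real (g1 y)) \<in> K" "(\<lambda>y. k y * of_real (g2 y)) \<in> K"
      using that by (auto simp: \<A>_def)
    then show "(\<lambda>y. k y * of_real (g1 y + g2 y)) \<in> K"
      by (simp add: K_def distrib_left distrib_right int_cis)
  qed
  have mult: "(\<lambda>y. g1 y * g2 y) \<in> \<A>" if "g1 \<in> \<A>" "g2 \<in> \<A>" for g1 g2
    unfolding \<A>_def
  proof (intro CollectI conjI ballI)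
    show "continuous_on UNIV (\<lambda>y. g1 y * g2 y)"
      using that by (auto simp: \<A>_def intro: continuous_intros)
    show "bounded (range (\<lambda>y. g1 y * g2 y))"
    proof -
      have "bounded (range g1)" "bounded (range g2)" using that by (auto simp: \<A>_def)
      then obtain L1 L2 where L: "\<And>y. \<bar>g1 y\<bar> \<le> L1" "\<And>y. \<bar>g2 y\<bar> \<le> L2"
        unfolding bounded_iff by (metis rangeI real_norm_def)
      have "norm (g1 y * g2 y) \<le> L1 * L2" for y
        using mult_mono[OF L(1)[of y] L(2)[of y]] L(1)[of y] by (simp add: abs_mult)
      then show ?thesis unfolding bounded_iff by blast
    qed
    fix k assume "k \<in> K"
    then have "(\<lambda>y. k y * of_real (g1 y)) \<in> K"
      using that by (auto simp: \<A>_def)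
    then have "(\<lambda>y. k y * of_real (g1 y) * of_real (g2 y)) \<in> K"
      using that by (auto simp: \<A>_def)
    then show "(\<lambda>y. k y * of_real (g1 y * g2 y)) \<in> K"
      by (simp add: mult.assoc)
  qed
  have cos: "(\<lambda>y. cos (\<beta>0 \<bullet> (y - x))) \<in> \<A>" for \<beta>0 x
    unfolding \<A>_def
  proof (intro CollectI conjI ballI)
    show c: "continuous_on UNIV (\<lambda>y. cos (\<beta>0 \<bullet> (y - x)))" by (intro continuous_intros)
    show b: "bounded (range (\<lambda>y. cos (\<beta>0 \<bullet> (y - x))))" by (auto simp: bounded_iff intro!: exI[of _ 1])
    fix k assume "k \<in> K"
    then have k: "integrable lborel k" and k0: "\<And>\<beta>. (\<integral>y. k y * cis (\<beta> \<bullet> y) \<partial>lborel) = 0"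
      by (auto simp: K_def)
    \<comment> \<open>Multiplication by the cosine splits a character into the two characters of
      frequency \<open>\<beta> + \<beta>0\<close> and \<open>\<beta> - \<beta>0\<close>, both of
      which integrate to 0 against \<open>k\<close>.\<close>
    have "k y * of_real (cos (\<beta>0 \<bullet> (y - x))) * cis (\<beta> \<bullet> y) =
        cis (- (\<beta>0 \<bullet> x)) / 2 * (k y * cis ((\<beta> + \<beta>0) \<bullet> y)) + cis (\<beta>0 \<bullet> x) / 2 * (k y * cis ((\<beta> - \<beta>0) \<bullet> y))" for \<beta> y
    proof -
      have "of_real (cos (\<beta>0 \<bullet> (y - x))) = (cis (\<beta>0 \<bullet> y) * cis (- (\<beta>0 \<bullet> x)) + cis (- (\<beta>0 \<bullet> y)) * cis (\<beta>0 \<bullet> x)) / 2"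
        by (simp add: cis_mult complex_eq_iff inner_diff_right cos_diff sin_diff)
      moreover have "cis ((\<beta> + \<beta>0) \<bullet> y) = cis (\<beta> \<bullet> y) * cis (\<beta>0 \<bullet> y)"
        "cis ((\<beta> - \<beta>0) \<bullet> y) = cis (\<beta> \<bullet> y) * cis (- (\<beta>0 \<bullet> y))"
        by (simp_all add: cis_mult inner_add_left inner_diff_left)
      ultimately show ?thesis by (simp only:) (simp add: field_simps)
    qed
    then have "(\<integral>y. k y * of_real (cos (\<beta>0 \<bullet> (y - x))) * cis (\<beta> \<bullet> y) \<partial>lborel) = 0" for \<beta>
      by (simp add: int_cis k k0)
    then show "(\<lambda>y. k y * of_real (cos (\<beta>0 \<bullet> (y - x)))) \<in> K"
      using int_bd[OF k c b] by (simp add: K_def)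
  qed
  have poly: "(\<lambda>y. p (g y)) \<in> \<A>" if p: "real_polynomial_function p" and g: "g \<in> \<A>" for p g
    using p
  proof induction
    case (linear p)
    then have "p x = x * p 1" for x
      using linear_cmul[OF bounded_linear.linear[OF linear], of x 1] by simp
    then show ?case using mult[OF g const[of "p 1"]] by (metis (no_types, lifting) ext)
  qed (auto intro: const add mult)
  have "h \<in> K" using h F by (simp add: K_def)
  have A0: "(\<integral>y. h y * of_real (g y) \<partial>lborel) = 0" "integrable lborel (\<lambda>y. h y * of_real (g y))" if "g \<in> \<A>" for g
  proof -
    have "(\<lambda>y. h y * of_real (g y)) \<in> K" using that \<open>h \<in> K\<close> by (auto simp: \<A>_def)
    then show "(\<integral>y. h y * of_real (g y) \<partial>lborel) = 0" "integrable lborel (\<lambda>y. h y * of_real (g y))"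
      unfolding K_def by (auto dest!: spec[of _ 0])
  qed
  have fb: "bounded (range f)" using f01 by (auto simp: bounded_iff intro!: exI[of _ 1])
  note hf = int_bd[OF h cf fb]
  let ?H = "\<integral>y. cmod (h y) \<partial>lborel"
  have bound: "cmod (\<integral>y. h y * of_real (f y) \<partial>lborel) \<le> e * (2 * ?H + 3)" if e: "0 < e" "e < 1" for e
  proof -
    have "(\<lambda>n. \<integral>y. indicator (- cball 0 (real n)) y *\<^sub>R cmod (h y) \<partial>lborel) \<longlonglongrightarrow> (\<integral>y. 0 \<partial>(lborel :: 'a measure))"
    proof (rule integral_dominated_convergence)
      show "integrable lborel (\<lambda>y. cmod (h y))" using h by simp
      have "(\<lambda>n. indicator (- cball 0 (real n)) y *\<^sub>R cmod (h y)) \<longlonglongrightarrow> 0" for y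
      proof (rule tendsto_eventually)
        obtain N :: nat where "norm y \<le> N" using real_arch_simple by blast
        then show "\<forall>\<^sub>F n in sequentially. indicator (- cball 0 (real n)) y *\<^sub>R cmod (h y) = 0"
          by (auto simp: eventually_sequentially intro!: exI[of _ N])
      qed
      then show "AE y in lborel. (\<lambda>n. indicator (- cball 0 (real n)) y *\<^sub>R cmod (h y)) \<longlonglongrightarrow> 0" by simp
    qed (use h in \<open>auto split: split_indicator\<close>)
    then have "\<forall>\<^sub>F n in sequentially. (\<integral>y. indicator (- cball 0 (real n)) y *\<^sub>R cmod (h y) \<partial>lborel) < e"
      by (rule order_tendstoD) (use e in simp)
    then obtain n :: nat where n: "(\<integral>y. indicator (- cball 0 (real n)) y *\<^sub>R cmod (h y) \<partial>lborel) < e"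
      by (auto simp: eventually_sequentially)
    let ?S = "cball (0::'a) (real n)"
    interpret function_ring_on \<A> ?S
    proof
      show "compact ?S" by simp
      show "continuous_on ?S g" if "g \<in> \<A>" for g
        using that by (auto simp: \<A>_def intro: continuous_on_subset)
      fix x y :: 'a assume "x \<noteq> y"
      \<comment> \<open>Normalized so that \<open>?b \<bullet> (y - x) = -1\<close>; the cosine
        centred at \<open>x\<close> then takes the values 1 at \<open>x\<close> and
        \<open>cos 1 < 1\<close> at \<open>y\<close>.\<close>
      let ?b = "(1 / (norm (x - y))\<^sup>2) *\<^sub>R (x - y)"
      have "?b \<bullet> (y - x) = - (((x - y) \<bullet> (x - y)) / (norm (x - y))\<^sup>2)"
        by (simp add: inner_diff_right inner_diff_left algebra_simps diff_divide_distrib add_divide_distrib)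
      then have "?b \<bullet> (y - x) = - 1" using \<open>x \<noteq> y\<close> by (simp flip: power2_norm_eq_inner)
      moreover have "cos (-1 :: real) < 1"
        using cos_monotone_0_pi[of 0 1] pi_gt3 by simp
      ultimately have "cos (?b \<bullet> (x - x)) \<noteq> cos (?b \<bullet> (y - x))" by (metis cos_zero diff_self inner_zero_right less_irrefl)
      then show "\<exists>g\<in>\<A>. g x \<noteq> g y" using cos[of ?b x] by (intro bexI[of _ "\<lambda>y. cos (?b \<bullet> (y - x))"]) auto
    qed (auto intro: add mult const)
    obtain P where P: "P \<in> \<A>" "\<And>y. y \<in> ?S \<Longrightarrow> \<bar>f y - P y\<bar> < e"
      using Stone_Weierstrass_basic[OF continuous_on_subset[OF cf] e(1)] by auto
    obtain L where L: "\<And>y. \<bar>P y\<bar> \<le> L" using P(1) unfolding \<A>_def by (metis (mono_tags, lifting) bounded_iff mem_Collect_eq rangeI real_norm_def)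
    let ?cl = "\<lambda>x::real. max 0 (min 1 x)"
    obtain p where p: "real_polynomial_function p" "\<And>x. x \<in> {-L..L} \<Longrightarrow> \<bar>?cl x - p x\<bar> < e"
      by (rule Stone_Weierstrass_real_polynomial_function[of "{-L..L}" ?cl e])
        (auto intro!: continuous_intros e)
    let ?g = "\<lambda>y. p (P y)"
    have g: "?g \<in> \<A>" by (rule poly[OF p(1) P(1)])
    have pg: "\<bar>?cl (P y) - ?g y\<bar> < e" for y
      using p(2)[of "P y"] L[of y] by (auto simp: abs_le_iff)
    \<comment> \<open>On the ball, clamping to \<open>[0, 1]\<close> does not increase the distance
      to \<open>f\<close>, which gives one \<open>e\<close>, and \<open>p\<close> adds another.
      Outside, \<open>f\<close> lies in \<open>[0, 1]\<close> and \<open>?g\<close> within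
      \<open>e\<close> of it, so any constant from \<open>1 + e\<close> on would do.\<close>
    have near: "\<bar>f y - ?g y\<bar> \<le> 2 * e + 3 * indicator (- ?S) y" for y
    proof (cases "y \<in> ?S")
      case True
      have "\<bar>f y - ?cl (P y)\<bar> \<le> \<bar>f y - P y\<bar>" using f01[of y] by (auto simp: abs_if max_def min_def)
      then show ?thesis using P(2)[OF True] pg[of y] True by simp
    next
      case False
      then show ?thesis using pg[of y] f01[of y] e by (auto simp: abs_if max_def min_def split: if_splits)
    qed
    have "cmod (\<integral>y. h y * of_real (f y) \<partial>lborel) = cmod (\<integral>y. h y * of_real (f y) - h y * of_real (?g y) \<partial>lborel)"
      using A0[OF g] hf by simp
    also have "\<dots> \<le> (\<integral>y. cmod (h y * of_real (f y) - h y * of_real (?g y)) \<partial>lborel)"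
      by (rule integral_norm_bound)
    also have "\<dots> \<le> (\<integral>y. 2 * e * cmod (h y) + 3 * (indicator (- ?S) y *\<^sub>R cmod (h y)) \<partial>lborel)"
    proof (rule integral_mono)
      show "integrable lborel (\<lambda>y. cmod (h y * of_real (f y) - h y * of_real (?g y)))"
        using A0[OF g] hf by simp
      show "integrable lborel (\<lambda>y. 2 * e * cmod (h y) + 3 * (indicator (- ?S) y *\<^sub>R cmod (h y)))"
        using h by (intro Bochner_Integration.integrable_add integrable_mult_right integrable_mult_indicator) auto
      fix y
      have "cmod (h y * of_real (f y) - h y * of_real (?g y)) = cmod (h y) * \<bar>f y - ?g y\<bar>"
        by (metis norm_mult norm_of_real of_real_diff right_diff_distrib)
      also have "\<dots> \<le> cmod (h y) * (2 * e + 3 * indicator (- ?S) y)"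
        by (intro mult_left_mono near) simp
      finally show "cmod (h y * of_real (f y) - h y * of_real (?g y)) \<le> 2 * e * cmod (h y) + 3 * (indicator (- ?S) y *\<^sub>R cmod (h y))"
        by (simp add: algebra_simps)
    qed
    also have "\<dots> = 2 * e * ?H + 3 * (\<integral>y. indicator (- ?S) y *\<^sub>R cmod (h y) \<partial>lborel)"
    proof -
      have "integrable lborel (\<lambda>y. indicator (- ?S) y *\<^sub>R cmod (h y))"
        by (rule integrable_mult_indicator) (use h in auto)
      then show ?thesis using h by simp
    qed
    also have "\<dots> \<le> e * (2 * ?H + 3)" using n by (simp add: algebra_simps)
    finally show ?thesis .
  qed
  have "cmod (\<integral>y. h y * of_real (f y) \<partial>lborel) \<le> 0"
  proof (rule tendsto_le[OF trivial_limit_at_right_real])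
    show "((\<lambda>e. e * (2 * ?H + 3)) \<longlongrightarrow> 0) (at_right 0)"
      by (auto intro!: tendsto_eq_intros)
    show "((\<lambda>e. cmod (\<integral>y. h y * of_real (f y) \<partial>lborel)) \<longlongrightarrow> cmod (\<integral>y. h y * of_real (f y) \<partial>lborel)) (at_right (0::real))"
      by simp
    show "\<forall>\<^sub>F e in at_right 0. cmod (\<integral>y. h y * of_real (f y) \<partial>lborel) \<le> e * (2 * ?H + 3)"
      using bound by (auto simp: eventually_at_right_field intro!: exI[of _ 1])
  qed
  then show "(\<integral>y. h y * of_real (f y) \<partial>lborel) = 0" by simp
qed

lemma completion_ex_borel_measurable_complex:
  fixes h :: "'a \<Rightarrow> complex"
  assumes "h \<in> borel_measurable (completion M)"
  obtains h' where "h' \<in> borel_measurable M" "AE x in M. h x = h' x"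
proof -
  have [measurable]: "h \<in> borel_measurable (completion M)" by fact
  obtain r where r [measurable]: "r \<in> borel_measurable M" "AE x in M. Re (h x) = r x"
    using completion_ex_borel_measurable_real[of "\<lambda>x. Re (h x)" M] by auto
  obtain i where i [measurable]: "i \<in> borel_measurable M" "AE x in M. Im (h x) = i x"
    using completion_ex_borel_measurable_real[of "\<lambda>x. Im (h x)" M] by auto
  show ?thesis
  proof (rule that)
    show "(\<lambda>x. of_real (r x) + \<i> * of_real (i x)) \<in> borel_measurable M" by measurable
    show "AE x in M. h x = of_real (r x) + \<i> * of_real (i x)"
      using r(2) i(2) by eventually_elim (simp add: complex_eq_iff)
  qed
qed

text \<open>A Borel representative of \<open>h\<close> carries the result from \<open>lborel\<close>
  to its completion.\<close>

theorem Fourier_injective: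
  fixes h :: "'a::euclidean_space \<Rightarrow> complex"
  assumes h: "integrable lebesgue h" and F: "\<And>\<beta>. (\<integral>y. h y * cis (\<beta> \<bullet> y) \<partial>lebesgue) = 0"
  shows "AE y in lebesgue. h y = 0"
proof -
  obtain h' where h' [measurable]: "h' \<in> borel_measurable lborel" and eq: "AE y in lborel. h y = h' y"
    using completion_ex_borel_measurable_complex[of h lborel] h by auto
  have cis_meas [measurable]: "(\<lambda>y. cis (\<beta> \<bullet> y)) \<in> borel_measurable borel" for \<beta> :: 'a
    by (intro borel_measurable_continuous_onI continuous_intros)
  have eq': "AE y in lebesgue. h y = h' y" using eq by (rule AE_completion)
  have h'l: "h' \<in> borel_measurable lebesgue" by (rule measurable_completion) simp
  have "integrable lebesgue h'"
    using h by (rule Bochner_Integration.integrable_cong_AE_imp) (use eq' h'l in \<open>auto elim: eventually_mono\<close>)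
  then have "integrable lborel h'" by (simp add: integrable_completion)
  moreover have "(\<integral>y. h' y * cis (\<beta> \<bullet> y) \<partial>lborel) = 0" for \<beta>
  proof -
    have "(\<integral>y. h' y * cis (\<beta> \<bullet> y) \<partial>lborel) = (\<integral>y. h' y * cis (\<beta> \<bullet> y) \<partial>lebesgue)"
      by (rule integral_completion[symmetric]) measurable
    also have "\<dots> = (\<integral>y. h y * cis (\<beta> \<bullet> y) \<partial>lebesgue)"
    proof (rule integral_cong_AE)
      have c: "(\<lambda>y. cis (\<beta> \<bullet> y)) \<in> borel_measurable lebesgue"
        by (rule measurable_completion) simp
      show "(\<lambda>y. h' y * cis (\<beta> \<bullet> y)) \<in> borel_measurable lebesgue" using h'l c by measurable
      show "(\<lambda>y. h y * cis (\<beta> \<bullet> y)) \<in> borel_measurable lebesgue"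
        using c borel_measurable_integrable[OF h] by measurable
      show "AE y in lebesgue. h' y * cis (\<beta> \<bullet> y) = h y * cis (\<beta> \<bullet> y)"
        using eq' by eventually_elim simp
    qed
    finally show ?thesis using F by simp
  qed
  ultimately have "AE y in lborel. h' y = 0" by (rule Fourier_injective_lborel)
  then have "AE y in lborel. h y = 0"
    using eq by eventually_elim simp
  then show ?thesis by (rule AE_completion)
qed

section \<open>Square integrable functions\<close>

lemma test_function_iff:
  fixes \<phi> :: "'a::euclidean_space \<Rightarrow> complex"
  shows "test_function \<phi> \<longleftrightarrow> smooth \<phi> \<and> (\<exists>r>0. \<forall>y. r \<le> norm y \<longrightarrow> \<phi> y = 0)"
proof -
  have "compact (closure {y. \<phi> y \<noteq> 0}) \<longleftrightarrow> bounded {y. \<phi> y \<noteq> 0}"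
    by (rule compact_closure)
  also have "\<dots> \<longleftrightarrow> (\<exists>r>0. \<forall>y. r \<le> norm y \<longrightarrow> \<phi> y = 0)"
  proof
    assume "bounded {y. \<phi> y \<noteq> 0}"
    then obtain B where "B > 0" "\<forall>y. \<phi> y \<noteq> 0 \<longrightarrow> norm y \<le> B" by (auto simp: bounded_pos)
    then show "\<exists>r>0. \<forall>y. r \<le> norm y \<longrightarrow> \<phi> y = 0" by (intro exI[of _ "B + 1"]) force
  next
    assume "\<exists>r>0. \<forall>y. r \<le> norm y \<longrightarrow> \<phi> y = 0"
    then show "bounded {y. \<phi> y \<noteq> 0}" unfolding bounded_iff by (metis (mono_tags) linear mem_Collect_eq)
  qed
  finally show ?thesis by (simp add: test_function_def)
qed

text \<open>A function of \<open>y \<bullet> y\<close>: smooth at the origin as well, and radial, so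
  that rotations annihilate it. It falls from 1 to 0 while \<open>y \<bullet> y\<close> runs from
  \<open>r^2\<close> to \<open>2 r^2\<close>.\<close>

definition cutoff :: "real \<Rightarrow> 'a::euclidean_space \<Rightarrow> real" where
  "cutoff r y = smooth_step (2 - (y \<bullet> y) / r\<^sup>2)"

lemma differentiable_upto_cutoff:
  "differentiable_upto n f \<Longrightarrow> differentiable_upto n (\<lambda>x. cutoff r (f x))"
  unfolding cutoff_def
  by (rule differentiable_upto_compose[of _ smooth_step])
    (use smooth_smooth_step in \<open>auto simp: smooth_iff divide_inverse intro!: differentiable_upto_intros\<close>)

lemma cutoff_eq_1: "0 < r \<Longrightarrow> norm y \<le> r \<Longrightarrow> cutoff r y = 1"
  unfolding cutoff_def
  by (rule smooth_step_eq_1) (simp add: power2_norm_eq_inner[symmetric] divide_le_eq power_mono)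

lemma cutoff_eq_0: "0 < r \<Longrightarrow> 2 * r \<le> norm y \<Longrightarrow> cutoff r y = 0"
proof -
  assume "0 < r" "2 * r \<le> norm y"
  then have "(2 * r)\<^sup>2 \<le> (norm y)\<^sup>2" by (intro power_mono) auto
  then show ?thesis unfolding cutoff_def
    using \<open>0 < r\<close> by (intro smooth_step_eq_0) (auto simp: power2_norm_eq_inner[symmetric] le_divide_eq power_mult_distrib intro: order_trans[rotated])
qed

lemma cutoff_bounds: "0 \<le> cutoff r y" "cutoff r y \<le> 1"
  by (simp_all add: cutoff_def smooth_step_bounds)

lemma integrable_locally_times_bounded:
  fixes f g :: "'a::euclidean_space \<Rightarrow> complex"
  assumes f: "locally_integrable f" and g: "continuous_on UNIV g" "\<And>y. r \<le> norm y \<Longrightarrow> g y = 0"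
  shows "integrable lebesgue (\<lambda>y. f y * g y)"
proof -
  have "compact (g ` cball 0 r)"
    using g(1) by (intro compact_continuous_image compact_cball continuous_on_subset[OF g(1)]) auto
  then obtain B where B: "\<And>y. norm y \<le> r \<Longrightarrow> cmod (g y) \<le> B"
    by (metis bounded_iff compact_imp_bounded imageI mem_cball_0)
  have i: "integrable lebesgue (\<lambda>y. of_real B * (indicator (cball 0 r) y *\<^sub>R f y))"
    using f unfolding locally_integrable_def set_integrable_def by (intro integrable_mult_right) simp
  have eq: "f y * g y = (indicator (cball 0 r) y *\<^sub>R f y) * g y" for y
    using g(2)[of y] by (auto simp: indicator_def)
  show ?thesis
  proof (rule Bochner_Integration.integrable_bound[OF i])
    have "(\<lambda>y. indicator (cball 0 r) y *\<^sub>R f y) \<in> borel_measurable lebesgue"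
      using f unfolding locally_integrable_def set_integrable_def
      by (intro borel_measurable_integrable) (auto dest: spec[of _ "cball 0 r"])
    then show "(\<lambda>y. f y * g y) \<in> borel_measurable lebesgue"
      unfolding eq[abs_def] by (rule borel_measurable_times) (rule borel_measurable_lebesgue_continuous[OF g(1)])
    show "AE y in lebesgue. cmod (f y * g y) \<le> cmod (of_real B * (indicator (cball 0 r) y *\<^sub>R f y))"
    proof (rule AE_I2)
      fix y
      show "cmod (f y * g y) \<le> cmod (of_real B * (indicator (cball 0 r) y *\<^sub>R f y))"
      proof (cases "norm y \<le> r")
        case True
        have "cmod (g y) \<le> \<bar>B\<bar>" using B[OF True] by linarith
        then have "cmod (f y) * cmod (g y) \<le> cmod (f y) * \<bar>B\<bar>" by (rule mult_left_mono) simp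
        then show ?thesis using True by (simp add: norm_mult mult.commute)
      qed (use g(2)[of y] in auto)
    qed
  qed
qed

lemma locally_integrable_measurable:
  fixes f :: "'a::euclidean_space \<Rightarrow> complex"
  assumes "locally_integrable f" shows "f \<in> borel_measurable lebesgue"
proof (rule borel_measurable_LIMSEQ_metric)
  show "(\<lambda>y. indicator (cball 0 (real n)) y *\<^sub>R f y) \<in> borel_measurable lebesgue" for n
    using assms unfolding locally_integrable_def set_integrable_def
    by (intro borel_measurable_integrable) auto
  show "(\<lambda>n. indicator (cball 0 (real n)) y *\<^sub>R f y) \<longlonglongrightarrow> f y" for y
  proof (rule tendsto_eventually)
    obtain N :: nat where "norm y \<le> N" using real_arch_simple by blast
    then show "\<forall>\<^sub>F n in sequentially. indicator (cball 0 (real n)) y *\<^sub>R f y = f y"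
      by (auto simp: eventually_sequentially intro!: exI[of _ N])
  qed
qed

text \<open>A cutoff times a character is a test function, so \<open>h\<close> times the cutoff is
  integrable with vanishing Fourier transform. Letting the radius run through the integers covers
  the whole space.\<close>

lemma AE_zero_of_test_functions:
  fixes h :: "'a::euclidean_space \<Rightarrow> complex"
  assumes h: "locally_integrable h" and 0: "\<And>\<phi>. test_function \<phi> \<Longrightarrow> (\<integral>y. h y * \<phi> y \<partial>lebesgue) = 0"
  shows "AE y in lebesgue. h y = 0"
proof -
  have "AE y in lebesgue. h y * of_real (cutoff (real (Suc n)) y) = 0" for n
  proof (rule Fourier_injective)
    have cut: "continuous_on UNIV (\<lambda>y::'a. complex_of_real (cutoff (real (Suc n)) y))"
      by (rule smooth_continuous) (auto simp: smooth_iff intro!: differentiable_upto_intros differentiable_upto_cutoff)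
    show "integrable lebesgue (\<lambda>y. h y * of_real (cutoff (real (Suc n)) y))"
      by (rule integrable_locally_times_bounded[OF h cut, of "2 * real (Suc n)"]) (simp add: cutoff_eq_0)
    fix \<beta> :: 'a
    have "smooth (\<lambda>y. of_real (cutoff (real (Suc n)) y) * cis (\<beta> \<bullet> y))"
      unfolding cis_conv_exp smooth_iff
      by (auto intro!: differentiable_upto_intros differentiable_upto_cutoff differentiable_upto_exp)
    then have "test_function (\<lambda>y. of_real (cutoff (real (Suc n)) y) * cis (\<beta> \<bullet> y))"
      unfolding test_function_iff by (auto simp: cutoff_eq_0 intro!: exI[of _ "2 * real (Suc n)"])
    from 0[OF this] show "(\<integral>y. h y * of_real (cutoff (real (Suc n)) y) * cis (\<beta> \<bullet> y) \<partial>lebesgue) = 0"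
      by (simp add: mult.assoc)
  qed
  then have "AE y in lebesgue. \<forall>n. h y * of_real (cutoff (real (Suc n)) y) = 0"
    unfolding AE_all_countable by blast
  then show ?thesis
  proof eventually_elim
    case (elim y)
    obtain N :: nat where "norm y \<le> N" using real_arch_simple by blast
    then have "cutoff (real (Suc N)) y = 1" by (intro cutoff_eq_1) auto
    then show ?case using elim[rule_format, of N] by simp
  qed
qed

lemma L2I:
  fixes f :: "'a::euclidean_space \<Rightarrow> complex"
  assumes "f \<in> borel_measurable lebesgue" "integrable lebesgue (\<lambda>y. (G y)\<^sup>2)" "\<And>y. cmod (f y) \<le> G y"
  shows "L2 f" "L2_norm f \<le> sqrt (\<integral>y. (G y)\<^sup>2 \<partial>lebesgue)"
proof -
  have le: "(cmod (f y))\<^sup>2 \<le> (G y)\<^sup>2" for y by (intro power_mono assms) simp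
  show 1: "L2 f" unfolding L2_def
  proof
    show "integrable lebesgue (\<lambda>y. (cmod (f y))\<^sup>2)"
      by (rule Bochner_Integration.integrable_bound[OF assms(2)])
        (use assms(1) le in \<open>auto intro!: AE_I2\<close>)
  qed (fact assms)
  show "L2_norm f \<le> sqrt (\<integral>y. (G y)\<^sup>2 \<partial>lebesgue)"
    unfolding L2_norm_def using 1 assms(2) le
    by (intro real_sqrt_le_mono integral_mono) (auto simp: L2_def)
qed

lemma L2_mult_integrable:
  fixes f g :: "'a::euclidean_space \<Rightarrow> complex"
  assumes "L2 f" "L2 g" shows "integrable lebesgue (\<lambda>y. f y * g y)"
proof (rule Bochner_Integration.integrable_bound)
  show "integrable lebesgue (\<lambda>y. (cmod (f y))\<^sup>2 + (cmod (g y))\<^sup>2)"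
    using assms by (simp add: L2_def)
  show "(\<lambda>y. f y * g y) \<in> borel_measurable lebesgue"
    using assms by (auto simp: L2_def)
  show "AE y in lebesgue. cmod (f y * g y) \<le> norm ((cmod (f y))\<^sup>2 + (cmod (g y))\<^sup>2)"
  proof (rule AE_I2)
    fix y
    have "2 * (cmod (f y) * cmod (g y)) \<le> (cmod (f y))\<^sup>2 + (cmod (g y))\<^sup>2"
      using sum_squares_bound[of "cmod (f y)" "cmod (g y)"] by simp
    moreover have "0 \<le> cmod (f y) * cmod (g y)" by simp
    ultimately have "cmod (f y) * cmod (g y) \<le> (cmod (f y))\<^sup>2 + (cmod (g y))\<^sup>2" by linarith
    then show "cmod (f y * g y) \<le> norm ((cmod (f y))\<^sup>2 + (cmod (g y))\<^sup>2)"
      by (simp add: norm_mult)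
  qed
qed

lemma L2_norm_nonneg: "0 \<le> L2_norm f"
  by (simp add: L2_norm_def)

lemma L2_Cauchy_Schwarz:
  fixes f g :: "'a::euclidean_space \<Rightarrow> complex"
  assumes "L2 f" "L2 g" shows "cmod (\<integral>y. f y * g y \<partial>lebesgue) \<le> L2_norm f * L2_norm g"
proof -
  let ?a = "\<integral>y. (cmod (f y))\<^sup>2 \<partial>lebesgue" and ?b = "\<integral>y. (cmod (g y))\<^sup>2 \<partial>lebesgue"
    and ?c = "\<integral>y. cmod (f y) * cmod (g y) \<partial>lebesgue"
  have ia: "integrable lebesgue (\<lambda>y. (cmod (f y))\<^sup>2)" and ib: "integrable lebesgue (\<lambda>y. (cmod (g y))\<^sup>2)"
    using assms by (auto simp: L2_def)
  have ic: "integrable lebesgue (\<lambda>y. cmod (f y) * cmod (g y))"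
    using integrable_norm[OF L2_mult_integrable[OF assms]] by (simp add: norm_mult)
  have c0: "0 \<le> ?c" by (intro Bochner_Integration.integral_nonneg) simp
  have quad: "0 \<le> ?a - 2 * s * ?c + s\<^sup>2 * ?b" for s
  proof -
    have "0 \<le> (\<integral>y. (cmod (f y) - s * cmod (g y))\<^sup>2 \<partial>lebesgue)" by (intro Bochner_Integration.integral_nonneg) simp
    also have "\<dots> = (\<integral>y. (cmod (f y))\<^sup>2 - 2 * s * (cmod (f y) * cmod (g y)) + s\<^sup>2 * (cmod (g y))\<^sup>2 \<partial>lebesgue)"
      by (intro Bochner_Integration.integral_cong) (auto simp: power2_eq_square algebra_simps)
    also have "\<dots> = ?a - 2 * s * ?c + s\<^sup>2 * ?b"
      using ia ib ic by simp
    finally show ?thesis .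
  qed
  have "?c\<^sup>2 \<le> ?a * ?b"
  proof (cases "?b = 0")
    case True
    have "?c = 0"
    proof (rule ccontr)
      assume "?c \<noteq> 0"
      \<comment> \<open>For \<open>?b = 0\<close> the polynomial is affine in \<open>s\<close>, and
        this \<open>s\<close> gives it the value -1.\<close>
      then show False using quad[of "(?a + 1) / (2 * ?c)"] True by simp
    qed
    then show ?thesis using True by simp
  next
    case False
    moreover have "0 \<le> ?b" by (intro Bochner_Integration.integral_nonneg) simp
    ultimately have b: "?b > 0" by linarith
    have "0 \<le> (?a - 2 * (?c / ?b) * ?c + (?c / ?b)\<^sup>2 * ?b) * ?b"
      using quad[of "?c / ?b"] b by simp
    also have "\<dots> = ?a * ?b - ?c\<^sup>2"
      using b by (simp add: field_simps power2_eq_square)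
    finally show ?thesis by simp
  qed
  then have "?c \<le> sqrt (?a * ?b)" by (rule real_le_rsqrt)
  moreover have "cmod (\<integral>y. f y * g y \<partial>lebesgue) \<le> ?c"
    using integral_norm_bound[of lebesgue "\<lambda>y. f y * g y"] by (simp add: norm_mult)
  ultimately show ?thesis by (simp add: L2_norm_def real_sqrt_mult)
qed

lemma L2_diff:
  fixes f g :: "'a::euclidean_space \<Rightarrow> complex"
  assumes "L2 f" "L2 g" shows "L2 (\<lambda>y. f y - g y)"
  unfolding L2_def
proof
  show m: "(\<lambda>y. f y - g y) \<in> borel_measurable lebesgue" using assms by (auto simp: L2_def)
  show "integrable lebesgue (\<lambda>y. (cmod (f y - g y))\<^sup>2)"
  proof (rule Bochner_Integration.integrable_bound)
    show "integrable lebesgue (\<lambda>y. 2 * (cmod (f y))\<^sup>2 + 2 * (cmod (g y))\<^sup>2)"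
      using assms by (simp add: L2_def)
    show "AE y in lebesgue. norm ((cmod (f y - g y))\<^sup>2) \<le> norm (2 * (cmod (f y))\<^sup>2 + 2 * (cmod (g y))\<^sup>2)"
    proof (rule AE_I2)
      fix y
      have "(cmod (f y - g y))\<^sup>2 \<le> (cmod (f y) + cmod (g y))\<^sup>2"
        by (intro power_mono norm_triangle_ineq4) simp
      also have "\<dots> \<le> 2 * (cmod (f y))\<^sup>2 + 2 * (cmod (g y))\<^sup>2"
        using sum_squares_bound[of "cmod (f y)" "cmod (g y)"] by (simp add: power2_sum)
      finally show "norm ((cmod (f y - g y))\<^sup>2) \<le> norm (2 * (cmod (f y))\<^sup>2 + 2 * (cmod (g y))\<^sup>2)" by simp
    qed
  qed (use m in measurable)
qed

lemma L2_indicator_compact: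
  "compact K \<Longrightarrow> L2 (\<lambda>y::'a::euclidean_space. indicator K y)"
proof -
  assume K: "compact K"
  then have K': "K \<in> lmeasurable" by (rule lmeasurable_compact)
  have "(cmod (indicator K y))\<^sup>2 = indicator K y" for y by (simp add: indicator_def)
  then show ?thesis
    unfolding L2_def using K' by (auto intro!: integrable_real_indicator dest: fmeasurableD simp: fmeasurable_def)
qed

lemma L2_locally_integrable:
  fixes f :: "'a::euclidean_space \<Rightarrow> complex"
  assumes "L2 f" shows "locally_integrable f"
  unfolding locally_integrable_def set_integrable_def
proof (intro allI impI)
  fix K :: "'a set" assume "compact K"
  from L2_mult_integrable[OF L2_indicator_compact[OF this] assms]
  show "integrable lebesgue (\<lambda>x. indicator K x *\<^sub>R f x)"
    by (rule Bochner_Integration.integrable_cong[THEN iffD1, rotated -1]) (auto simp: indicator_def)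
qed

lemma locally_integrable_diff:
  "locally_integrable f \<Longrightarrow> locally_integrable g \<Longrightarrow> locally_integrable (\<lambda>y. f y - g y)"
  by (auto simp: locally_integrable_def)

lemma test_function_continuous: "test_function \<phi> \<Longrightarrow> continuous_on A \<phi>"
  by (simp add: test_function_def smooth_continuous)

section \<open>From the spaces \<open>\<Sigma>\<^sup>k\<close> to square integrable
  functions\<close>

lemma concat_map_Nil: "concat (map (\<lambda>_. []) xs) = []"
  by (induction xs) auto

lemma mi_deriv_zero: "mi_deriv (\<lambda>_. 0) f = f"
  by (simp add: mi_deriv_def concat_map_Nil)

lemma has_weak_deriv_zero_AE:
  fixes f g :: "real ^ 'd::{finite,linorder} \<Rightarrow> complex"
  assumes "has_weak_deriv f (\<lambda>_. 0) g" shows "AE y in lebesgue. g y = f y"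
proof -
  have li: "locally_integrable f" "locally_integrable g"
    using assms by (auto simp: has_weak_deriv_def)
  have "AE y in lebesgue. f y - g y = 0"
  proof (rule AE_zero_of_test_functions)
    fix \<phi> :: "real ^ 'd::{finite,linorder} \<Rightarrow> complex" assume \<phi>: "test_function \<phi>"
    then obtain r where r: "\<And>y. r \<le> norm y \<Longrightarrow> \<phi> y = 0" by (auto simp: test_function_iff)
    have "(\<integral>y. f y * \<phi> y \<partial>lebesgue) = (\<integral>y. g y * \<phi> y \<partial>lebesgue)"
      using assms \<phi> by (auto simp: has_weak_deriv_def mi_deriv_zero mi_order_def)
    moreover have "integrable lebesgue (\<lambda>y. f y * \<phi> y)" "integrable lebesgue (\<lambda>y. g y * \<phi> y)"
      using integrable_locally_times_bounded[OF _ test_function_continuous[OF \<phi>] r] li by blast+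
    ultimately show "(\<integral>y. (f y - g y) * \<phi> y \<partial>lebesgue) = 0"
      by (simp add: left_diff_distrib)
  qed (intro locally_integrable_diff li)
  then show ?thesis by eventually_elim simp
qed

text \<open>\<open>weak_deriv\<close> is a choice among representatives even at order zero, so it
  returns \<open>f\<close> only up to a null set, and its measurability has to be recovered from
  local integrability.\<close>

lemma weak_deriv_zero_AE:
  fixes f :: "real ^ 'd::{finite,linorder} \<Rightarrow> complex"
  assumes "L2 f"
  shows "AE y in lebesgue. weak_deriv (\<lambda>_. 0) f y = f y" "weak_deriv (\<lambda>_. 0) f \<in> borel_measurable lebesgue"
proof -
  have "has_weak_deriv f (\<lambda>_. 0) f"
    using L2_locally_integrable[OF assms] by (auto simp: has_weak_deriv_def mi_deriv_zero mi_order_def)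
  then have *: "has_weak_deriv f (\<lambda>_. 0) (weak_deriv (\<lambda>_. 0) f)"
    unfolding weak_deriv_def by (metis someI)
  show "AE y in lebesgue. weak_deriv (\<lambda>_. 0) f y = f y" by (rule has_weak_deriv_zero_AE[OF *])
  show "weak_deriv (\<lambda>_. 0) f \<in> borel_measurable lebesgue"
    using * by (auto simp: has_weak_deriv_def intro: locally_integrable_measurable)
qed

text \<open>The summand with both multi-indices zero is the \<open>L2\<close> norm. Hence continuity
  in \<open>\<Sigma>\<^sup>k\<close> yields continuity in \<open>L2\<close> for every
  \<open>k\<close>.\<close>

lemma L2_norm_le_Sigma_norm:
  fixes f :: "real ^ 'd::{finite,linorder} \<Rightarrow> complex"
  assumes "L2 f" shows "L2_norm f \<le> Sigma_norm k f"
proof -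
  have "L2_norm f = L2_norm (\<lambda>y. of_real (mi_power y (\<lambda>_. 0)) * weak_deriv (\<lambda>_. 0) f y)"
    unfolding L2_norm_def
    by (intro arg_cong[of _ _ sqrt] integral_cong_AE)
      (use assms weak_deriv_zero_AE[OF assms] in \<open>auto simp: L2_def mi_power_def elim: eventually_mono\<close>)
  also have "\<dots> \<le> Sigma_norm k f"
    unfolding Sigma_norm_def
    by (rule order_trans[OF _ member_le_sum[of "(\<lambda>_. 0, \<lambda>_. 0)"]])
      (use finite_mi_order_le in \<open>auto simp: mi_order_def L2_norm_nonneg\<close>)
  finally show ?thesis .
qed

definition L2_continuous :: "(real \<Rightarrow> 'a::euclidean_space \<Rightarrow> complex) \<Rightarrow> bool" where
  "L2_continuous v \<longleftrightarrow> (\<forall>t. L2 (v t)) \<and> (\<forall>t. ((\<lambda>s. L2_norm (\<lambda>y. v s y - v t y)) \<longlongrightarrow> 0) (at t))"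

lemma continuous_in_Sigma_imp_L2_continuous:
  assumes "continuous_in_Sigma k v" shows "L2_continuous v"
proof -
  have L: "L2 (v t)" for t using assms by (auto simp: continuous_in_Sigma_def in_Sigma_def)
  have "((\<lambda>s. L2_norm (\<lambda>y. v s y - v t y)) \<longlongrightarrow> 0) (at t)" for t
  proof (rule tendsto_sandwich[OF _ _ tendsto_const])
    show "((\<lambda>s. Sigma_norm k (\<lambda>y. v s y - v t y)) \<longlongrightarrow> 0) (at t)"
      using assms by (simp add: continuous_in_Sigma_def)
  qed (auto intro!: always_eventually L2_norm_nonneg L2_norm_le_Sigma_norm L2_diff L)
  with L show ?thesis by (simp add: L2_continuous_def)
qed

text \<open>Shaped for dominated convergence in a pairing: one square integrable majorant has to
  serve only the times near \<open>t\<close>, so Gaussians with time-dependent width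
  qualify.\<close>

definition locally_dominated :: "(real \<Rightarrow> 'a::euclidean_space \<Rightarrow> complex) \<Rightarrow> bool" where
  "locally_dominated g \<longleftrightarrow> (\<forall>t. g t \<in> borel_measurable lebesgue) \<and>
    (\<forall>t. \<exists>e>0. \<exists>G. integrable lebesgue (\<lambda>y. (G y)\<^sup>2) \<and> G \<in> borel_measurable lebesgue \<and>
      (\<forall>s\<in>ball t e. \<forall>y. cmod (g s y) \<le> G y))"

lemma locally_dominated_L2: "locally_dominated g \<Longrightarrow> L2 (g t)"
  unfolding locally_dominated_def by (metis L2I(1) centre_in_ball)

text \<open>The change of \<open>v\<close> is controlled by Cauchy-Schwarz with the majorant, the
  change of \<open>g\<close> by dominated convergence against the fixed function
  \<open>v t\<close>.\<close>

lemma isCont_pairing: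
  fixes v g :: "real \<Rightarrow> 'a::euclidean_space \<Rightarrow> complex"
  assumes v: "L2_continuous v" and g: "locally_dominated g" and cont: "\<And>y. isCont (\<lambda>t. g t y) t"
  shows "isCont (\<lambda>t. \<integral>y. v t y * g t y \<partial>lebesgue) t"
proof -
  obtain e G where e: "e > 0" and G: "integrable lebesgue (\<lambda>y. (G y)\<^sup>2)" "G \<in> borel_measurable lebesgue"
    and dom: "\<And>s y. s \<in> ball t e \<Longrightarrow> cmod (g s y) \<le> G y"
    using g unfolding locally_dominated_def by metis
  have G0: "0 \<le> G y" for y using dom[of t y] e by (meson centre_in_ball norm_ge_zero order_trans)
  have GL: "L2 (\<lambda>y. of_real (G y))" using G by (auto simp: L2_def)
  have vL: "L2 (v s)" for s using v by (simp add: L2_continuous_def)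
  note gL = locally_dominated_L2[OF g]
  have "(\<lambda>n. \<integral>y. v (T n) y * g (T n) y \<partial>lebesgue) \<longlonglongrightarrow> (\<integral>y. v t y * g t y \<partial>lebesgue)"
    if T: "\<And>n. T n \<noteq> t" "T \<longlonglongrightarrow> t" "\<And>n. T n \<in> ball t e" for T
  proof -
    have split: "(\<integral>y. v (T n) y * g (T n) y \<partial>lebesgue) =
      (\<integral>y. (v (T n) y - v t y) * g (T n) y \<partial>lebesgue) + (\<integral>y. v t y * g (T n) y \<partial>lebesgue)" for n
      by (simp add: left_diff_distrib L2_mult_integrable vL gL)
    have "(\<lambda>n. \<integral>y. (v (T n) y - v t y) * g (T n) y \<partial>lebesgue) \<longlonglongrightarrow> 0"
    proof (rule Lim_null_comparison)
      show "\<forall>\<^sub>F n in sequentially. cmod (\<integral>y. (v (T n) y - v t y) * g (T n) y \<partial>lebesgue)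
          \<le> L2_norm (\<lambda>y. v (T n) y - v t y) * sqrt (\<integral>y. (G y)\<^sup>2 \<partial>lebesgue)"
      proof (rule always_eventually, rule allI)
        fix n
        have "cmod (\<integral>y. (v (T n) y - v t y) * g (T n) y \<partial>lebesgue)
            \<le> L2_norm (\<lambda>y. v (T n) y - v t y) * L2_norm (g (T n))"
          by (intro L2_Cauchy_Schwarz L2_diff vL gL)
        also have "\<dots> \<le> L2_norm (\<lambda>y. v (T n) y - v t y) * sqrt (\<integral>y. (G y)\<^sup>2 \<partial>lebesgue)"
          using g T(3) by (intro mult_left_mono L2I L2_norm_nonneg G dom) (auto simp: locally_dominated_def)
        finally show "cmod (\<integral>y. (v (T n) y - v t y) * g (T n) y \<partial>lebesgue)
          \<le> L2_norm (\<lambda>y. v (T n) y - v t y) * sqrt (\<integral>y. (G y)\<^sup>2 \<partial>lebesgue)" .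
      qed
      have "(\<lambda>n. L2_norm (\<lambda>y. v (T n) y - v t y)) \<longlonglongrightarrow> 0"
        using v T unfolding L2_continuous_def tendsto_at_iff_sequentially by (auto simp: o_def)
      then show "(\<lambda>n. L2_norm (\<lambda>y. v (T n) y - v t y) * sqrt (\<integral>y. (G y)\<^sup>2 \<partial>lebesgue)) \<longlonglongrightarrow> 0"
        by (auto intro!: tendsto_eq_intros)
    qed
    moreover have "(\<lambda>n. \<integral>y. v t y * g (T n) y \<partial>lebesgue) \<longlonglongrightarrow> (\<integral>y. v t y * g t y \<partial>lebesgue)"
    proof (rule integral_dominated_convergence)
      show "integrable lebesgue (\<lambda>y. cmod (v t y * of_real (G y)))"
        by (intro integrable_norm L2_mult_integrable vL GL)
      show "(\<lambda>y. v t y * g s y) \<in> borel_measurable lebesgue" for s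
        by (intro borel_measurable_integrable L2_mult_integrable vL gL)
      then show "(\<lambda>y. v t y * g (T n) y) \<in> borel_measurable lebesgue" for n .
      show "AE y in lebesgue. (\<lambda>n. v t y * g (T n) y) \<longlonglongrightarrow> v t y * g t y"
        by (intro AE_I2 tendsto_intros isCont_tendsto_compose[OF cont T(2)])
      show "AE y in lebesgue. norm (v t y * g (T n) y) \<le> cmod (v t y * of_real (G y))" for n
        using dom[OF T(3)] G0 by (intro AE_I2) (simp add: norm_mult mult_left_mono)
    qed
    ultimately have "(\<lambda>n. (\<integral>y. (v (T n) y - v t y) * g (T n) y \<partial>lebesgue) + (\<integral>y. v t y * g (T n) y \<partial>lebesgue))
      \<longlonglongrightarrow> 0 + (\<integral>y. v t y * g t y \<partial>lebesgue)" by (rule tendsto_add)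
    then show ?thesis unfolding split by simp
  qed
  then have "((\<lambda>t. \<integral>y. v t y * g t y \<partial>lebesgue) \<longlongrightarrow> (\<integral>y. v t y * g t y \<partial>lebesgue)) (at t within ball t e)"
    unfolding tendsto_at_iff_sequentially by (auto simp: o_def)
  then show ?thesis
    unfolding isCont_def using e by (simp add: at_within_open[of t "ball t e"])
qed

section \<open>Integration by parts\<close>

lemma continuous_compact_support_integrable:
  fixes f :: "'a::euclidean_space \<Rightarrow> complex"
  assumes f: "continuous_on UNIV f" "\<And>y. r \<le> norm y \<Longrightarrow> f y = 0"
  shows "integrable lborel f" "integrable lebesgue f"
proof -
  have "integrable lborel (\<lambda>y. indicator (cball 0 r) y *\<^sub>R f y)"
    using continuous_on_subset[OF f(1) subset_UNIV] by (intro borel_integrable_compact) auto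
  moreover have "(\<lambda>y. indicator (cball 0 r) y *\<^sub>R f y) = f"
    using f(2) by (auto simp: indicator_def fun_eq_iff)
  ultimately show "integrable lborel f" by simp
  then show "integrable lebesgue f"
    by (simp add: integrable_completion borel_measurable_continuous_onI[OF f(1)])
qed

lemma continuous_bounded_on_cball:
  fixes f :: "'a::euclidean_space \<Rightarrow> 'b::real_normed_vector"
  assumes "continuous_on UNIV f"
  obtains K where "K > 0" "\<And>y. norm y \<le> r \<Longrightarrow> norm (f y) \<le> K"
proof -
  have "bounded (f ` cball 0 r)"
    by (intro compact_imp_bounded compact_continuous_image compact_cball continuous_on_subset[OF assms]) simp
  then obtain K where "K > 0" "\<forall>z\<in>f ` cball 0 r. norm z \<le> K" unfolding bounded_pos by blast
  then show ?thesis by (intro that[of K]) auto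
qed

lemma test_function_integrable:
  assumes "test_function f" shows "integrable lborel f" "integrable lebesgue f"
  using assms continuous_compact_support_integrable[OF test_function_continuous[OF assms]]
  by (auto simp: test_function_iff)

lemma test_function_frechet_derivative:
  assumes "test_function f" "b \<in> Basis"
  shows "test_function (\<lambda>x. frechet_derivative f (at x) b)"
proof -
  obtain r where f: "smooth f" and r: "r > 0" "\<And>y. r \<le> norm y \<Longrightarrow> f y = 0"
    using assms by (auto simp: test_function_iff)
  \<comment> \<open>The margin 1 puts \<open>x\<close> in the open complement of the ball of radius
    \<open>r\<close>, where \<open>f\<close> vanishes identically.\<close>
  have "frechet_derivative f (at x) b = 0" if "r + 1 \<le> norm x" for x
  proof -
    have "((\<lambda>x. 0) has_derivative frechet_derivative f (at x)) (at x)"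
    proof (rule has_derivative_transform_within_open[OF smooth_has_derivative[OF f]])
      show "open (- cball 0 r :: 'a set)" by (simp add: open_Compl)
    qed (use that r in auto)
    then have "frechet_derivative f (at x) = (\<lambda>_. 0)"
      by (metis has_derivative_const has_derivative_unique)
    then show ?thesis by simp
  qed
  then show ?thesis
    unfolding test_function_iff using smooth_frechet_derivative[OF f assms(2)] r(1)
    by (intro conjI exI[of _ "r + 1"]) auto
qed

lemma has_vector_derivative_imp_quotient_tendsto:
  assumes "(f has_vector_derivative d) (at 0)"
  shows "((\<lambda>s. (f s - f 0) /\<^sub>R s) \<longlongrightarrow> d) (at 0)"
proof -
  have "((\<lambda>s. (f s - f 0 - s *\<^sub>R d) /\<^sub>R \<bar>s\<bar>) \<longlongrightarrow> 0) (at 0)"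
    using assms by (simp add: has_vector_derivative_def has_derivative_at_within has_derivative_def)
  then have "((\<lambda>s. norm ((f s - f 0 - s *\<^sub>R d) /\<^sub>R \<bar>s\<bar>)) \<longlongrightarrow> 0) (at 0)"
    by (rule tendsto_norm_zero)
  then have "((\<lambda>s. norm ((f s - f 0) /\<^sub>R s - d)) \<longlongrightarrow> 0) (at 0)"
  proof (rule Lim_transform_eventually)
    show "\<forall>\<^sub>F s in at 0. norm ((f s - f 0 - s *\<^sub>R d) /\<^sub>R \<bar>s\<bar>) = norm ((f s - f 0) /\<^sub>R s - d)"
    proof (rule eventually_at[THEN iffD2], intro exI[of _ 1] conjI ballI impI)
      fix s :: real assume "s \<noteq> 0 \<and> dist s 0 < 1"
      then have "(f s - f 0) /\<^sub>R s - d = (f s - f 0 - s *\<^sub>R d) /\<^sub>R s"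
        by (simp add: scaleR_diff_right)
      then show "norm ((f s - f 0 - s *\<^sub>R d) /\<^sub>R \<bar>s\<bar>) = norm ((f s - f 0) /\<^sub>R s - d)"
        by simp
    qed simp
  qed
  then show ?thesis by (metis Lim_null tendsto_norm_zero_cancel)
qed

text \<open>Difference quotients integrate to 0 by translation invariance and converge dominatedly
  to the derivative. This treats space and space-time alike, without iterated integrals.\<close>

lemma integral_derivative_test_function:
  fixes f :: "'a::euclidean_space \<Rightarrow> complex"
  assumes tf: "test_function f" and b: "b \<in> Basis"
  shows "(\<integral>y. frechet_derivative f (at y) b \<partial>lborel) = 0"
proof -
  obtain r where f: "smooth f" and r: "r > 0" "\<And>y. r \<le> norm y \<Longrightarrow> f y = 0"
    using assms by (auto simp: test_function_iff)
  let ?D = "\<lambda>y. frechet_derivative f (at y) b"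
  have D: "smooth ?D" by (rule smooth_frechet_derivative[OF f b])
  \<comment> \<open>Difference quotients with step at most 1 vanish for
    \<open>norm y > r + 1\<close>, and the intermediate point of the mean value theorem moves by at
    most 1 more; hence the radius \<open>r + 2\<close>.\<close>
  obtain K where K: "\<And>y. norm y \<le> r + 2 \<Longrightarrow> cmod (?D y) \<le> K"
    using continuous_bounded_on_cball[OF smooth_continuous[OF D]] by metis
  define h where "h n = inverse (real (Suc n))" for n
  have h: "0 < h n" "h n \<le> 1" for n by (auto simp: h_def inverse_le_1_iff)
  define g where "g n y = (f (h n *\<^sub>R b + y) - f y) /\<^sub>R h n" for n y
  have line: "((\<lambda>s. f (s *\<^sub>R b + y)) has_derivative (\<lambda>t. t *\<^sub>R ?D (s *\<^sub>R b + y))) (at s)" for s y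
  proof -
    have "((\<lambda>s. s *\<^sub>R b + y) has_derivative (\<lambda>t. t *\<^sub>R b)) (at s)"
      by (auto intro!: derivative_eq_intros)
    from has_derivative_compose[OF this smooth_has_derivative[OF f]]
    show ?thesis
      by (simp add: linear_cmul[OF has_derivative_linear[OF smooth_has_derivative[OF f]]])
  qed
  have shift: "(\<integral>y. f (c + y) \<partial>lborel) = (\<integral>y. f y \<partial>lborel)" "integrable lborel (\<lambda>y. f (c + y))" for c
  proof -
    have m: "f \<in> borel_measurable borel"
      using test_function_continuous[OF tf] by (rule borel_measurable_continuous_onI)
    have "(\<integral>y. f y \<partial>distr lborel borel ((+) c)) = (\<integral>y. f (c + y) \<partial>lborel)"
      by (rule integral_distr) (use m in auto)
    then show "(\<integral>y. f (c + y) \<partial>lborel) = (\<integral>y. f y \<partial>lborel)" by (simp add: lborel_distr_plus)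
    have "integrable (distr lborel borel ((+) c)) f \<longleftrightarrow> integrable lborel (\<lambda>y. f (c + y))"
      by (rule integrable_distr_eq) (use m in auto)
    then show "integrable lborel (\<lambda>y. f (c + y))"
      using test_function_integrable[OF tf] by (simp add: lborel_distr_plus)
  qed
  have "(\<lambda>n. \<integral>y. g n y \<partial>lborel) \<longlonglongrightarrow> (\<integral>y. ?D y \<partial>lborel)"
  proof (rule integral_dominated_convergence)
    show "?D \<in> borel_measurable lborel"
      using borel_measurable_continuous_onI[OF smooth_continuous[OF D]] by simp
    have "continuous_on UNIV (g n)" for n
      unfolding g_def
      by (intro continuous_intros continuous_on_compose2[OF smooth_continuous[OF f, of UNIV]] smooth_continuous[OF f]) auto
    then show "g n \<in> borel_measurable lborel" for n
      using borel_measurable_continuous_onI by simp blast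
    have "integrable lborel (\<lambda>y::'a. indicator (cball 0 (r + 1)) y *\<^sub>R K)"
      by (intro borel_integrable_compact continuous_intros) auto
    then show "integrable lborel (\<lambda>y::'a. indicator (cball 0 (r + 1)) y * K)" by simp
    have "(\<lambda>n. g n y) \<longlonglongrightarrow> ?D y" for y
    proof -
      have "((\<lambda>s. f (s *\<^sub>R b + y)) has_vector_derivative ?D y) (at 0)"
        using line[of y 0] by (simp add: has_vector_derivative_def)
      from has_vector_derivative_imp_quotient_tendsto[OF this]
      have "((\<lambda>s. (f (s *\<^sub>R b + y) - f y) /\<^sub>R s) \<longlongrightarrow> ?D y) (at 0)" by simp
      moreover have "filterlim h (at 0) sequentially"
        unfolding h_def using h LIMSEQ_inverse_real_of_nat by (auto simp: filterlim_at h_def intro!: always_eventually)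
      ultimately show ?thesis unfolding g_def by (rule filterlim_compose)
    qed
    then show "AE y in lborel. (\<lambda>n. g n y) \<longlonglongrightarrow> ?D y" by simp
    have "cmod (g n y) \<le> indicator (cball 0 (r + 1)) y * K" for n y
    proof (cases "norm y \<le> r + 1")
      case True
      have "\<exists>s\<in>{0<..<h n}. cmod (f (h n *\<^sub>R b + y) - f (0 *\<^sub>R b + y)) \<le> cmod ((h n - 0) *\<^sub>R ?D (s *\<^sub>R b + y))"
        by (rule mvt_general[OF h(1)])
          (auto intro!: line has_derivative_continuous_on[OF has_derivative_at_withinI[OF line]])
      then obtain s where s: "0 < s" "s < h n" and le: "cmod (f (h n *\<^sub>R b + y) - f y) \<le> h n * cmod (?D (s *\<^sub>R b + y))"
        using h(1)[of n] by auto
      have "norm (s *\<^sub>R b + y) \<le> norm (s *\<^sub>R b) + norm y" by (rule norm_triangle_ineq)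
      also have "\<dots> \<le> 1 + (r + 1)" using s h[of n] True b by (intro add_mono) auto
      finally have "cmod (?D (s *\<^sub>R b + y)) \<le> K" by (intro K) simp
      then have "h n * cmod (?D (s *\<^sub>R b + y)) \<le> h n * K" using h[of n] by (intro mult_left_mono) auto
      then have "cmod (f (h n *\<^sub>R b + y) - f y) \<le> h n * K" using le by linarith
      then have "inverse (h n) * cmod (f (h n *\<^sub>R b + y) - f y) \<le> inverse (h n) * (h n * K)"
        using h(1)[of n] by (intro mult_left_mono) auto
      then show ?thesis using True h(1)[of n] by (simp add: g_def mult.assoc[symmetric])
    next
      case False
      have "norm y \<le> norm (h n *\<^sub>R b + y) + norm (h n *\<^sub>R b)"
        using norm_triangle_ineq4[of "h n *\<^sub>R b + y" "h n *\<^sub>R b"] by simp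
      then have "r \<le> norm (h n *\<^sub>R b + y)" using False h[of n] b by simp
      then show ?thesis using False r by (simp add: g_def)
    qed
    then show "AE y in lborel. norm (g n y) \<le> indicator (cball 0 (r + 1)) y * K" for n by simp
  qed
  moreover have "(\<integral>y. g n y \<partial>lborel) = 0" for n
    unfolding g_def using shift[of "h n *\<^sub>R b"] test_function_integrable[OF tf] by simp
  ultimately show ?thesis by (simp add: LIMSEQ_const_iff)
qed

lemma integral_partial_deriv_test_function:
  fixes f :: "real ^ 'n \<Rightarrow> complex"
  assumes "test_function f"
  shows "(\<integral>y. partial_deriv j f y \<partial>lebesgue) = 0"
proof -
  have b: "axis j 1 \<in> (Basis :: (real ^ 'n) set)" by simp
  have "test_function (partial_deriv j f)"
    using test_function_frechet_derivative[OF assms b] by (simp add: partial_deriv_def)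
  then have "partial_deriv j f \<in> borel_measurable lborel"
    using borel_measurable_continuous_onI[OF test_function_continuous] by simp
  then show ?thesis
    using integral_derivative_test_function[OF assms b] integral_completion[of "partial_deriv j f" lborel]
    by (simp add: partial_deriv_def)
qed

lemma frechet_derivative_complex_mult:
  fixes f g :: "'a::euclidean_space \<Rightarrow> complex"
  assumes "smooth f" "smooth g"
  shows "frechet_derivative (\<lambda>x. f x * g x) (at x) b =
    f x * frechet_derivative g (at x) b + frechet_derivative f (at x) b * g x"
  using frechet_derivative_at[OF has_derivative_mult[OF smooth_has_derivative[OF assms(1)] smooth_has_derivative[OF assms(2)]], of x]
  by (simp add: fun_eq_iff)

lemma smooth_mult: "smooth f \<Longrightarrow> smooth g \<Longrightarrow> smooth (\<lambda>x. f x * g x :: complex)"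
  by (simp add: smooth_iff differentiable_upto_mult)

lemma smooth_partial_deriv: "smooth f \<Longrightarrow> smooth (partial_deriv j f)"
  using smooth_frechet_derivative[of f "axis j 1"] by (simp add: partial_deriv_def)

lemma test_function_smooth: "test_function f \<Longrightarrow> smooth f"
  by (simp add: test_function_def)

lemma test_function_mult:
  "smooth f \<Longrightarrow> test_function g \<Longrightarrow> test_function (\<lambda>x. f x * g x)"
  by (auto simp: test_function_iff smooth_mult)

lemma test_function_diff:
  assumes "test_function f" "test_function g" shows "test_function (\<lambda>x. f x - g x)"
proof -
  from assms obtain r s where "r > 0" "\<And>y. r \<le> norm y \<Longrightarrow> f y = 0" "\<And>y. s \<le> norm y \<Longrightarrow> g y = 0"
    by (auto simp: test_function_iff)
  with assms show ?thesis
    unfolding test_function_iff smooth_iff by (auto intro!: differentiable_upto_diff exI[of _ "max r s"])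
qed

lemma test_function_partial_deriv: "test_function f \<Longrightarrow> test_function (partial_deriv j f)"
  using test_function_frechet_derivative[of f "axis j 1"] by (simp add: partial_deriv_def)

lemma partial_deriv_mult:
  fixes f g :: "real ^ 'n \<Rightarrow> complex"
  shows "smooth f \<Longrightarrow> smooth g \<Longrightarrow> partial_deriv j (\<lambda>x. f x * g x) x = f x * partial_deriv j g x + partial_deriv j f x * g x"
  by (simp add: partial_deriv_def) (rule frechet_derivative_complex_mult)

lemma partial_deriv_diff:
  assumes "smooth f" "smooth g"
  shows "partial_deriv j (\<lambda>x. f x - g x) x = partial_deriv j f x - partial_deriv j g x"
  using frechet_derivative_at[OF has_derivative_diff[OF smooth_has_derivative[OF assms(1)] smooth_has_derivative[OF assms(2)]], of x]
  by (simp add: partial_deriv_def fun_eq_iff)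

text \<open>Green's identity: the difference of the integrands is the divergence of the compactly
  supported field \<open>?P\<close>.\<close>

lemma integral_laplacian_symmetric:
  assumes f: "smooth f" and g: "test_function g"
  shows "(\<integral>y. f y * laplacian g y \<partial>lebesgue) = (\<integral>y. laplacian f y * g y \<partial>lebesgue)"
proof -
  let ?P = "\<lambda>j y. f y * partial_deriv j g y - partial_deriv j f y * g y"
  have gs: "smooth g" using g by (rule test_function_smooth)
  note s = smooth_partial_deriv[OF f] smooth_partial_deriv[OF gs] f gs smooth_mult
  have P: "test_function (?P j)" for j
    by (intro test_function_diff test_function_mult test_function_partial_deriv g s)
  have "f y * laplacian g y - laplacian f y * g y = (\<Sum>j\<in>UNIV. partial_deriv j (?P j) y)" for y
    by (simp add: laplacian_def sum_distrib_left sum_distrib_right partial_deriv_diff partial_deriv_mult s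
        flip: sum_subtractf)
  then have "(\<integral>y. f y * laplacian g y - laplacian f y * g y \<partial>lebesgue) = (\<Sum>j\<in>UNIV. \<integral>y. partial_deriv j (?P j) y \<partial>lebesgue)"
    using test_function_integrable[OF test_function_partial_deriv[OF P]]
    by (simp add: Bochner_Integration.integral_sum)
  moreover have "integrable lebesgue (\<lambda>y. f y * laplacian g y)" "integrable lebesgue (\<lambda>y. laplacian f y * g y)"
    unfolding laplacian_def sum_distrib_left sum_distrib_right
    by (intro Bochner_Integration.integrable_sum test_function_integrable test_function_mult test_function_partial_deriv g smooth_partial_deriv f)+
  ultimately show ?thesis
    by (simp add: integral_partial_deriv_test_function[OF P])
qed

text \<open>Since \<open>W y $ j\<close> does not depend on \<open>y $ j\<close>, each term
  \<open>W_j \<partial>_j (f g)\<close> is by itself the derivative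
  \<open>\<partial>_j (W_j f g)\<close> and integrates to 0. This is why \<open>div\<close> is a
  condition on every diagonal entry of \<open>W\<close>.\<close>

lemma integral_Omega_L_antisymmetric:
  assumes f: "smooth f" and g: "test_function g"
    and W: "linear W" and div: "\<And>j. W (axis j 1) $ j = 0"
  shows "(\<integral>y. f y * Omega_L W g y \<partial>lebesgue) = - (\<integral>y. Omega_L W f y * g y \<partial>lebesgue)"
proof -
  let ?W = "\<lambda>j y. complex_of_real (W y $ j)"
  have gs: "smooth g" using g by (rule test_function_smooth)
  have bl: "bounded_linear (?W j)" for j
    using W by (intro bounded_linear_compose[OF bounded_linear_of_real] bounded_linear_compose[OF bounded_linear_vec_nth])
      (simp add: linear_conv_bounded_linear)
  have sW: "smooth (?W j)" for j
    unfolding smooth_iff using bounded_linear_differentiable_upto[OF bl] by blast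
  have pW: "partial_deriv j (?W j) y = 0" for j y
  proof -
    have "?W j = frechet_derivative (?W j) (at y)"
      by (rule frechet_derivative_at) (rule bounded_linear_imp_has_derivative[OF bl])
    from fun_cong[OF this, of "axis j 1"] show ?thesis
      unfolding partial_deriv_def iter_deriv.simps by (simp only: div of_real_0)
  qed
  have P: "test_function (\<lambda>y. ?W j y * (f y * g y))" for j
    by (intro test_function_mult f g sW)
  have "f y * Omega_L W g y + Omega_L W f y * g y = - \<i> * (\<Sum>j\<in>UNIV. partial_deriv j (\<lambda>y. ?W j y * (f y * g y)) y)" for y
    by (simp add: Omega_L_def sum_distrib_left sum_distrib_right partial_deriv_mult f gs sW smooth_mult pW
        algebra_simps flip: sum.distrib sum_negf)
  then have "(\<integral>y. f y * Omega_L W g y + Omega_L W f y * g y \<partial>lebesgue)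
      = - \<i> * (\<Sum>j\<in>UNIV. \<integral>y. partial_deriv j (\<lambda>y. ?W j y * (f y * g y)) y \<partial>lebesgue)"
    using test_function_integrable[OF test_function_partial_deriv[OF P]]
    by (simp add: Bochner_Integration.integral_sum)
  moreover have "integrable lebesgue (\<lambda>y. f y * Omega_L W g y)"
  proof -
    have "f y * Omega_L W g y = (\<Sum>j\<in>UNIV. - \<i> * (f y * (?W j y * partial_deriv j g y)))" for y
      by (simp add: Omega_L_def sum_distrib_left mult_ac flip: sum_negf)
    moreover have "integrable lebesgue (\<lambda>y. \<Sum>j\<in>UNIV. - \<i> * (f y * (?W j y * partial_deriv j g y)))"
      by (intro Bochner_Integration.integrable_sum integrable_mult_right test_function_integrable
          test_function_mult test_function_partial_deriv g f sW)
    ultimately show ?thesis by simp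
  qed
  moreover have "integrable lebesgue (\<lambda>y. Omega_L W f y * g y)"
  proof -
    have "Omega_L W f y * g y = (\<Sum>j\<in>UNIV. - \<i> * (?W j y * (partial_deriv j f y * g y)))" for y
      by (simp add: Omega_L_def sum_distrib_left sum_distrib_right mult_ac flip: sum_negf)
    moreover have "integrable lebesgue (\<lambda>y. \<Sum>j\<in>UNIV. - \<i> * (?W j y * (partial_deriv j f y * g y)))"
      by (intro Bochner_Integration.integrable_sum integrable_mult_right test_function_integrable
          test_function_mult smooth_partial_deriv g f sW)
    ultimately show ?thesis by simp
  qed
  ultimately show ?thesis
    by (simp add: integral_partial_deriv_test_function[OF P] eq_neg_iff_add_eq_0)
qed

section \<open>Classical solutions\<close>

definition time_deriv :: "(real \<times> (real ^ 'n) \<Rightarrow> complex) \<Rightarrow> real \<times> (real ^ 'n) \<Rightarrow> complex" where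
  "time_deriv F p = frechet_derivative F (at p) (1, 0)"

lemma differentiable_upto_slice:
  fixes F :: "real \<times> (real ^ 'n) \<Rightarrow> complex"
  assumes "differentiable_upto n F" shows "differentiable_upto n (\<lambda>y. F (t, y))"
proof (rule differentiable_upto_compose[OF assms])
  have "differentiable_upto n (\<lambda>y::real ^ 'n. (t, 0) + (0, y))"
    by (rule differentiable_upto_add[OF differentiable_upto_const bounded_linear_differentiable_upto])
      (rule bounded_linear_intro[where K = 1], auto)
  then show "differentiable_upto n (\<lambda>y::real ^ 'n. (t, y))" by simp
qed

lemma smooth_slice: "smooth F \<Longrightarrow> smooth (\<lambda>y. F (t, y) :: complex)" for F :: "real \<times> (real ^ 'n) \<Rightarrow> complex"
  by (simp add: smooth_iff differentiable_upto_slice)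

lemma test_function_slice:
  fixes F :: "real \<times> (real ^ 'n) \<Rightarrow> complex"
  assumes "test_function F" shows "test_function (\<lambda>y. F (t, y))"
proof -
  obtain r where r: "r > 0" "\<And>p. r \<le> norm p \<Longrightarrow> F p = 0"
    using assms by (auto simp: test_function_iff)
  have "F (t, y) = 0" if "r \<le> norm y" for y
    using that norm_snd_le[of y t] by (intro r(2)) linarith
  then show ?thesis
    unfolding test_function_iff using smooth_slice[OF test_function_smooth[OF assms]] r(1) by blast
qed

lemma has_vector_derivative_time:
  fixes F :: "real \<times> (real ^ 'n) \<Rightarrow> complex"
  assumes "smooth F"
  shows "((\<lambda>s. F (s, y)) has_vector_derivative time_deriv F (t, y)) (at t)"
proof -
  have "((\<lambda>s. (s, y)) has_derivative (\<lambda>h. (h, 0))) (at t)"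
    by (auto intro!: derivative_eq_intros)
  from has_derivative_compose[OF this smooth_has_derivative[OF assms]]
  have d: "((\<lambda>s. F (s, y)) has_derivative (\<lambda>h. frechet_derivative F (at (t, y)) (h, 0))) (at t)" .
  have "frechet_derivative F (at (t, y)) (h, 0) = h *\<^sub>R time_deriv F (t, y)" for h
    using linear_cmul[OF has_derivative_linear[OF smooth_has_derivative[OF assms]], of "(t, y)" h "(1, 0)"]
    by (simp add: time_deriv_def)
  then have eq: "(\<lambda>h. frechet_derivative F (at (t, y)) (h, 0)) = (\<lambda>h. h *\<^sub>R time_deriv F (t, y))"
    by (rule ext)
  show ?thesis unfolding has_vector_derivative_def using d unfolding eq .
qed

lemma smooth_time_deriv: "smooth F \<Longrightarrow> smooth (time_deriv F)"
  using smooth_frechet_derivative[of F "(1, 0)"] by (simp add: time_deriv_def[abs_def] Basis_prod_def)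

lemma test_function_time_deriv: "test_function F \<Longrightarrow> test_function (time_deriv F)"
  using test_function_frechet_derivative[of F "(1, 0)"] by (simp add: time_deriv_def[abs_def] Basis_prod_def)

lemma time_deriv_mult:
  "smooth F \<Longrightarrow> smooth G \<Longrightarrow> time_deriv (\<lambda>p. F p * G p) p = F p * time_deriv G p + time_deriv F p * G p"
  unfolding time_deriv_def by (rule frechet_derivative_complex_mult)

lemma integral_spacetime:
  fixes F :: "real \<times> (real ^ 'n) \<Rightarrow> complex"
  assumes F: "test_function F"
  shows "integrable lebesgue (\<lambda>t. \<integral>y. F (t, y) \<partial>lebesgue)"
    "(\<integral>t. (\<integral>y. F (t, y) \<partial>lebesgue) \<partial>lebesgue) = (\<integral>p. F p \<partial>lborel)"
proof -
  have i: "integrable (lborel \<Otimes>\<^sub>M lborel) F"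
    using test_function_integrable[OF F] by (simp add: lborel_prod)
  have y: "(\<integral>y. F (t, y) \<partial>lebesgue) = (\<integral>y. F (t, y) \<partial>lborel)" for t
    using borel_measurable_continuous_onI[OF test_function_continuous[OF test_function_slice[OF F]]]
    by (intro integral_completion) simp
  have il: "integrable lborel (\<lambda>t. \<integral>y. F (t, y) \<partial>lborel)"
    by (rule lborel_pair.integrable_fst'[OF i])
  then show "integrable lebesgue (\<lambda>t. \<integral>y. F (t, y) \<partial>lebesgue)"
    unfolding y by (subst integrable_completion) auto
  have "(\<integral>t. (\<integral>y. F (t, y) \<partial>lborel) \<partial>lborel) = (\<integral>p. F p \<partial>lborel)"
    using lborel_pair.integral_fst'[OF i] by (simp add: lborel_prod)
  then show "(\<integral>t. (\<integral>y. F (t, y) \<partial>lebesgue) \<partial>lebesgue) = (\<integral>p. F p \<partial>lborel)"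
    unfolding y using il by (subst integral_completion) auto
qed

lemma integral_time_deriv:
  fixes F :: "real \<times> (real ^ 'n) \<Rightarrow> complex"
  assumes F: "test_function F"
  shows "(\<integral>t. (\<integral>y. time_deriv F (t, y) \<partial>lebesgue) \<partial>lebesgue) = 0"
  using integral_derivative_test_function[OF F, of "(1, 0)"]
  by (simp add: integral_spacetime(2)[OF test_function_time_deriv[OF F]] time_deriv_def[symmetric] Basis_prod_def)

lemma test_function_laplacian: "test_function f \<Longrightarrow> test_function (laplacian f)"
proof -
  assume f: "test_function f"
  then obtain r where r: "r > 0" "\<And>y. r \<le> norm y \<Longrightarrow> f y = 0" by (auto simp: test_function_iff)
  have "\<exists>s>0. \<forall>y. s \<le> norm y \<longrightarrow> partial_deriv j (partial_deriv j f) y = 0" for j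
    using test_function_partial_deriv[OF test_function_partial_deriv[OF f]] by (auto simp: test_function_iff)
  then obtain s where s: "\<And>j. s j > 0" "\<And>j y. s j \<le> norm y \<Longrightarrow> partial_deriv j (partial_deriv j f) y = 0"
    by metis
  have "smooth (laplacian f)"
    using test_function_smooth[OF test_function_partial_deriv[OF test_function_partial_deriv[OF f]]]
    unfolding laplacian_def[abs_def] smooth_iff by (auto intro: differentiable_upto_sum)
  moreover have "laplacian f y = 0" if "(\<Sum>j\<in>UNIV. s j) \<le> norm y" for y
    unfolding laplacian_def
  proof (rule sum.neutral, rule ballI, rule s(2))
    fix j
    have "s j \<le> (\<Sum>j\<in>UNIV. s j)" using s(1) by (intro member_le_sum) (auto intro: less_imp_le)
    then show "s j \<le> norm y" using that by simp
  qed
  ultimately show ?thesis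
    unfolding test_function_iff using s(1) by (auto intro!: exI[of _ "\<Sum>j\<in>UNIV. s j"] sum_pos)
qed

text \<open>At fixed time the spatial operators are moved from the test function onto
  \<open>U\<close>, where the equation turns them into \<open>\<i>\<close> times the time
  derivative. The product rule hands the time derivative back to the test function, up to the time
  derivative of the product, whose space-time integral vanishes.\<close>

theorem classical_solution_amplitude_equation:
  fixes U :: "real \<times> (real ^ 'n) \<Rightarrow> complex"
  assumes U: "smooth U"
    and W: "linear W" "\<And>j. W (axis j 1) $ j = 0"
    and pde: "\<And>t y. \<i> * time_deriv U (t, y) = - (1/2) * laplacian (\<lambda>y. U (t, y)) y
      + (1/2) * of_real (y \<bullet> (Q t *v y)) * U (t, y) + Omega_L W (\<lambda>y. U (t, y)) y"
  shows "amplitude_equation W Q (\<lambda>t y. U (t, y))"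
  unfolding amplitude_equation_def
proof (intro allI impI)
  fix \<phi> :: "real \<Rightarrow> real ^ 'n \<Rightarrow> complex"
  define F where "F = (\<lambda>(t, y). \<phi> t y)"
  assume "test_function (\<lambda>(t, y). \<phi> t y)"
  then have F: "test_function F" by (simp add: F_def)
  note Fs = test_function_smooth[OF F]
  have \<phi>: "\<phi> t = (\<lambda>y. F (t, y))" for t by (simp add: F_def)
  have \<phi>t: "vector_derivative (\<lambda>s. \<phi> s y) (at t) = time_deriv F (t, y)" for t y
    using has_vector_derivative_time[OF Fs, of y t] by (simp add: F_def vector_derivative_at)
  let ?L = "\<lambda>t y. - (1/2) * laplacian (\<phi> t) y + (1/2) * of_real (y \<bullet> (Q t *v y)) * \<phi> t y - Omega_L W (\<phi> t) y"
  let ?Z = "\<lambda>p. U p * F p"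
  have Z: "test_function ?Z" by (rule test_function_mult[OF U F])
  have UFt: "test_function (\<lambda>p. U p * (- \<i> * time_deriv F p))"
    using test_function_mult[OF U test_function_mult[OF _ test_function_time_deriv[OF F], of "\<lambda>_. - \<i>"]]
    by (simp add: smooth_iff)
  have slice: "(\<integral>y. U (t, y) * ?L t y \<partial>lebesgue) =
      (\<integral>y. U (t, y) * (- \<i> * time_deriv F (t, y)) \<partial>lebesgue) + \<i> * (\<integral>y. time_deriv ?Z (t, y) \<partial>lebesgue)" for t
  proof -
    let ?u = "\<lambda>y. U (t, y)"
    have f: "test_function (\<phi> t)" unfolding \<phi> by (rule test_function_slice[OF F])
    have u: "smooth ?u" by (rule smooth_slice[OF U])
    have tf: "test_function (\<lambda>y. ?u y * laplacian (\<phi> t) y)"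
      by (rule test_function_mult[OF u test_function_laplacian[OF f]])
    have Wi: "integrable lebesgue (\<lambda>y. ?u y * Omega_L W (\<phi> t) y)" "integrable lebesgue (\<lambda>y. Omega_L W ?u y * \<phi> t y)"
      and Qi: "integrable lebesgue (\<lambda>y. of_real (y \<bullet> (Q t *v y)) * (?u y * \<phi> t y))"
      and li: "integrable lebesgue (\<lambda>y. laplacian ?u y * \<phi> t y)"
    proof -
      have c: "continuous_on UNIV (\<lambda>y. complex_of_real (W y $ j))" for j
        using W(1) by (intro continuous_intros linear_continuous_on) (simp add: linear_conv_bounded_linear)
      obtain r where r: "\<And>y. r \<le> norm y \<Longrightarrow> \<phi> t y = 0" using f by (auto simp: test_function_iff)
      obtain s where s: "\<And>j y. s j \<le> norm y \<Longrightarrow> partial_deriv j (\<phi> t) y = 0"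
        using test_function_partial_deriv[OF f] unfolding test_function_iff by metis
      have "integrable lebesgue (\<lambda>y. of_real (W y $ j) * (?u y * partial_deriv j (\<phi> t) y))" for j
        using c[of j] smooth_continuous[OF u] test_function_continuous[OF test_function_partial_deriv[OF f]]
        by (intro continuous_compact_support_integrable[where r = "s j"] continuous_on_mult) (simp_all add: s)
      then have "integrable lebesgue (\<lambda>y. \<Sum>j\<in>UNIV. - \<i> * (of_real (W y $ j) * (?u y * partial_deriv j (\<phi> t) y)))"
        by (intro Bochner_Integration.integrable_sum integrable_mult_right)
      then show "integrable lebesgue (\<lambda>y. ?u y * Omega_L W (\<phi> t) y)"
        by (simp add: Omega_L_def sum_distrib_left sum_negf mult_ac)
      have "integrable lebesgue (\<lambda>y. of_real (W y $ j) * (partial_deriv j ?u y * \<phi> t y))" for j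
        using c[of j] smooth_continuous[OF smooth_partial_deriv[OF u]] test_function_continuous[OF f]
        by (intro continuous_compact_support_integrable[where r = r] continuous_on_mult) (simp_all add: r)
      then have "integrable lebesgue (\<lambda>y. \<Sum>j\<in>UNIV. - \<i> * (of_real (W y $ j) * (partial_deriv j ?u y * \<phi> t y)))"
        by (intro Bochner_Integration.integrable_sum integrable_mult_right)
      then show "integrable lebesgue (\<lambda>y. Omega_L W ?u y * \<phi> t y)"
        by (simp add: Omega_L_def sum_distrib_left sum_distrib_right sum_negf mult_ac)
      have "continuous_on UNIV (\<lambda>y. complex_of_real (y \<bullet> (Q t *v y)))"
        by (intro continuous_intros linear_continuous_on matrix_vector_mul_bounded_linear)
      then show "integrable lebesgue (\<lambda>y. of_real (y \<bullet> (Q t *v y)) * (?u y * \<phi> t y))"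
        using smooth_continuous[OF u] test_function_continuous[OF f]
        by (intro continuous_compact_support_integrable[where r = r] continuous_on_mult) (simp_all add: r)
      show "integrable lebesgue (\<lambda>y. laplacian ?u y * \<phi> t y)"
        unfolding laplacian_def sum_distrib_right
        by (intro Bochner_Integration.integrable_sum test_function_integrable test_function_mult smooth_partial_deriv u f)
    qed
    have "(\<integral>y. ?u y * ?L t y \<partial>lebesgue) = (\<integral>y. - (1/2) * (?u y * laplacian (\<phi> t) y)
        + (1/2) * (of_real (y \<bullet> (Q t *v y)) * (?u y * \<phi> t y)) - ?u y * Omega_L W (\<phi> t) y \<partial>lebesgue)"
      by (simp add: algebra_simps)
    also have "\<dots> = - (1/2) * (\<integral>y. laplacian ?u y * \<phi> t y \<partial>lebesgue)
        + (1/2) * (\<integral>y. of_real (y \<bullet> (Q t *v y)) * (?u y * \<phi> t y) \<partial>lebesgue)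
        + (\<integral>y. Omega_L W ?u y * \<phi> t y \<partial>lebesgue)"
      using test_function_integrable[OF tf] Wi Qi
      by (simp add: integral_laplacian_symmetric[OF u f] integral_Omega_L_antisymmetric[OF u f W])
    also have "\<dots> = (\<integral>y. - (1/2) * (laplacian ?u y * \<phi> t y)
        + (1/2) * (of_real (y \<bullet> (Q t *v y)) * (?u y * \<phi> t y)) + Omega_L W ?u y * \<phi> t y \<partial>lebesgue)"
      using li Wi Qi by simp
    also have "\<dots> = (\<integral>y. (- (1/2) * laplacian ?u y + (1/2) * of_real (y \<bullet> (Q t *v y)) * ?u y + Omega_L W ?u y) * \<phi> t y \<partial>lebesgue)"
      by (simp add: algebra_simps)
    also have "\<dots> = (\<integral>y. \<i> * time_deriv U (t, y) * F (t, y) \<partial>lebesgue)"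
      unfolding pde[symmetric] \<phi> ..
    also have "\<dots> = (\<integral>y. U (t, y) * (- \<i> * time_deriv F (t, y)) + \<i> * time_deriv ?Z (t, y) \<partial>lebesgue)"
      unfolding time_deriv_mult[OF U Fs] by (simp add: algebra_simps)
    also have "\<dots> = (\<integral>y. U (t, y) * (- \<i> * time_deriv F (t, y)) \<partial>lebesgue) + \<i> * (\<integral>y. time_deriv ?Z (t, y) \<partial>lebesgue)"
      using test_function_integrable(2)[OF test_function_slice[OF UFt, of t]]
        test_function_integrable(2)[OF test_function_slice[OF test_function_time_deriv[OF Z], of t]]
      by (subst Bochner_Integration.integral_add) simp_all
    finally show ?thesis .
  qed
  have "(\<integral>t. (\<integral>y. U (t, y) * ?L t y \<partial>lebesgue) \<partial>lebesgue) =
      (\<integral>t. (\<integral>y. U (t, y) * (- \<i> * time_deriv F (t, y)) \<partial>lebesgue) \<partial>lebesgue)"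
    unfolding slice
    using integral_spacetime(1)[OF UFt] integral_spacetime(1)[OF test_function_time_deriv[OF Z]]
      integral_time_deriv[OF Z]
    by (subst Bochner_Integration.integral_add) simp_all
  then show "(\<integral>t. (\<integral>y. U (t, y) * (- \<i> * vector_derivative (\<lambda>s. \<phi> s y) (at t)) \<partial>lebesgue) \<partial>lebesgue)
      = (\<integral>t. (\<integral>y. U (t, y) * ?L t y \<partial>lebesgue) \<partial>lebesgue)"
    unfolding \<phi>t by simp
qed

section \<open>Conservation of the pairing with a dual solution\<close>

text \<open>Unit mass makes the rescalings of \<open>smooth_step'\<close> a mollifier.\<close>

lemma smooth_step'_integral: "(\<integral>x. smooth_step' x \<partial>lborel) = 1"
proof -
  have "(\<integral>x. smooth_step' x * indicator {0..1} x \<partial>lborel) = smooth_step 1 - smooth_step 0"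
    by (rule integral_FTC_Icc_real)
      (auto intro: smooth_step_DERIV continuous_at_imp_continuous_on smooth_continuous smooth_smooth_step' DERIV_isCont[OF smooth_step_DERIV(2)])
  moreover have "smooth_step' x * indicator {0..1} x = smooth_step' x" for x
    using smooth_step_derivatives_outside(1)[of x] by (cases "x < 0 \<or> x > 1") (auto simp: indicator_def)
  ultimately show ?thesis by (simp add: smooth_step_eq_0 smooth_step_eq_1)
qed

lemma differentiable_upto_smooth_step:
  "differentiable_upto n f \<Longrightarrow> differentiable_upto n (\<lambda>x. smooth_step (f x))"
  by (rule differentiable_upto_compose[where f = smooth_step, OF smooth_smooth_step[unfolded smooth_iff, rule_format]])

text \<open>The lemma of du Bois-Reymond. A suitable \<open>\<theta>\<close> has as derivative the
  difference of two mollifiers, located at \<open>a\<close> and at \<open>b\<close>; letting their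
  width \<open>e\<close> tend to 0 compares \<open>m a\<close> with \<open>m b\<close>.\<close>

lemma constant_of_weak_derivative_zero:
  fixes m :: "real \<Rightarrow> complex"
  assumes m: "continuous_on UNIV m"
    and zero: "\<And>\<theta> \<theta>' T. smooth \<theta> \<Longrightarrow> (\<And>t. (\<theta> has_real_derivative \<theta>' t) (at t)) \<Longrightarrow> T > 0 \<Longrightarrow>
      (\<And>t. T \<le> \<bar>t\<bar> \<Longrightarrow> \<theta> t = 0) \<Longrightarrow> (\<integral>t. of_real (\<theta>' t) * m t \<partial>lborel) = 0"
  shows "m a = m b"
proof -
  define k where "k e a = (\<integral>x. of_real (smooth_step' x) * m (a + e * x) \<partial>lborel)" for e a
  have cS: "continuous_on A smooth_step'" for A by (rule smooth_continuous) (rule smooth_smooth_step')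
  have cm: "continuous_on A (\<lambda>x. m (f x))" if "continuous_on A f" for f A
    using continuous_on_compose2[OF m that] by simp
  have keq: "k e a = k e b" if e: "e > 0" for e
  proof -
    let ?S = "\<lambda>c t. smooth_step' ((t - c) / e) / e"
    have k: "(\<integral>t. of_real (?S c t) * m t \<partial>lborel) = k e c" for c
      using e by (subst lborel_integral_real_affine[of e _ c]) (auto simp: k_def scaleR_conv_of_real)
    have i: "integrable lborel (\<lambda>t::real. of_real (?S c t) * m t)" for c
    proof (rule continuous_compact_support_integrable[where r = "\<bar>c\<bar> + e + 1"])
      show "continuous_on UNIV (\<lambda>t. of_real (?S c t) * m t)"
        using e by (intro continuous_intros m continuous_on_compose2[OF cS]) auto
      fix t :: real assume "\<bar>c\<bar> + e + 1 \<le> norm t"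
      then have "(t - c) / e < 0 \<or> (t - c) / e > 1" using e by (auto simp: field_simps)
      then show "of_real (?S c t) * m t = 0" by (simp add: smooth_step_derivatives_outside)
    qed
    have "(\<integral>t. of_real (?S a t - ?S b t) * m t \<partial>lborel) = 0"
    \<comment> \<open>Each step alone stays at 1 to the right, but their difference vanishes beyond
      both, hence has compact support.\<close>
    proof (rule zero[of "\<lambda>t. smooth_step ((t - a) / e) - smooth_step ((t - b) / e)" _ "\<bar>a\<bar> + \<bar>b\<bar> + e"])
      show "smooth (\<lambda>t. smooth_step ((t - a) / e) - smooth_step ((t - b) / e))"
        unfolding smooth_iff divide_inverse
        by (intro allI differentiable_upto_intros differentiable_upto_smooth_step)
      show "((\<lambda>t. smooth_step ((t - a) / e) - smooth_step ((t - b) / e)) has_real_derivative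
          ?S a t - ?S b t) (at t)" for t
      proof (rule DERIV_diff)
        have "((\<lambda>t. smooth_step ((t - c) / e)) has_real_derivative smooth_step' ((t - c) / e) * (1 / e)) (at t)" for c
        proof (rule DERIV_chain2[OF smooth_step_DERIV(1)])
          show "((\<lambda>t. (t - c) / e) has_real_derivative 1 / e) (at t)"
            by (rule DERIV_cdivide) (auto intro!: derivative_eq_intros)
        qed
        then show "((\<lambda>t. smooth_step ((t - a) / e)) has_real_derivative ?S a t) (at t)"
          "((\<lambda>t. smooth_step ((t - b) / e)) has_real_derivative ?S b t) (at t)" by simp_all
      qed
      show "smooth_step ((t - a) / e) - smooth_step ((t - b) / e) = 0" if "\<bar>a\<bar> + \<bar>b\<bar> + e \<le> \<bar>t\<bar>" for t
      proof (cases "t \<ge> 0")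
        case True
        then have "1 \<le> (t - a) / e" "1 \<le> (t - b) / e" using that e by (auto simp: le_divide_eq)
        then show ?thesis by (simp add: smooth_step_eq_1)
      next
        case False
        then have "(t - a) / e \<le> 0" "(t - b) / e \<le> 0" using that e by (auto simp: divide_le_0_iff)
        then show ?thesis by (simp add: smooth_step_eq_0)
      qed
    qed (use e in auto)
    then have "(\<integral>t. of_real (?S a t) * m t - of_real (?S b t) * m t \<partial>lborel) = 0"
      by (simp only: of_real_diff left_diff_distrib)
    then have "k e a - k e b = 0"
      unfolding Bochner_Integration.integral_diff[OF i i] k .
    then show ?thesis by simp
  qed
  have lim: "(\<lambda>n. k (inverse (real (Suc n))) c) \<longlonglongrightarrow> m c" for c
  proof -
    obtain M where M: "M > 0" "\<And>y. norm y \<le> \<bar>c\<bar> + 1 \<Longrightarrow> norm (m y) \<le> M"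
      using continuous_bounded_on_cball[OF m] by blast
    have "(\<lambda>n. k (inverse (real (Suc n))) c) \<longlonglongrightarrow> (\<integral>x. of_real (smooth_step' x) * m c \<partial>lborel)"
      unfolding k_def
    proof (rule integral_dominated_convergence)
      show "integrable lborel (\<lambda>x. indicator {0..1} x *\<^sub>R (\<bar>smooth_step' x\<bar> * M))"
        by (intro borel_integrable_compact continuous_intros cS) auto
      show "AE x in lborel. (\<lambda>n. of_real (smooth_step' x) * m (c + inverse (real (Suc n)) * x)) \<longlonglongrightarrow> of_real (smooth_step' x) * m c"
      proof (rule AE_I2)
        fix x
        have "isCont m c" using m by (simp add: continuous_on_eq_continuous_at)
        moreover have "(\<lambda>n. c + inverse (real (Suc n)) * x) \<longlonglongrightarrow> c + 0 * x"
          by (intro tendsto_intros LIMSEQ_inverse_real_of_nat)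
        ultimately show "(\<lambda>n. of_real (smooth_step' x) * m (c + inverse (real (Suc n)) * x)) \<longlonglongrightarrow> of_real (smooth_step' x) * m c"
          by (intro tendsto_intros isCont_tendsto_compose[of c m]) auto
      qed
      show "AE x in lborel. norm (of_real (smooth_step' x) * m (c + inverse (real (Suc n)) * x))
          \<le> indicator {0..1} x *\<^sub>R (\<bar>smooth_step' x\<bar> * M)" for n
      proof (rule AE_I2)
        fix x :: real
        show "norm (of_real (smooth_step' x) * m (c + inverse (real (Suc n)) * x))
          \<le> indicator {0..1} x *\<^sub>R (\<bar>smooth_step' x\<bar> * M)"
        proof (cases "x \<in> {0..1}")
          case True
          have "inverse (real (Suc n)) \<le> 1" by (simp add: inverse_le_1_iff)
          then have "0 \<le> inverse (real (Suc n)) * x" "inverse (real (Suc n)) * x \<le> 1 * 1"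
            using True by (simp, intro mult_mono) simp_all
          then have "norm (c + inverse (real (Suc n)) * x) \<le> \<bar>c\<bar> + 1" by (auto simp: abs_if)
          from mult_left_mono[OF M(2)[OF this], of "\<bar>smooth_step' x\<bar>"] True show ?thesis
            by (simp add: norm_mult)
        next
          case False
          then show ?thesis using smooth_step_derivatives_outside(1)[of x] by auto
        qed
      qed
      show "(\<lambda>x. of_real (smooth_step' x) * m c) \<in> borel_measurable lborel"
        "(\<lambda>x. of_real (smooth_step' x) * m (c + inverse (real (Suc n)) * x)) \<in> borel_measurable lborel" for n
        using borel_measurable_continuous_onI[of "\<lambda>x. of_real (smooth_step' x) * m c"]
          borel_measurable_continuous_onI[of "\<lambda>x. of_real (smooth_step' x) * m (c + inverse (real (Suc n)) * x)"]
        by (simp_all add: continuous_on_mult continuous_on_of_real cS cm continuous_on_add)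
    qed
    moreover have "(\<integral>x. of_real (smooth_step' x) * m c \<partial>lborel) = m c"
      by (simp add: smooth_step'_integral)
    ultimately show ?thesis by (simp only:)
  qed
  have "k (inverse (real (Suc n))) a = k (inverse (real (Suc n))) b" for n by (rule keq) simp
  then show ?thesis using lim[of a] lim[of b] LIMSEQ_unique by simp
qed

text \<open>\<open>cutoff1\<close> and \<open>cutoff2\<close> are the first and the pure second
  partial derivatives of \<open>cutoff\<close> in direction \<open>j\<close>, in a form that can be
  estimated uniformly in \<open>r\<close>.\<close>

definition cutoff1 :: "real \<Rightarrow> 'n \<Rightarrow> real ^ 'n \<Rightarrow> real" where
  "cutoff1 r j y = smooth_step' (2 - (y \<bullet> y) / r\<^sup>2) * (- 2 * y $ j / r\<^sup>2)"

definition cutoff2 :: "real \<Rightarrow> 'n \<Rightarrow> real ^ 'n \<Rightarrow> real" where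
  "cutoff2 r j y = smooth_step'' (2 - (y \<bullet> y) / r\<^sup>2) * (4 * (y $ j)\<^sup>2 / r ^ 4)
     - smooth_step' (2 - (y \<bullet> y) / r\<^sup>2) * (2 / r\<^sup>2)"

lemma partial_deriv_eqI: "(f has_derivative f') (at y) \<Longrightarrow> partial_deriv j f y = f' (axis j 1)"
  unfolding partial_deriv_def iter_deriv.simps by (metis frechet_derivative_at)

text \<open>The factor \<open>c\<close> will be the value of the temporal cutoff at a fixed
  time.\<close>

lemma partial_deriv_cutoff:
  fixes j :: "'n::finite"
  shows "partial_deriv j (\<lambda>y. complex_of_real (c * cutoff r y)) = (\<lambda>y. of_real (c * cutoff1 r j y))"
  "partial_deriv j (\<lambda>y. complex_of_real (c * cutoff1 r j y)) = (\<lambda>y. of_real (c * cutoff2 r j y))"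
proof -
  have q: "((\<lambda>y::real ^ 'n. 2 - (y \<bullet> y) / r\<^sup>2) has_derivative (\<lambda>h. - 2 * (y \<bullet> h) / r\<^sup>2)) (at y)" for y
    by (rule has_derivative_eq_rhs[OF has_derivative_diff[OF has_derivative_const
        bounded_linear.has_derivative[OF bounded_linear_divide has_derivative_inner[OF has_derivative_ident has_derivative_ident]]]])
      (auto simp: inner_commute)
  have S: "((\<lambda>y::real ^ 'n. smooth_step (2 - (y \<bullet> y) / r\<^sup>2)) has_derivative
      (\<lambda>h. smooth_step' (2 - (y \<bullet> y) / r\<^sup>2) * (- 2 * (y \<bullet> h) / r\<^sup>2))) (at y)" for y
    using has_derivative_compose[OF q smooth_step_DERIV(1)[unfolded has_field_derivative_def]] .
  have S': "((\<lambda>y::real ^ 'n. smooth_step' (2 - (y \<bullet> y) / r\<^sup>2)) has_derivative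
      (\<lambda>h. smooth_step'' (2 - (y \<bullet> y) / r\<^sup>2) * (- 2 * (y \<bullet> h) / r\<^sup>2))) (at y)" for y
    using has_derivative_compose[OF q smooth_step_DERIV(2)[unfolded has_field_derivative_def]] .
  have ax: "y \<bullet> axis j 1 = y $ j" "axis j (1::real) $ j = 1" for y :: "real ^ 'n"
    by (simp add: inner_axis) (simp add: axis_def)
  show "partial_deriv j (\<lambda>y. complex_of_real (c * cutoff r y)) = (\<lambda>y. of_real (c * cutoff1 r j y))"
  proof
    fix y :: "real ^ 'n"
    have "((\<lambda>y. complex_of_real (c * cutoff r y)) has_derivative
      (\<lambda>h. of_real (c * (smooth_step' (2 - (y \<bullet> y) / r\<^sup>2) * (- 2 * (y \<bullet> h) / r\<^sup>2))))) (at y)"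
      unfolding cutoff_def by (intro has_derivative_of_real has_derivative_mult_right S)
    from partial_deriv_eqI[OF this] show "partial_deriv j (\<lambda>y. complex_of_real (c * cutoff r y)) y = of_real (c * cutoff1 r j y)"
      by (simp add: cutoff1_def ax)
  qed
  have nth: "((\<lambda>y. - 2 * y $ j / r\<^sup>2) has_derivative (\<lambda>h. - 2 * h $ j / r\<^sup>2)) (at y)" for y :: "real ^ 'n"
    using bounded_linear_imp_has_derivative[OF bounded_linear_compose[OF bounded_linear_mult_right[of "- 2 / r\<^sup>2"] bounded_linear_vec_nth[of j]], of "at y"]
    by simp
  show "partial_deriv j (\<lambda>y. complex_of_real (c * cutoff1 r j y)) = (\<lambda>y. of_real (c * cutoff2 r j y))"
  proof
    fix y :: "real ^ 'n"
    have "((\<lambda>y. complex_of_real (c * cutoff1 r j y)) has_derivative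
      (\<lambda>h. of_real (c * (smooth_step' (2 - (y \<bullet> y) / r\<^sup>2) * (- 2 * h $ j / r\<^sup>2) +
        smooth_step'' (2 - (y \<bullet> y) / r\<^sup>2) * (- 2 * (y \<bullet> h) / r\<^sup>2) * (- 2 * y $ j / r\<^sup>2))))) (at y)"
      unfolding cutoff1_def by (intro has_derivative_of_real has_derivative_mult_right has_derivative_mult S' nth)
    then have "partial_deriv j (\<lambda>y. complex_of_real (c * cutoff1 r j y)) y =
      of_real (c * (smooth_step' (2 - (y \<bullet> y) / r\<^sup>2) * (- 2 * axis j 1 $ j / r\<^sup>2) +
        smooth_step'' (2 - (y \<bullet> y) / r\<^sup>2) * (- 2 * (y \<bullet> axis j 1) / r\<^sup>2) * (- 2 * y $ j / r\<^sup>2)))"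
      by (rule partial_deriv_eqI)
    moreover have "(- 2 * y $ j / r\<^sup>2) * (- 2 * y $ j / r\<^sup>2) = 4 * (y $ j)\<^sup>2 / r ^ 4"
    proof -
      have "r\<^sup>2 * r\<^sup>2 = r ^ 4" by (simp flip: power_add)
      then show ?thesis by (simp add: power2_eq_square[of "y $ j"])
    qed
    ultimately show "partial_deriv j (\<lambda>y. complex_of_real (c * cutoff1 r j y)) y = of_real (c * cutoff2 r j y)"
      unfolding ax cutoff2_def by (simp only: mult.assoc) simp
  qed
qed

lemma cutoff_derivatives_eq_0:
  assumes "0 < r" "norm y < r" shows "cutoff1 r j y = 0" "cutoff2 r j y = 0"
proof -
  have "(norm y)\<^sup>2 < r\<^sup>2" using assms by (intro power_strict_mono) auto
  then have "2 - (y \<bullet> y) / r\<^sup>2 > 1" using assms by (simp add: divide_less_eq power2_norm_eq_inner)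
  then show "cutoff1 r j y = 0" "cutoff2 r j y = 0"
    by (simp_all add: cutoff1_def cutoff2_def smooth_step_derivatives_outside)
qed

text \<open>The bound must not depend on \<open>r \<ge> 1\<close>, so that one majorant serves the
  limit of large radius. The growth in \<open>y\<close> is left as a weight, for which the decay
  demanded in \<open>dual_solution\<close> pays. The factor 6 collects the numerical constants 4 and
  2 of the two terms of \<open>cutoff2\<close>.\<close>

lemma cutoff_derivatives_bounded:
  obtains C where "C \<ge> 0" "\<And>r j (y :: real ^ 'n). 1 \<le> r \<Longrightarrow> \<bar>cutoff1 r j y\<bar> \<le> C * (1 + (norm y)\<^sup>2)"
    "\<And>r j (y :: real ^ 'n). 1 \<le> r \<Longrightarrow> \<bar>cutoff2 r j y\<bar> \<le> C * (1 + (norm y)\<^sup>2)"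
proof -
  obtain C where C: "C \<ge> 0" "\<And>x. \<bar>smooth_step' x\<bar> \<le> C" "\<And>x. \<bar>smooth_step'' x\<bar> \<le> C"
    using smooth_step_derivatives_bounded by blast
  have b1: "\<bar>cutoff1 r j y\<bar> \<le> 6 * C * (1 + (norm y)\<^sup>2)" if r: "1 \<le> r" for r j and y :: "real ^ 'n"
  proof -
    have "\<bar>2 * y $ j / r\<^sup>2\<bar> \<le> 2 * \<bar>y $ j\<bar> / 1"
      unfolding abs_divide using r by (intro frac_le) (auto simp: abs_mult one_le_power)
    also have "\<dots> \<le> 2 * norm y" by (simp add: component_le_norm_cart)
    also have "\<dots> \<le> 1 + (norm y)\<^sup>2" using sum_squares_bound[of 1 "norm y"] by simp
    also have "\<dots> \<le> 6 * (1 + (norm y)\<^sup>2)" by simp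
    finally have "\<bar>2 * y $ j / r\<^sup>2\<bar> \<le> 6 * (1 + (norm y)\<^sup>2)" .
    then have "\<bar>smooth_step' (2 - (y \<bullet> y) / r\<^sup>2)\<bar> * \<bar>2 * y $ j / r\<^sup>2\<bar> \<le> C * (6 * (1 + (norm y)\<^sup>2))"
      by (intro mult_mono C) auto
    then show ?thesis by (simp add: cutoff1_def abs_mult algebra_simps)
  qed
  have b2: "\<bar>cutoff2 r j y\<bar> \<le> 6 * C * (1 + (norm y)\<^sup>2)" if r: "1 \<le> r" for r j and y :: "real ^ 'n"
  proof -
    have "4 * (y $ j)\<^sup>2 / r ^ 4 \<le> 4 * (norm y)\<^sup>2 / 1"
      using r component_le_norm_cart[of y j] by (intro frac_le) (auto simp: one_le_power abs_le_square_iff[symmetric])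
    then have "\<bar>smooth_step'' (2 - (y \<bullet> y) / r\<^sup>2)\<bar> * (4 * (y $ j)\<^sup>2 / r ^ 4) \<le> C * (4 * (norm y)\<^sup>2)"
      by (intro mult_mono C) auto
    moreover have "\<bar>smooth_step' (2 - (y \<bullet> y) / r\<^sup>2)\<bar> * (2 / r\<^sup>2) \<le> C * 2"
      using r by (intro mult_mono C) (auto simp: divide_le_eq one_le_power)
    moreover have "\<bar>cutoff2 r j y\<bar> \<le> \<bar>smooth_step'' (2 - (y \<bullet> y) / r\<^sup>2)\<bar> * (4 * (y $ j)\<^sup>2 / r ^ 4)
        + \<bar>smooth_step' (2 - (y \<bullet> y) / r\<^sup>2)\<bar> * (2 / r\<^sup>2)"
      unfolding cutoff2_def by (rule order_trans[OF abs_triangle_ineq4]) (simp add: abs_mult)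
    ultimately have "\<bar>cutoff2 r j y\<bar> \<le> C * (4 * (norm y)\<^sup>2) + C * 2" by linarith
    also have "\<dots> \<le> 6 * C * (1 + (norm y)\<^sup>2)" using C(1) by (simp add: algebra_simps)
    finally show ?thesis .
  qed
  show ?thesis by (rule that[OF _ b1 b2]) (use C in auto)
qed

lemma laplacian_mult:
  fixes f g :: "real ^ 'n \<Rightarrow> complex"
  assumes f: "smooth f" and g: "smooth g"
  shows "laplacian (\<lambda>y. f y * g y) y = f y * laplacian g y
    + 2 * (\<Sum>j\<in>UNIV. partial_deriv j f y * partial_deriv j g y) + laplacian f y * g y"
proof -
  have "partial_deriv j (partial_deriv j (\<lambda>y. f y * g y)) y =
      f y * partial_deriv j (partial_deriv j g) y + 2 * (partial_deriv j f y * partial_deriv j g y)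
      + partial_deriv j (partial_deriv j f) y * g y" for j
  proof -
    have s: "smooth (\<lambda>y. f y * partial_deriv j g y)" "smooth (\<lambda>y. partial_deriv j f y * g y)"
      by (intro smooth_mult smooth_partial_deriv f g)+
    have "partial_deriv j (\<lambda>y. f y * g y) = (\<lambda>y. f y * partial_deriv j g y + partial_deriv j f y * g y)"
      by (rule ext) (rule partial_deriv_mult[OF f g])
    then have "partial_deriv j (partial_deriv j (\<lambda>y. f y * g y)) y
        = partial_deriv j (\<lambda>y. f y * partial_deriv j g y) y + partial_deriv j (\<lambda>y. partial_deriv j f y * g y) y"
      using partial_deriv_eqI[OF has_derivative_add[OF smooth_has_derivative[OF s(1)] smooth_has_derivative[OF s(2)]], of j y]
      by (simp add: partial_deriv_def)
    also have "\<dots> = f y * partial_deriv j (partial_deriv j g) y + 2 * (partial_deriv j f y * partial_deriv j g y)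
      + partial_deriv j (partial_deriv j f) y * g y"
      by (simp add: partial_deriv_mult smooth_partial_deriv f g)
    finally show ?thesis .
  qed
  then show ?thesis
    by (simp add: laplacian_def sum.distrib sum_distrib_left sum_distrib_right)
qed

lemma Omega_L_mult:
  assumes "smooth f" "smooth g"
  shows "Omega_L W (\<lambda>y. f y * g y) y = f y * Omega_L W g y + Omega_L W f y * g y"
  by (simp add: Omega_L_def partial_deriv_mult[OF assms] sum_distrib_left sum_distrib_right distrib_left sum.distrib mult_ac)

lemma partial_deriv_slice:
  fixes F :: "real \<times> (real ^ 'n) \<Rightarrow> complex"
  assumes "smooth F"
  shows "partial_deriv j (\<lambda>y. F (t, y)) y = frechet_derivative F (at (t, y)) (0, axis j 1)"
proof -
  have "((\<lambda>y. (t, y)) has_derivative (\<lambda>h. (0, h))) (at y)"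
    by (auto intro!: derivative_eq_intros)
  from partial_deriv_eqI[OF has_derivative_compose[OF this smooth_has_derivative[OF assms]]]
  show ?thesis .
qed

lemma isCont_slices:
  fixes F :: "real \<times> (real ^ 'n) \<Rightarrow> complex"
  assumes "smooth F"
  shows "isCont (\<lambda>t. F (t, y)) t" "isCont (\<lambda>t. partial_deriv j (\<lambda>y. F (t, y)) y) t"
proof -
  have *: "isCont (\<lambda>t. G (t, y)) t" if "smooth G" for G :: "real \<times> (real ^ 'n) \<Rightarrow> complex"
  proof -
    have "continuous_on UNIV (\<lambda>t. G (t, y))"
      by (rule continuous_on_compose2[OF smooth_continuous[OF that, of UNIV]]) (auto intro!: continuous_intros)
    then show ?thesis by (simp add: continuous_on_eq_continuous_at)
  qed
  show "isCont (\<lambda>t. F (t, y)) t" by (rule *[OF assms])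
  have "smooth (\<lambda>p. frechet_derivative F (at p) (0, axis j 1))"
    by (rule smooth_frechet_derivative[OF assms]) (simp add: Basis_prod_def)
  from *[OF this] show "isCont (\<lambda>t. partial_deriv j (\<lambda>y. F (t, y)) y) t"
    unfolding partial_deriv_slice[OF assms] .
qed

lemma locally_dominatedI:
  assumes "\<And>t. g t \<in> borel_measurable lebesgue" "G \<in> borel_measurable lebesgue"
    "integrable lebesgue (\<lambda>y. (G y)\<^sup>2)" "\<And>t y. cmod (g t y) \<le> G y"
  shows "locally_dominated g"
  unfolding locally_dominated_def using assms by (meson zero_less_one)

lemma locally_dominated_test_function:
  fixes F :: "real \<times> (real ^ 'n) \<Rightarrow> complex"
  assumes F: "test_function F" shows "locally_dominated (\<lambda>t y. F (t, y))"
proof -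
  obtain r where r: "\<And>p. r \<le> norm p \<Longrightarrow> F p = 0" using F by (auto simp: test_function_iff)
  obtain K where K: "K > 0" "\<And>p. norm p \<le> r \<Longrightarrow> cmod (F p) \<le> K"
    using continuous_bounded_on_cball[OF test_function_continuous[OF F]] by blast
  let ?G = "\<lambda>y::real ^ 'n. K * indicator (cball 0 r) y"
  show ?thesis
  proof (rule locally_dominatedI)
    show "(\<lambda>y. F (t, y)) \<in> borel_measurable lebesgue" for t
      by (rule borel_measurable_lebesgue_continuous) (rule test_function_continuous[OF test_function_slice[OF F]])
    have "integrable lebesgue (\<lambda>y::real ^ 'n. K\<^sup>2 * indicator (cball 0 r) y)"
      by (intro integrable_mult_right integrable_real_indicator) (use lmeasurable_cball[of 0 r] in \<open>auto simp: fmeasurable_def\<close>)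
    moreover have "(\<lambda>y. (?G y)\<^sup>2) = (\<lambda>y. K\<^sup>2 * indicator (cball 0 r) y)"
      by (auto simp: fun_eq_iff indicator_def)
    ultimately show "integrable lebesgue (\<lambda>y. (?G y)\<^sup>2)" by simp
    show "?G \<in> borel_measurable lebesgue"
      by (intro borel_measurable_times borel_measurable_const borel_measurable_indicator fmeasurableD lmeasurable_cball)
    show "cmod (F (t, y)) \<le> ?G y" for t y
    proof (cases "norm (t, y) \<le> r")
      case True
      then have "norm y \<le> r" using norm_snd_le[of y t] by linarith
      then show ?thesis using K(2)[OF True] by simp
    next
      case False
      then have "F (t, y) = 0" by (intro r) simp
      then show ?thesis using K(1) by (auto simp: indicator_def)
    qed
  qed
qed

text \<open>A solution of the transposed equation with the decay which makes the cut-off error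
  disappear in the limit.\<close>

definition dual_solution :: "(real ^ 'n \<Rightarrow> real ^ 'n) \<Rightarrow> (real \<Rightarrow> real ^ 'n ^ 'n)
    \<Rightarrow> (real \<times> (real ^ 'n) \<Rightarrow> complex) \<Rightarrow> bool" where
  "dual_solution W Q \<Phi> \<longleftrightarrow> smooth \<Phi> \<and>
     (\<forall>t y. - \<i> * time_deriv \<Phi> (t, y) = - (1/2) * laplacian (\<lambda>y. \<Phi> (t, y)) y
        + (1/2) * of_real (y \<bullet> (Q t *v y)) * \<Phi> (t, y) - Omega_L W (\<lambda>y. \<Phi> (t, y)) y) \<and>
     (\<forall>T. \<exists>G. G \<in> borel_measurable lebesgue \<and> integrable lebesgue (\<lambda>y. (G y)\<^sup>2) \<and>
        (\<forall>t y. \<bar>t\<bar> \<le> T \<longrightarrow> (1 + (norm y)\<^sup>2) * cmod (\<Phi> (t, y)) \<le> G y \<and>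
          (\<forall>j. (1 + (norm y)\<^sup>2) * cmod (partial_deriv j (\<lambda>y. \<Phi> (t, y)) y) \<le> G y)))"

lemma dual_solution_locally_dominated:
  assumes "dual_solution W Q \<Phi>" shows "locally_dominated (\<lambda>t y. \<Phi> (t, y))"
  unfolding locally_dominated_def
proof (intro conjI allI)
  fix t :: real
  have \<Phi>: "smooth \<Phi>" using assms by (simp add: dual_solution_def)
  show "(\<lambda>y. \<Phi> (t, y)) \<in> borel_measurable lebesgue"
    by (rule borel_measurable_lebesgue_continuous) (rule smooth_continuous[OF smooth_slice[OF \<Phi>]])
  obtain G where G: "G \<in> borel_measurable lebesgue" "integrable lebesgue (\<lambda>y. (G y)\<^sup>2)"
    and dom: "\<And>s y. \<bar>s\<bar> \<le> \<bar>t\<bar> + 1 \<Longrightarrow> (1 + (norm y)\<^sup>2) * cmod (\<Phi> (s, y)) \<le> G y"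
    using assms unfolding dual_solution_def by meson
  have "cmod (\<Phi> (s, y)) \<le> G y" if "s \<in> ball t 1" for s y
  proof -
    have "\<bar>s\<bar> \<le> \<bar>t\<bar> + 1" using that by (auto simp: dist_real_def)
    from dom[OF this, of y] show ?thesis
      by (rule order_trans[rotated]) (simp add: distrib_right)
  qed
  with G show "\<exists>e>0. \<exists>G. integrable lebesgue (\<lambda>y. (G y)\<^sup>2) \<and> G \<in> borel_measurable lebesgue \<and>
      (\<forall>s\<in>ball t e. \<forall>y. cmod (\<Phi> (s, y)) \<le> G y)"
    by (intro exI[of _ 1] conjI exI[of _ G]) auto
qed

text \<open>By the reverse triangle inequality. It makes the time-dependent majorant of the
  truncated pairings continuous, hence integrable over bounded intervals.\<close>

lemma L2_continuous_cmod:
  assumes v: "L2_continuous v" shows "L2_continuous (\<lambda>t y. of_real (cmod (v t y)))"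
proof -
  have L: "L2 (v t)" for t using v by (simp add: L2_continuous_def)
  have L': "L2 (\<lambda>y. complex_of_real (cmod (v t y)))" for t
    using L[of t] by (auto simp: L2_def)
  have le: "L2_norm (\<lambda>y. complex_of_real (cmod (v s y)) - of_real (cmod (v t y))) \<le> L2_norm (\<lambda>y. v s y - v t y)" for s t
    unfolding L2_norm_def
  proof (intro real_sqrt_le_mono integral_mono)
    show "integrable lebesgue (\<lambda>y. (cmod (complex_of_real (cmod (v s y)) - of_real (cmod (v t y))))\<^sup>2)"
      using L2_diff[OF L' L'] by (simp add: L2_def)
    show "integrable lebesgue (\<lambda>y. (cmod (v s y - v t y))\<^sup>2)"
      using L2_diff[OF L L] by (simp add: L2_def)
    show "(cmod (complex_of_real (cmod (v s y)) - of_real (cmod (v t y))))\<^sup>2 \<le> (cmod (v s y - v t y))\<^sup>2" for y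
    proof (rule power_mono)
      have "cmod (complex_of_real (cmod (v s y)) - of_real (cmod (v t y))) = \<bar>cmod (v s y) - cmod (v t y)\<bar>"
        by (metis norm_of_real of_real_diff)
      also have "\<dots> \<le> cmod (v s y - v t y)" by (rule norm_triangle_ineq3)
      finally show "cmod (complex_of_real (cmod (v s y)) - of_real (cmod (v t y))) \<le> cmod (v s y - v t y)" .
    qed simp
  qed
  have "((\<lambda>s. L2_norm (\<lambda>y. complex_of_real (cmod (v s y)) - of_real (cmod (v t y)))) \<longlongrightarrow> 0) (at t)" for t
  proof (rule tendsto_sandwich[OF _ _ tendsto_const])
    show "((\<lambda>s. L2_norm (\<lambda>y. v s y - v t y)) \<longlongrightarrow> 0) (at t)"
      using v by (simp add: L2_continuous_def)
  qed (intro always_eventually allI L2_norm_nonneg le)+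
  with L' show ?thesis by (simp add: L2_continuous_def)
qed

text \<open>The equation is tested with \<open>\<theta>(t) \<chi>(y/r) \<Phi>(t,y)\<close>; since \<open>\<Phi>\<close> solves the transposed
  equation only terms with a derivative of \<open>\<theta>\<close> or \<open>\<chi>\<close> survive, and the latter vanish as \<open>r \<rightarrow> \<infinity>\<close>.
  The rotation does not contribute, as \<open>\<chi>\<close> is radial.\<close>

lemma pairing_weak_derivative_zero:
  fixes \<Phi> :: "real \<times> (real ^ 'n) \<Rightarrow> complex"
  assumes v: "L2_continuous v" and eq: "amplitude_equation W Q v"
    and W: "\<And>y. y \<bullet> W y = 0" and dual: "dual_solution W Q \<Phi>"
    and \<theta>: "smooth \<theta>" and d\<theta>: "\<And>t. (\<theta> has_real_derivative \<theta>' t) (at t)"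
    and T: "T > 0" "\<And>t. T \<le> \<bar>t\<bar> \<Longrightarrow> \<theta> t = 0"
  shows "(\<integral>t. of_real (\<theta>' t) * (\<integral>y. v t y * \<Phi> (t, y) \<partial>lebesgue) \<partial>lborel) = 0"
proof -
  have \<Phi>: "smooth \<Phi>" using dual by (simp add: dual_solution_def)
  have pde: "- \<i> * time_deriv \<Phi> (t, y) + (1/2) * laplacian (\<lambda>y. \<Phi> (t, y)) y
      - (1/2) * of_real (y \<bullet> (Q t *v y)) * \<Phi> (t, y) + Omega_L W (\<lambda>y. \<Phi> (t, y)) y = 0" for t y
    using dual unfolding dual_solution_def by simp
  obtain G where G: "G \<in> borel_measurable lebesgue" "integrable lebesgue (\<lambda>y. (G y)\<^sup>2)"
    and dom0: "\<And>t y. \<bar>t\<bar> \<le> T \<Longrightarrow> (1 + (norm y)\<^sup>2) * cmod (\<Phi> (t, y)) \<le> G y"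
    and dom1: "\<And>t y j. \<bar>t\<bar> \<le> T \<Longrightarrow> (1 + (norm y)\<^sup>2) * cmod (partial_deriv j (\<lambda>y. \<Phi> (t, y)) y) \<le> G y"
    using dual unfolding dual_solution_def by meson
  have G0: "0 \<le> G y" for y
    using dom0[of 0 y] T(1) by (auto intro: order_trans[rotated])
  have GL: "L2 (\<lambda>y. of_real (c * G y))" for c
    using G by (auto simp: L2_def norm_mult power_mult_distrib)
  have vL: "L2 (v t)" for t using v by (simp add: L2_continuous_def)
  have \<theta>'_eq: "\<theta>' t = frechet_derivative \<theta> (at t) 1" for t
    using DERIV_unique[OF d\<theta> smooth_has_real_derivative[OF \<theta>]] .
  have s\<theta>': "smooth \<theta>'"
    unfolding \<theta>'_eq[abs_def] by (rule smooth_frechet_derivative[OF \<theta>]) simp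
  have T': "\<theta>' t = 0" if "T < \<bar>t\<bar>" for t
    by (rule DERIV_eventually_const[of "{..<-T} \<union> {T<..}" _ \<theta> 0, OF _ _ _ d\<theta>]) (use that T in auto)
  obtain B0 where B0: "B0 > 0" "\<And>t. norm t \<le> T \<Longrightarrow> norm (\<theta> t) \<le> B0"
    using continuous_bounded_on_cball[OF smooth_continuous[OF \<theta>]] by blast
  obtain B1 where B1: "B1 > 0" "\<And>t. norm t \<le> T \<Longrightarrow> norm (\<theta>' t) \<le> B1"
    using continuous_bounded_on_cball[OF smooth_continuous[OF s\<theta>']] by blast
  obtain C where C: "C \<ge> 0" "\<And>r j (y :: real ^ 'n). 1 \<le> r \<Longrightarrow> \<bar>cutoff1 r j y\<bar> \<le> C * (1 + (norm y)\<^sup>2)"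
    "\<And>r j (y :: real ^ 'n). 1 \<le> r \<Longrightarrow> \<bar>cutoff2 r j y\<bar> \<le> C * (1 + (norm y)\<^sup>2)"
    using cutoff_derivatives_bounded by blast
  define r where "r n = real (Suc n)" for n
  have r: "0 < r n" "1 \<le> r n" for n by (simp_all add: r_def)
  \<comment> \<open>What remains of the transposed operator on \<open>\<theta> \<chi> \<Phi>\<close>
    after the equation for \<open>\<Phi>\<close> has been used: the term with
    \<open>\<theta>'\<close>, and the two terms in which the Laplacian hits the cutoff.\<close>
  define H where "H n t y = - \<i> * of_real (\<theta>' t * cutoff (r n) y) * \<Phi> (t, y) + of_real (\<theta> t) *
      (1/2 * \<Phi> (t, y) * (\<Sum>j\<in>UNIV. of_real (cutoff2 (r n) j y))
       + (\<Sum>j\<in>UNIV. of_real (cutoff1 (r n) j y) * partial_deriv j (\<lambda>y. \<Phi> (t, y)) y))" for n t y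
  \<comment> \<open>\<open>B1\<close> bounds the term with \<open>\<theta>'\<close>; each of the two
    cutoff terms is a sum over the coordinates and contributes at most
    \<open>B0 * C * CARD('n)\<close>.\<close>
  define K where "K = B1 + B0 * (2 * (C * CARD('n)))"
  have K0: "0 \<le> K" using B0(1) B1(1) C(1) by (simp add: K_def)
  have H_zero: "H n t y = 0" if "T < \<bar>t\<bar>" for n t y
    using T(2)[of t] T'[OF that] that by (simp add: H_def)
  have H_bound: "cmod (H n t y) \<le> K * G y" for n t y
  proof (cases "\<bar>t\<bar> \<le> T")
    case True
    let ?w = "1 + (norm y)\<^sup>2"
    have p: "cmod (\<Phi> (t, y)) \<le> G y"
      using dom0[OF True, of y] by (rule order_trans[rotated]) (simp add: distrib_right)
    have "cmod (- \<i> * of_real (\<theta>' t * cutoff (r n) y) * \<Phi> (t, y)) = \<bar>\<theta>' t\<bar> * cutoff (r n) y * cmod (\<Phi> (t, y))"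
      using cutoff_bounds(1)[of "r n" y] by (simp add: norm_mult)
    also have "\<dots> \<le> B1 * 1 * G y"
      using B1(2)[of t] True p cutoff_bounds[of "r n" y] B1(1) by (intro mult_mono) auto
    finally have 1: "cmod (- \<i> * of_real (\<theta>' t * cutoff (r n) y) * \<Phi> (t, y)) \<le> B1 * G y" by simp
    have "cmod (1/2 * \<Phi> (t, y) * (\<Sum>j\<in>UNIV. of_real (cutoff2 (r n) j y)))
        \<le> cmod (\<Phi> (t, y)) * cmod (\<Sum>j\<in>UNIV. complex_of_real (cutoff2 (r n) j y))"
      by (simp add: norm_mult norm_divide)
    also have "\<dots> \<le> cmod (\<Phi> (t, y)) * (\<Sum>j\<in>(UNIV::'n set). C * ?w)"
      using C(3)[OF r(2)] by (intro mult_left_mono sum_norm_le) auto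
    also have "\<dots> = C * CARD('n) * (?w * cmod (\<Phi> (t, y)))" by simp
    also have "\<dots> \<le> C * CARD('n) * G y"
      using C(1) by (intro mult_left_mono dom0[OF True]) auto
    finally have 2: "cmod (1/2 * \<Phi> (t, y) * (\<Sum>j\<in>UNIV. of_real (cutoff2 (r n) j y))) \<le> C * CARD('n) * G y" .
    have "cmod (\<Sum>j\<in>UNIV. of_real (cutoff1 (r n) j y) * partial_deriv j (\<lambda>y. \<Phi> (t, y)) y) \<le> (\<Sum>j\<in>(UNIV::'n set). C * G y)"
    proof (rule sum_norm_le)
      fix j
      have "cmod (of_real (cutoff1 (r n) j y) * partial_deriv j (\<lambda>y. \<Phi> (t, y)) y)
          \<le> C * ?w * cmod (partial_deriv j (\<lambda>y. \<Phi> (t, y)) y)"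
        unfolding norm_mult norm_of_real by (intro mult_right_mono C(2) r) simp
      also have "\<dots> = C * (?w * cmod (partial_deriv j (\<lambda>y. \<Phi> (t, y)) y))" by simp
      also have "\<dots> \<le> C * G y" using C(1) by (intro mult_left_mono dom1[OF True])
      finally show "cmod (of_real (cutoff1 (r n) j y) * partial_deriv j (\<lambda>y. \<Phi> (t, y)) y) \<le> C * G y" .
    qed
    then have 3: "cmod (\<Sum>j\<in>UNIV. of_real (cutoff1 (r n) j y) * partial_deriv j (\<lambda>y. \<Phi> (t, y)) y) \<le> C * CARD('n) * G y"
      by (simp add: mult_ac)
    let ?X = "1/2 * \<Phi> (t, y) * (\<Sum>j\<in>UNIV. of_real (cutoff2 (r n) j y))
       + (\<Sum>j\<in>UNIV. of_real (cutoff1 (r n) j y) * partial_deriv j (\<lambda>y. \<Phi> (t, y)) y)"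
    have "cmod ?X \<le> 2 * (C * CARD('n)) * G y"
      unfolding mult_2 distrib_right by (rule norm_triangle_le[OF add_mono[OF 2 3]])
    then have 4: "cmod (of_real (\<theta> t) * ?X) \<le> B0 * (2 * (C * CARD('n)) * G y)"
      unfolding norm_mult using B0(2)[of t] True B0(1) by (intro mult_mono) auto
    have "cmod (H n t y) \<le> B1 * G y + B0 * (2 * (C * CARD('n)) * G y)"
      unfolding H_def by (rule norm_triangle_le[OF add_mono[OF 1 4]])
    then show ?thesis by (simp only: K_def distrib_right mult.assoc)
  qed (use H_zero[of t] K0 G0 in auto)
  have ccut: "continuous_on UNIV (cutoff (r n) :: real ^ 'n \<Rightarrow> real)"
    "continuous_on UNIV (cutoff1 (r n) j :: real ^ 'n \<Rightarrow> real)"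
    "continuous_on UNIV (cutoff2 (r n) j :: real ^ 'n \<Rightarrow> real)" for n j
    unfolding cutoff_def[abs_def] cutoff1_def[abs_def] cutoff2_def[abs_def] using r[of n]
    by (intro continuous_intros continuous_on_compose2[OF smooth_continuous[OF smooth_smooth_step, of UNIV]]
        continuous_on_compose2[OF smooth_continuous[OF smooth_smooth_step'(1), of UNIV]]
        continuous_on_compose2[OF smooth_continuous[OF smooth_smooth_step'(2), of UNIV]]; simp)+
  have cH: "continuous_on UNIV (H n t)" for n t
    unfolding H_def
    by (intro continuous_intros ccut smooth_continuous smooth_slice smooth_partial_deriv \<Phi>)
  have HG: "locally_dominated (H n)" for n
  proof (rule locally_dominatedI[where G = "\<lambda>y. K * G y"])
    show "H n t \<in> borel_measurable lebesgue" for t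
      by (rule borel_measurable_lebesgue_continuous[OF cH])
  qed (use G H_bound in \<open>auto simp: power_mult_distrib\<close>)
  have cHt: "isCont (\<lambda>t. H n t y) t" for n t y
    unfolding H_def
    using smooth_continuous[OF \<theta>, of UNIV] smooth_continuous[OF s\<theta>', of UNIV]
    by (intro continuous_intros isCont_slices[OF \<Phi>]) (auto simp: continuous_on_eq_continuous_at)
  define c where "c n t = (\<integral>y. v t y * H n t y \<partial>lebesgue)" for n t
  have cont_c: "continuous_on UNIV (c n)" for n
    unfolding c_def continuous_on_eq_continuous_at[OF open_UNIV]
    by (intro ballI isCont_pairing v HG cHt)
  have c_zero: "c n t = 0" if "T < \<bar>t\<bar>" for n t by (simp add: c_def H_zero[OF that])
  have int_c: "integrable lborel (c n)" "integrable lebesgue (c n)" for n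
    by (rule continuous_compact_support_integrable[OF cont_c, of "T + 1"]; simp add: c_zero)+
  have c_int_zero: "(\<integral>t. c n t \<partial>lebesgue) = 0" for n
  proof -
    let ?\<rho> = "\<lambda>p. complex_of_real (\<theta> (fst p) * cutoff (r n) (snd p))"
    define F where "F p = ?\<rho> p * \<Phi> p" for p
    have s\<rho>: "smooth ?\<rho>"
      unfolding smooth_iff
      by (intro allI differentiable_upto_intros differentiable_upto_cutoff
          differentiable_upto_compose[where f = \<theta>, OF \<theta>[unfolded smooth_iff, rule_format]])
    have sF: "smooth F" unfolding F_def by (rule smooth_mult[OF s\<rho> \<Phi>])
    have tF: "test_function F"
      unfolding test_function_iff
    proof (intro conjI sF exI[of _ "T + 2 * r n"] allI impI)
      show "0 < T + 2 * r n" using T r[of n] by simp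
      fix p :: "real \<times> (real ^ 'n)" assume "T + 2 * r n \<le> norm p"
      moreover have "norm p \<le> \<bar>fst p\<bar> + norm (snd p)"
        using norm_Pair_le[of "fst p" "snd p"] by simp
      ultimately consider "T \<le> \<bar>fst p\<bar>" | "2 * r n \<le> norm (snd p)" by linarith
      then show "F p = 0" by cases (simp_all add: F_def T(2) cutoff_eq_0 r)
    qed
    let ?L = "\<lambda>t y. - (1/2) * laplacian (\<lambda>y. F (t, y)) y + (1/2) * of_real (y \<bullet> (Q t *v y)) * F (t, y)
        - Omega_L W (\<lambda>y. F (t, y)) y"
    have dF: "time_deriv F (t, y) = ?\<rho> (t, y) * time_deriv \<Phi> (t, y) + of_real (\<theta>' t * cutoff (r n) y) * \<Phi> (t, y)" for t y
    proof -
      have "((\<lambda>s. \<theta> s * cutoff (r n) y) has_vector_derivative \<theta>' t * cutoff (r n) y) (at t)"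
        using DERIV_cmult_right[OF d\<theta>] by (simp add: has_real_derivative_iff_has_vector_derivative[symmetric])
      then have "((\<lambda>s. complex_of_real (\<theta> s * cutoff (r n) y)) has_vector_derivative of_real (\<theta>' t * cutoff (r n) y)) (at t)"
        by (rule bounded_linear.has_vector_derivative[OF bounded_linear_of_real])
      from has_vector_derivative_mult[OF this has_vector_derivative_time[OF \<Phi>, of y t]]
      have "((\<lambda>s. F (s, y)) has_vector_derivative
          ?\<rho> (t, y) * time_deriv \<Phi> (t, y) + of_real (\<theta>' t * cutoff (r n) y) * \<Phi> (t, y)) (at t)"
        by (simp add: F_def)
      with has_vector_derivative_time[OF sF, of y t] show ?thesis
        by (rule vector_derivative_unique_at)
    qed
    have HL: "- \<i> * time_deriv F (t, y) - ?L t y = H n t y" for t y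
    proof -
      let ?g = "\<lambda>y :: real ^ 'n. complex_of_real (\<theta> t * cutoff (r n) y)" and ?f = "\<lambda>y. \<Phi> (t, y)"
      have sg: "smooth ?g" using smooth_slice[OF s\<rho>, of t] by simp
      have sf: "smooth ?f" by (rule smooth_slice[OF \<Phi>])
      have slice: "(\<lambda>y. F (t, y)) = (\<lambda>y. ?g y * ?f y)" by (simp add: F_def)
      have lg: "laplacian ?g y = of_real (\<theta> t) * (\<Sum>j\<in>UNIV. of_real (cutoff2 (r n) j y))"
        unfolding laplacian_def partial_deriv_cutoff by (simp add: sum_distrib_left)
      have "Omega_L W ?g y = - \<i> * (\<Sum>j\<in>UNIV. of_real (W y $ j) * of_real (\<theta> t * cutoff1 (r n) j y))"
        unfolding Omega_L_def partial_deriv_cutoff ..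
      also have "\<dots> = - \<i> * of_real (\<Sum>j\<in>UNIV. W y $ j * (\<theta> t * cutoff1 (r n) j y))"
        by simp
      also have "(\<Sum>j\<in>UNIV. W y $ j * (\<theta> t * cutoff1 (r n) j y))
          = \<theta> t * smooth_step' (2 - (y \<bullet> y) / (r n)\<^sup>2) * (- 2 / (r n)\<^sup>2) * (\<Sum>j\<in>UNIV. y $ j * W y $ j)"
        unfolding cutoff1_def sum_distrib_left by (rule sum.cong) simp_all
      also have "(\<Sum>j\<in>UNIV. y $ j * W y $ j) = 0"
        using W[of y] by (simp add: inner_vec_def)
      finally have og: "Omega_L W ?g y = 0" by simp
      have lF: "laplacian (\<lambda>y. F (t, y)) y = ?g y * laplacian ?f y
          + 2 * (of_real (\<theta> t) * (\<Sum>j\<in>UNIV. of_real (cutoff1 (r n) j y) * partial_deriv j ?f y))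
          + of_real (\<theta> t) * (\<Sum>j\<in>UNIV. of_real (cutoff2 (r n) j y)) * ?f y"
        unfolding slice laplacian_mult[OF sg sf] lg unfolding partial_deriv_cutoff
        by (simp add: sum_distrib_left mult_ac)
      have oF: "Omega_L W (\<lambda>y. F (t, y)) y = ?g y * Omega_L W ?f y"
        unfolding slice Omega_L_mult[OF sg sf] og by simp
      have "- \<i> * time_deriv F (t, y) - ?L t y = ?g y * (- \<i> * time_deriv \<Phi> (t, y) + (1/2) * laplacian ?f y
          - (1/2) * of_real (y \<bullet> (Q t *v y)) * \<Phi> (t, y) + Omega_L W ?f y) + H n t y"
        unfolding dF lF oF H_def by (simp add: F_def algebra_simps)
      then show ?thesis unfolding pde by simp
    qed
    have a_dom: "locally_dominated (\<lambda>t y. - \<i> * time_deriv F (t, y))"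
    proof -
      have "test_function (\<lambda>p. - \<i> * time_deriv F p)"
        using test_function_mult[OF _ test_function_time_deriv[OF tF], of "\<lambda>_. - \<i>"] by (simp add: smooth_iff)
      from locally_dominated_test_function[OF this] show ?thesis .
    qed
    define a where "a t = (\<integral>y. v t y * (- \<i> * time_deriv F (t, y)) \<partial>lebesgue)" for t
    have "continuous_on UNIV a"
      unfolding a_def continuous_on_eq_continuous_at[OF open_UNIV]
      by (intro ballI isCont_pairing v a_dom continuous_intros isCont_slices smooth_time_deriv sF)
    moreover obtain s where "\<And>p. s \<le> norm p \<Longrightarrow> time_deriv F p = 0"
      using test_function_time_deriv[OF tF] by (auto simp: test_function_iff)
    then have "a t = 0" if "s \<le> norm t" for t
    proof -
      have "norm t \<le> norm (t, y)" for y :: "real ^ 'n" using norm_fst_le[of t y] by simp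
      then have "time_deriv F (t, y) = 0" for y
        using that by (intro \<open>\<And>p. s \<le> norm p \<Longrightarrow> time_deriv F p = 0\<close>) (meson order_trans)
      then show ?thesis by (simp add: a_def)
    qed
    ultimately have int_a: "integrable lebesgue a" by (rule continuous_compact_support_integrable)
    have b: "(\<integral>y. v t y * ?L t y \<partial>lebesgue) = a t - c n t" for t
    proof -
      have L: "?L t = (\<lambda>y. - \<i> * time_deriv F (t, y) - H n t y)"
        using HL[of t] by (auto simp: fun_eq_iff algebra_simps)
      have "(\<integral>y. v t y * (- \<i> * time_deriv F (t, y)) - v t y * H n t y \<partial>lebesgue) = a t - c n t"
        unfolding a_def c_def
        by (intro Bochner_Integration.integral_diff L2_mult_integrable vL locally_dominated_L2 a_dom HG)
      then show ?thesis unfolding fun_cong[OF L] by (simp only: right_diff_distrib)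
    qed
    have "test_function (\<lambda>(t, y). F (t, y))" using tF by (simp add: case_prod_beta')
    with eq have "(\<integral>t. (\<integral>y. v t y * (- \<i> * vector_derivative (\<lambda>s. F (s, y)) (at t)) \<partial>lebesgue) \<partial>lebesgue)
        = (\<integral>t. (\<integral>y. v t y * ?L t y \<partial>lebesgue) \<partial>lebesgue)"
      unfolding amplitude_equation_def by (elim allE[of _ "\<lambda>t y. F (t, y)"]) blast
    \<comment> \<open>The two sides of the weak equation are the integrals of \<open>a\<close> and
      of \<open>a - c n\<close>. Integrability of both functions is essential here, for only then
      may the common part be subtracted.\<close>
    then have "(\<integral>t. a t \<partial>lebesgue) = (\<integral>t. a t - c n t \<partial>lebesgue)"
      unfolding b unfolding a_def using has_vector_derivative_time[OF sF, THEN vector_derivative_at] by simp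
    then show ?thesis using int_a int_c(2)[of n] by simp
  qed
  define m where "m t = (\<integral>y. v t y * \<Phi> (t, y) \<partial>lebesgue)" for t
  have cont_m: "continuous_on UNIV m"
    unfolding m_def continuous_on_eq_continuous_at[OF open_UNIV]
    by (intro ballI isCont_pairing v dual_solution_locally_dominated[OF dual] isCont_slices \<Phi>)
  \<comment> \<open>Majorant in time for all \<open>c n\<close> at once: the pairing of
    \<open>cmod v\<close> with the spatial majorant \<open>K * G\<close>.\<close>
  define w where "w t = (\<integral>y. of_real (cmod (v t y)) * complex_of_real (K * G y) \<partial>lebesgue)" for t
  have cont_w: "continuous_on UNIV w"
  proof -
    have "locally_dominated (\<lambda>t y. complex_of_real (K * G y))"
      by (rule locally_dominatedI[where G = "\<lambda>y. K * G y"])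
        (use G K0 G0 in \<open>auto simp: power_mult_distrib norm_mult\<close>)
    then show ?thesis
      unfolding w_def continuous_on_eq_continuous_at[OF open_UNIV]
      by (intro ballI isCont_pairing L2_continuous_cmod[OF v]) auto
  qed
  have c_lim: "(\<lambda>n. c n t) \<longlonglongrightarrow> - \<i> * of_real (\<theta>' t) * m t" for t
  proof -
    have "(\<lambda>n. c n t) \<longlonglongrightarrow> (\<integral>y. v t y * (- \<i> * of_real (\<theta>' t) * \<Phi> (t, y)) \<partial>lebesgue)"
      unfolding c_def
    proof (rule integral_dominated_convergence)
      show "integrable lebesgue (\<lambda>y. cmod (v t y * of_real (K * G y)))"
        by (intro integrable_norm L2_mult_integrable vL GL)
      show "(\<lambda>y. v t y * H n t y) \<in> borel_measurable lebesgue" for n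
        by (intro borel_measurable_integrable L2_mult_integrable vL locally_dominated_L2 HG)
      have "(\<lambda>y. v t y * \<Phi> (t, y)) \<in> borel_measurable lebesgue"
        by (intro borel_measurable_integrable L2_mult_integrable vL
            locally_dominated_L2[OF dual_solution_locally_dominated[OF dual]])
      then have "(\<lambda>y. - \<i> * of_real (\<theta>' t) * (v t y * \<Phi> (t, y))) \<in> borel_measurable lebesgue" by measurable
      then show "(\<lambda>y. v t y * (- \<i> * of_real (\<theta>' t) * \<Phi> (t, y))) \<in> borel_measurable lebesgue"
        by (simp add: mult_ac)
      show "AE y in lebesgue. (\<lambda>n. v t y * H n t y) \<longlonglongrightarrow> v t y * (- \<i> * of_real (\<theta>' t) * \<Phi> (t, y))"
      proof (rule AE_I2, rule tendsto_eventually)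
        \<comment> \<open>At a fixed point the limit is attained: as soon as \<open>r n\<close>
          exceeds \<open>norm y\<close> the cutoff is 1 there and its derivatives vanish.\<close>
        fix y :: "real ^ 'n"
        obtain N :: nat where N: "norm y < N" using reals_Archimedean2 by blast
        have "H n t y = - \<i> * of_real (\<theta>' t) * \<Phi> (t, y)" if "n \<ge> N" for n
        proof -
          have "norm y < r n" using N that by (simp add: r_def)
          then show ?thesis using r(1)[of n] by (simp add: H_def cutoff_eq_1 cutoff_derivatives_eq_0)
        qed
        then show "\<forall>\<^sub>F n in sequentially. v t y * H n t y = v t y * (- \<i> * of_real (\<theta>' t) * \<Phi> (t, y))"
          by (auto simp: eventually_sequentially intro!: exI[of _ N])
      qed
      show "AE y in lebesgue. norm (v t y * H n t y) \<le> cmod (v t y * of_real (K * G y))" for n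
      proof (rule AE_I2)
        fix y
        have "0 \<le> K * G y" using K0 G0 by simp
        then show "norm (v t y * H n t y) \<le> cmod (v t y * of_real (K * G y))"
          unfolding norm_mult[of "v t y"] norm_of_real using H_bound[of n t y] by (intro mult_left_mono) auto
      qed
    qed
    also have "(\<integral>y. v t y * (- \<i> * of_real (\<theta>' t) * \<Phi> (t, y)) \<partial>lebesgue) = - \<i> * of_real (\<theta>' t) * m t"
      unfolding m_def integral_mult_right_zero[symmetric] by (simp add: mult_ac)
    finally show ?thesis .
  qed
  have "(\<lambda>n. \<integral>t. c n t \<partial>lborel) \<longlonglongrightarrow> (\<integral>t. - \<i> * of_real (\<theta>' t) * m t \<partial>lborel)"
  proof (rule integral_dominated_convergence)
    show "(\<lambda>t. - \<i> * of_real (\<theta>' t) * m t) \<in> borel_measurable lborel"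
      using borel_measurable_continuous_onI[of "\<lambda>t. - \<i> * of_real (\<theta>' t) * m t"] cont_m smooth_continuous[OF s\<theta>', of UNIV]
      by (simp add: continuous_on_mult continuous_on_of_real continuous_on_minus)
    show "c n \<in> borel_measurable lborel" for n using int_c(1) by (rule borel_measurable_integrable)
    show "integrable lborel (\<lambda>t. indicator {-T..T} t *\<^sub>R cmod (w t))"
      by (intro borel_integrable_compact compact_Icc continuous_on_norm continuous_on_subset[OF cont_w]) simp
    show "AE t in lborel. (\<lambda>n. c n t) \<longlonglongrightarrow> - \<i> * of_real (\<theta>' t) * m t" using c_lim by simp
    have "cmod (c n t) \<le> cmod (w t)" for n t
    proof -
      have i: "integrable lebesgue (\<lambda>y. cmod (v t y) * (K * G y))"
        using integrable_norm[OF L2_mult_integrable[OF vL[of t] GL[of K]]] K0 G0 by (simp add: norm_mult)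
      have "cmod (c n t) \<le> (\<integral>y. cmod (v t y * H n t y) \<partial>lebesgue)"
        unfolding c_def by (rule integral_norm_bound)
      also have "\<dots> \<le> (\<integral>y. cmod (v t y) * (K * G y) \<partial>lebesgue)"
        using H_bound
        by (intro integral_mono integrable_norm L2_mult_integrable vL locally_dominated_L2 HG i)
          (simp add: norm_mult mult_left_mono)
      also have "\<dots> = Re (w t)" unfolding w_def of_real_mult[symmetric] integral_complex_of_real by simp
      also have "\<dots> \<le> cmod (w t)" by (rule complex_Re_le_cmod)
      finally show ?thesis .
    qed
    then show "AE t in lborel. norm (c n t) \<le> indicator {-T..T} t *\<^sub>R cmod (w t)" for n
      using c_zero[of _ n] by (intro AE_I2) (auto simp: indicator_def abs_le_iff not_le)
  qed
  moreover have "(\<integral>t. c n t \<partial>lborel) = 0" for n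
    using c_int_zero[of n] borel_measurable_integrable[OF int_c(1)[of n]] by (simp add: integral_completion)
  ultimately have "(\<integral>t. - \<i> * of_real (\<theta>' t) * m t \<partial>lborel) = 0"
    by (simp add: LIMSEQ_const_iff)
  then show ?thesis by (simp add: m_def mult.assoc)
qed

theorem pairing_constant:
  fixes \<Phi> :: "real \<times> (real ^ 'n) \<Rightarrow> complex"
  assumes v: "L2_continuous v" and eq: "amplitude_equation W Q v"
    and W: "\<And>y. y \<bullet> W y = 0" and dual: "dual_solution W Q \<Phi>"
  shows "(\<integral>y. v a y * \<Phi> (a, y) \<partial>lebesgue) = (\<integral>y. v b y * \<Phi> (b, y) \<partial>lebesgue)"
proof (rule constant_of_weak_derivative_zero[of "\<lambda>t. \<integral>y. v t y * \<Phi> (t, y) \<partial>lebesgue"])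
  have "smooth \<Phi>" using dual by (simp add: dual_solution_def)
  then show "continuous_on UNIV (\<lambda>t. \<integral>y. v t y * \<Phi> (t, y) \<partial>lebesgue)"
    unfolding continuous_on_eq_continuous_at[OF open_UNIV]
    by (intro ballI isCont_pairing v dual_solution_locally_dominated[OF dual] isCont_slices)
qed (rule pairing_weak_derivative_zero[OF assms])

section \<open>Gaussian wave packets\<close>

text \<open>The bilinear product, without conjugation; transposes rather than adjoints move across
  it, which matches the complex symmetric \<open>M\<close>.\<close>

definition bdot :: "complex ^ 'n \<Rightarrow> complex ^ 'n \<Rightarrow> complex" where
  "bdot x y = (\<Sum>i\<in>UNIV. x $ i * y $ i)"

lemma bdot_linear:
  "bdot (x + y) z = bdot x z + bdot y z" "bdot x (y + z) = bdot x y + bdot x z"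
  "bdot (x - y) z = bdot x z - bdot y z" "bdot x (y - z) = bdot x y - bdot x z"
  "bdot (- x) z = - bdot x z" "bdot x (- z) = - bdot x z"
  by (simp_all add: bdot_def algebra_simps sum.distrib sum_subtractf sum_negf)

lemma bdot_commute: "bdot x y = bdot y x"
  by (simp add: bdot_def mult.commute)

lemma bdot_transpose: "bdot x (A *v y) = bdot (transpose A *v x) y"
proof -
  have "bdot x (A *v y) = (\<Sum>i\<in>UNIV. \<Sum>j\<in>UNIV. x $ i * (A $ i $ j * y $ j))"
    by (simp add: bdot_def matrix_vector_mult_def sum_distrib_left)
  also have "\<dots> = (\<Sum>j\<in>UNIV. \<Sum>i\<in>UNIV. x $ i * (A $ i $ j * y $ j))" by (rule sum.swap)
  also have "\<dots> = bdot (transpose A *v x) y"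
    by (simp add: bdot_def matrix_vector_mult_def transpose_def sum_distrib_left sum_distrib_right mult_ac
        del: transpose_matrix_vector)
  finally show ?thesis .
qed

lemma cquad_eq_bdot: "cquad M y = bdot (cvec y) (M *v cvec y)"
  by (simp add: cquad_def bdot_def matrix_vector_mult_def sum_distrib_left mult.assoc)

lemma imat_mult_vec: "(imat M *v x) $ j = \<i> * (M *v x) $ j"
  by (simp add: matrix_vector_mult_def sum_distrib_left mult.assoc)

lemma bdot_imat: "bdot x (imat M *v y) = \<i> * bdot x (M *v y)" "bdot (imat M *v x) y = \<i> * bdot (M *v x) y"
  by (simp_all add: bdot_def imat_mult_vec sum_distrib_left mult_ac)

lemma matrix_vector_minus: "(- A) *v x = - (A *v x)" for A :: "'a::ring_1 ^ 'n ^ 'm"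
  by (simp add: matrix_vector_mult_def vec_eq_iff sum_negf)

lemma cvec_linear: "cvec (x + y) = cvec x + cvec y" "cvec (h *\<^sub>R x) = h *\<^sub>R cvec x"
  by (simp_all add: vec_eq_iff scaleR_conv_of_real[where 'a = complex])

lemma cvec_axis: "cvec (axis j 1) = axis j 1"
  by (simp add: vec_eq_iff axis_def)

lemma bdot_axis: "bdot x (axis j 1) = x $ j" "bdot (axis j 1) x = x $ j"
  by (simp_all add: bdot_def axis_def if_distrib[of "\<lambda>a. _ * a"] if_distrib[of "\<lambda>a. a * _"] cong: if_cong)

lemma bounded_linear_cvec: "bounded_linear (\<lambda>y::real ^ 'n. cvec y)"
  unfolding linear_conv_bounded_linear[symmetric] linear_iff using cvec_linear by blast

lemma bounded_bilinear_bdot: "bounded_bilinear (bdot :: complex ^ 'n \<Rightarrow> _)"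
  unfolding bilinear_conv_bounded_bilinear[symmetric] bilinear_def linear_iff
  by (auto simp: bdot_linear) (auto simp: bdot_def scaleR_sum_right)

lemma quadratic_completion_le:
  fixes a d r :: real
  assumes "d > 0" shows "a * r - d * r\<^sup>2 \<le> a\<^sup>2 / (4 * d)"
proof -
  have "0 \<le> (2 * d * r - a)\<^sup>2" by simp
  then have "4 * d * (a * r - d * r\<^sup>2) \<le> a\<^sup>2" by (simp add: power2_eq_square algebra_simps)
  then show ?thesis using assms by (simp add: pos_le_divide_eq mult.commute)
qed

lemmas differentiable_upto_arith = differentiable_upto_const differentiable_upto_add
  differentiable_upto_diff differentiable_upto_minus differentiable_upto_mult
  differentiable_upto_of_real differentiable_upto_sum

text \<open>The three differential equations result from inserting
  \<open>c exp (- y . m y / 2 + b . y)\<close> and comparing the coefficients of degree two, one and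
  zero in \<open>y\<close>. \<open>coercive\<close> is Gaussian decay, uniform on bounded time
  intervals.\<close>

locale wave_packet =
  fixes R :: "real ^ 'n ^ 'n" and Q :: "real \<Rightarrow> real ^ 'n ^ 'n"
    and m :: "real \<Rightarrow> complex ^ 'n ^ 'n" and b :: "real \<Rightarrow> complex ^ 'n" and c :: "real \<Rightarrow> complex"
  assumes skew: "transpose R = - R"
    and smooth_Q: "\<And>j l. smooth (\<lambda>t. Q t $ j $ l)"
    and sym: "\<And>t. transpose (m t) = m t"
    and m': "\<And>t. (m has_vector_derivative (imat (cmat (Q t)) - imat (m t ** m t) - (cmat R ** m t - m t ** cmat R))) (at t)"
    and b': "\<And>t. (b has_vector_derivative (- (imat (m t) *v b t) - cmat R *v b t)) (at t)"
    and c': "\<And>t. (c has_vector_derivative (\<i> / 2 * (bdot (b t) (b t) - trace (m t)) * c t)) (at t)"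
    and coercive: "\<And>T. \<exists>\<delta>>0. \<forall>t y. \<bar>t\<bar> \<le> T \<longrightarrow> \<delta> * (norm y)\<^sup>2 \<le> Re (cquad (m t) y)"
begin

definition packet :: "real \<times> (real ^ 'n) \<Rightarrow> complex" where
  "packet p = c (fst p) * exp (- (1/2) * cquad (m (fst p)) (snd p) + bdot (b (fst p)) (cvec (snd p)))"

lemma packet_Pair: "packet (t, y) = c t * exp (- (1/2) * cquad (m t) y + bdot (b t) (cvec y))"
  by (simp add: packet_def)

text \<open>Bootstrap: the right-hand side of the Riccati equation is polynomial in the entries of
  \<open>m\<close>, with coefficients from the smooth \<open>Q\<close> and the constant
  \<open>R\<close>.\<close>

lemma differentiable_upto_m: "differentiable_upto n (\<lambda>t. m t $ i $ j)"
proof (induction n arbitrary: i j)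
  case 0
  have "((\<lambda>t. m t $ i $ j) has_vector_derivative (imat (cmat (Q t)) - imat (m t ** m t) - (cmat R ** m t - m t ** cmat R)) $ i $ j) (at t)" for t
    using m'[of t] unfolding has_vector_derivative_vec_iff by blast
  then show ?case by (auto simp: has_vector_derivative_def differentiable_def)
next
  case (Suc n)
  show ?case
  proof (rule differentiable_upto_real_SucI)
    show "((\<lambda>t. m t $ i $ j) has_vector_derivative (imat (cmat (Q t)) - imat (m t ** m t) - (cmat R ** m t - m t ** cmat R)) $ i $ j) (at t)" for t
      using m'[of t] unfolding has_vector_derivative_vec_iff by blast
    have Q: "differentiable_upto n (\<lambda>t. Q t $ i $ j)" using smooth_Q by (simp add: smooth_iff)
    show "differentiable_upto n (\<lambda>t. (imat (cmat (Q t)) - imat (m t ** m t) - (cmat R ** m t - m t ** cmat R)) $ i $ j)"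
      unfolding matrix_matrix_mult_def vector_minus_component imat_nth nth_map_matrix vec_lambda_beta
      by (intro differentiable_upto_arith Suc Q)
  qed
qed

lemma differentiable_upto_b: "differentiable_upto n (\<lambda>t. b t $ j)"
proof (induction n arbitrary: j)
  case 0
  have "((\<lambda>t. b t $ j) has_vector_derivative (- (imat (m t) *v b t) - cmat R *v b t) $ j) (at t)" for t
    using b'[of t] unfolding has_vector_derivative_vec_iff by blast
  then show ?case by (auto simp: has_vector_derivative_def differentiable_def)
next
  case (Suc n)
  show ?case
  proof (rule differentiable_upto_real_SucI)
    show "((\<lambda>t. b t $ j) has_vector_derivative (- (imat (m t) *v b t) - cmat R *v b t) $ j) (at t)" for t
      using b'[of t] unfolding has_vector_derivative_vec_iff by blast
    show "differentiable_upto n (\<lambda>t. (- (imat (m t) *v b t) - cmat R *v b t) $ j)"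
      unfolding matrix_vector_mult_def vector_minus_component vector_uminus_component imat_nth nth_map_matrix vec_lambda_beta
      by (intro differentiable_upto_arith Suc differentiable_upto_m)
  qed
qed

lemma differentiable_upto_c: "differentiable_upto n c"
proof (induction n)
  case 0
  show ?case using c' by (auto simp: has_vector_derivative_def differentiable_def)
next
  case (Suc n)
  show ?case
    by (rule differentiable_upto_real_SucI[OF c'])
      (unfold bdot_def trace_def, intro differentiable_upto_arith Suc differentiable_upto_b differentiable_upto_m)
qed

lemma smooth_packet: "smooth packet"
proof -
  have fst: "differentiable_upto n f \<Longrightarrow> differentiable_upto n (\<lambda>p. f (fst p))" for f :: "real \<Rightarrow> complex" and n
    by (erule differentiable_upto_compose) (intro differentiable_upto_fst differentiable_upto_ident)
  have snd: "differentiable_upto n (\<lambda>p. snd p $ j)" for n j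
    by (intro differentiable_upto_nth differentiable_upto_snd differentiable_upto_ident)
  show ?thesis
    unfolding smooth_iff packet_def[abs_def] cquad_def bdot_def vec_lambda_beta
    by (intro allI differentiable_upto_arith differentiable_upto_exp snd
        fst[OF differentiable_upto_m] fst[OF differentiable_upto_b] fst[OF differentiable_upto_c])
qed

lemma continuous_coefficients:
  "continuous_on A (\<lambda>t. m t $ i $ j)" "continuous_on A (\<lambda>t. b t $ j)" "continuous_on A c"
  by (auto intro!: smooth_continuous simp: smooth_iff differentiable_upto_m differentiable_upto_b differentiable_upto_c)

text \<open>The logarithmic gradient of the packet, affine in \<open>y\<close>.\<close>

definition slope :: "real \<Rightarrow> real ^ 'n \<Rightarrow> complex ^ 'n" where
  "slope t y = b t - m t *v cvec y"

lemma has_derivative_packet: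
  "((\<lambda>y. packet (t, y)) has_derivative (\<lambda>h. packet (t, y) * bdot (slope t y) (cvec h))) (at y)"
proof -
  note cv = bounded_linear_imp_has_derivative[OF bounded_linear_cvec]
  have mv: "((\<lambda>y. m t *v cvec y) has_derivative (\<lambda>h. m t *v cvec h)) (at y)"
    by (rule bounded_linear.has_derivative[OF bounded_bilinear.bounded_linear_right[OF bounded_bilinear_matrix_vector_mult] cv])
  have "((\<lambda>y. - (1/2) * bdot (cvec y) (m t *v cvec y) + bdot (b t) (cvec y)) has_derivative
      (\<lambda>h. - (1/2) * (bdot (cvec y) (m t *v cvec h) + bdot (cvec h) (m t *v cvec y)) + bdot (b t) (cvec h))) (at y)"
    by (intro has_derivative_add has_derivative_mult_right bounded_bilinear.FDERIV[OF bounded_bilinear_bdot]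
        cv mv bounded_linear.has_derivative[OF bounded_bilinear.bounded_linear_right[OF bounded_bilinear_bdot]])
  moreover have "bdot (cvec y) (m t *v cvec h) = bdot (m t *v cvec y) (cvec h)" for h
    unfolding bdot_transpose[of _ "m t"] sym ..
  then have "- (1/2) * (bdot (cvec y) (m t *v cvec h) + bdot (cvec h) (m t *v cvec y)) + bdot (b t) (cvec h)
      = bdot (slope t y) (cvec h)" for h
    unfolding slope_def bdot_linear bdot_commute[of "cvec h"] by simp
  ultimately have E: "((\<lambda>y. - (1/2) * cquad (m t) y + bdot (b t) (cvec y)) has_derivative
      (\<lambda>h. bdot (slope t y) (cvec h))) (at y)"
    unfolding cquad_eq_bdot by (simp only:)
  from has_derivative_mult_right[OF has_derivative_compose[OF E DERIV_exp[unfolded has_field_derivative_def]], of "c t"]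
  show ?thesis unfolding packet_Pair by (simp add: mult.assoc)
qed

lemma partial_deriv_packet:
  "partial_deriv j (\<lambda>y. packet (t, y)) = (\<lambda>y. packet (t, y) * slope t y $ j)"
proof
  fix y show "partial_deriv j (\<lambda>y. packet (t, y)) y = packet (t, y) * slope t y $ j"
    using partial_deriv_eqI[OF has_derivative_packet[of t y], of j] unfolding cvec_axis bdot_axis .
qed

lemma partial_deriv_partial_deriv_packet:
  "partial_deriv j (partial_deriv j (\<lambda>y. packet (t, y))) y
    = packet (t, y) * ((slope t y $ j)\<^sup>2 - m t $ j $ j)"
proof -
  have "((\<lambda>y. slope t y $ j) has_derivative (\<lambda>h. - (m t *v cvec h) $ j)) (at y)"
  proof -
    have "bounded_linear (\<lambda>h. (m t *v cvec h) $ j)"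
      by (rule bounded_linear_compose[OF bounded_linear_vec_nth bounded_linear_compose[OF
          bounded_bilinear.bounded_linear_right[OF bounded_bilinear_matrix_vector_mult] bounded_linear_cvec]])
    from has_derivative_diff[OF has_derivative_const bounded_linear_imp_has_derivative[OF this], of "b t $ j"]
    show ?thesis by (simp add: slope_def)
  qed
  from partial_deriv_eqI[OF has_derivative_mult[OF has_derivative_packet this], of j]
  have "partial_deriv j (\<lambda>y. packet (t, y) * slope t y $ j) y =
      packet (t, y) * (- (m t *v cvec (axis j 1)) $ j) + packet (t, y) * bdot (slope t y) (cvec (axis j 1)) * slope t y $ j" .
  moreover have "(m t *v axis j 1) $ j = m t $ j $ j"
    by (simp add: matrix_vector_mult_def axis_def if_distrib[of "\<lambda>a. _ * a"] cong: if_cong)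
  ultimately show ?thesis
    unfolding partial_deriv_packet cvec_axis bdot_axis by (simp add: power2_eq_square algebra_simps)
qed

lemma time_deriv_packet:
  "time_deriv packet (t, y) = packet (t, y) * (\<i> / 2 * (bdot (b t) (b t) - trace (m t))
    - 1/2 * bdot (cvec y) ((imat (cmat (Q t)) - imat (m t ** m t) - (cmat R ** m t - m t ** cmat R)) *v cvec y)
    + bdot (- (imat (m t) *v b t) - cmat R *v b t) (cvec y))"
proof -
  have "((\<lambda>t. m t *v cvec y) has_vector_derivative
     (imat (cmat (Q t)) - imat (m t ** m t) - (cmat R ** m t - m t ** cmat R)) *v cvec y) (at t)"
    by (rule bounded_linear.has_vector_derivative[OF bounded_bilinear.bounded_linear_left[OF bounded_bilinear_matrix_vector_mult] m'])
  then have "((\<lambda>t. - (1/2) * bdot (cvec y) (m t *v cvec y) + bdot (b t) (cvec y)) has_vector_derivative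
      - (1/2) * bdot (cvec y) ((imat (cmat (Q t)) - imat (m t ** m t) - (cmat R ** m t - m t ** cmat R)) *v cvec y)
      + bdot (- (imat (m t) *v b t) - cmat R *v b t) (cvec y)) (at t)" (is "(?e has_vector_derivative ?E') _")
    by (intro has_vector_derivative_add has_vector_derivative_mult_right
        bounded_linear.has_vector_derivative[OF bounded_bilinear.bounded_linear_right[OF bounded_bilinear_bdot]]
        bounded_linear.has_vector_derivative[OF bounded_bilinear.bounded_linear_left[OF bounded_bilinear_bdot]] b')
  then have "((\<lambda>t. exp (?e t)) has_vector_derivative ?E' * exp (?e t)) (at t)"
    using field_vector_diff_chain_at[of ?e ?E' t exp "exp (?e t)"] DERIV_exp[of "?e t"] by (simp add: o_def)
  from has_vector_derivative_mult[OF c' this]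
  have "((\<lambda>t. packet (t, y)) has_vector_derivative
      c t * (?E' * exp (?e t)) + \<i> / 2 * (bdot (b t) (b t) - trace (m t)) * c t * exp (?e t)) (at t)"
    unfolding packet_Pair cquad_eq_bdot .
  from vector_derivative_unique_at[OF has_vector_derivative_time[OF smooth_packet] this]
  show ?thesis
    unfolding packet_Pair cquad_eq_bdot by (simp add: algebra_simps)
qed

text \<open>Both sides are the packet times a polynomial of degree two in \<open>y\<close>. Symmetry
  of \<open>m\<close> and skewness of \<open>R\<close> (the facts \<open>sm\<close> and
  \<open>sk\<close>) bring its terms to common normal forms, after which they cancel.\<close>

lemma packet_equation:
  assumes W: "\<And>y. W y = - (R *v y)"
  shows "\<i> * time_deriv packet (t, y) = - (1/2) * laplacian (\<lambda>y. packet (t, y)) y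
      + (1/2) * of_real (y \<bullet> (Q t *v y)) * packet (t, y) + Omega_L W (\<lambda>y. packet (t, y)) y"
proof -
  let ?Y = "cvec y" and ?m = "m t" and ?b = "b t" and ?R = "cmat R"
  have lap: "laplacian (\<lambda>y. packet (t, y)) y = packet (t, y) * (bdot (slope t y) (slope t y) - trace ?m)"
    by (simp add: laplacian_def partial_deriv_partial_deriv_packet bdot_def trace_def power2_eq_square
        right_diff_distrib sum_subtractf sum_distrib_left)
  have cW: "complex_of_real (W y $ j) = - (?R *v ?Y) $ j" for j
    by (simp add: W matrix_vector_mult_def)
  have om: "Omega_L W (\<lambda>y. packet (t, y)) y = \<i> * packet (t, y) * bdot (?R *v ?Y) (slope t y)"
    unfolding Omega_L_def partial_deriv_packet cW
    by (simp add: bdot_def sum_distrib_left sum_negf mult_ac)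
  have quad: "complex_of_real (y \<bullet> (Q t *v y)) = bdot ?Y (cmat (Q t) *v ?Y)"
    by (simp add: inner_vec_def bdot_def matrix_vector_mult_def)
  have sm: "bdot x (?m *v z) = bdot (?m *v x) z" for x z by (simp add: bdot_transpose[of x ?m] sym del: transpose_matrix_vector)
  have sk: "bdot x (?R *v z) = - bdot (?R *v x) z" for x z
    by (simp add: bdot_transpose[of x ?R] conj_transpose_cmat skew cmat_minus matrix_vector_minus bdot_linear del: transpose_matrix_vector)
  have c1: "bdot ?Y ((?m ** ?m) *v ?Y) = bdot (?m *v ?Y) (?m *v ?Y)"
    by (simp add: sm flip: matrix_vector_mul_assoc)
  have c2: "bdot ?Y ((?R ** ?m) *v ?Y) = - bdot (?R *v ?Y) (?m *v ?Y)"
    by (simp add: sk flip: matrix_vector_mul_assoc)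
  have c3: "bdot ?Y ((?m ** ?R) *v ?Y) = bdot (?R *v ?Y) (?m *v ?Y)"
    by (simp add: sm bdot_commute[of "?m *v ?Y"] flip: matrix_vector_mul_assoc)
  have c4: "bdot (?m *v ?b) ?Y = bdot ?b (?m *v ?Y)" by (rule sm[symmetric])
  have c5: "bdot (?R *v ?b) ?Y = - bdot (?R *v ?Y) ?b"
    using sk[of ?Y ?b] by (simp add: bdot_commute)
  have c6: "bdot (?m *v ?Y) ?b = bdot ?b (?m *v ?Y)" by (rule bdot_commute)
  show ?thesis
    unfolding time_deriv_packet lap om quad slope_def
    by (simp add: bdot_linear bdot_imat matrix_vector_mult_diff_rdistrib c1 c2 c3 c4 c5 c6 algebra_simps)
qed

lemma packet_dominated:
  "\<exists>K. \<forall>t y. \<bar>t\<bar> \<le> T \<longrightarrow> (1 + (norm y)\<^sup>2) * cmod (packet (t, y)) \<le> K * exp (- norm y) \<and>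
     (\<forall>j. (1 + (norm y)\<^sup>2) * cmod (packet (t, y) * slope t y $ j) \<le> K * exp (- norm y))"
proof -
  obtain \<delta> where \<delta>: "\<delta> > 0" "\<And>t y. \<bar>t\<bar> \<le> T \<Longrightarrow> \<delta> * (norm y)\<^sup>2 \<le> Re (cquad (m t) y)"
    using coercive by blast
  define g where "g t = cmod (c t) + (\<Sum>j\<in>UNIV. cmod (b t $ j)) + (\<Sum>i\<in>UNIV. \<Sum>j\<in>UNIV. cmod (m t $ i $ j))" for t
  have "continuous_on UNIV g"
    unfolding g_def by (intro continuous_intros continuous_coefficients)
  then obtain L where L: "L > 0" "\<And>t. norm t \<le> T \<Longrightarrow> norm (g t) \<le> L"
    using continuous_bounded_on_cball by blast
  have bounds: "cmod (c t) \<le> L" "(\<Sum>j\<in>UNIV. cmod (b t $ j)) \<le> L"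
      "(\<Sum>i\<in>UNIV. \<Sum>j\<in>UNIV. cmod (m t $ i $ j)) \<le> L" if "\<bar>t\<bar> \<le> T" for t
  proof -
    have "0 \<le> cmod (c t)" "0 \<le> (\<Sum>j\<in>UNIV. cmod (b t $ j))" "0 \<le> (\<Sum>i\<in>UNIV. \<Sum>j\<in>UNIV. cmod (m t $ i $ j))"
      by (auto intro!: sum_nonneg)
    with L(2)[of t] that abs_ge_self[of "g t"] show "cmod (c t) \<le> L" "(\<Sum>j\<in>UNIV. cmod (b t $ j)) \<le> L"
      "(\<Sum>i\<in>UNIV. \<Sum>j\<in>UNIV. cmod (m t $ i $ j)) \<le> L"
      unfolding g_def real_norm_def by linarith+
  qed
  \<comment> \<open>In \<open>L + 3\<close>, the \<open>L\<close> bounds the linear exponent, 2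
    comes from estimating the weights \<open>1 + |y|^2\<close> and \<open>1 + |y|\<close> by
    exponentials, and 1 is set aside for the factor \<open>exp (- norm y)\<close> of the claim.
    Completing the square against \<open>\<delta>/2 |y|^2\<close> gives the exponential
    constant.\<close>
  define K where "K = 2 * L * (1 + L) * exp ((L + 3)\<^sup>2 / (4 * (\<delta> / 2)))"
  \<comment> \<open>The factor \<open>(1 + norm y) * (1 + L)\<close> dominates both 1 and every
    component of \<open>slope\<close>, so a single estimate serves the packet and its
    gradient.\<close>
  have main: "(1 + (norm y)\<^sup>2) * (1 + norm y) * (1 + L) * cmod (packet (t, y)) \<le> K * exp (- norm y)"
    if t: "\<bar>t\<bar> \<le> T" for t y
  proof -
    let ?r = "norm y"
    have "Re (bdot (b t) (cvec y)) \<le> cmod (bdot (b t) (cvec y))" by (rule complex_Re_le_cmod)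
    also have "\<dots> \<le> (\<Sum>j\<in>UNIV. cmod (b t $ j) * ?r)"
      unfolding bdot_def
      by (intro sum_norm_le) (simp add: norm_mult component_le_norm_cart mult_left_mono)
    also have "\<dots> \<le> L * ?r"
      unfolding sum_distrib_right[symmetric] by (intro mult_right_mono bounds t) simp
    finally have "Re (- (1/2) * cquad (m t) y + bdot (b t) (cvec y)) \<le> L * ?r - \<delta> / 2 * ?r\<^sup>2"
      using \<delta>(2)[OF t, of y] by simp
    then have p: "cmod (packet (t, y)) \<le> L * exp (L * ?r - \<delta> / 2 * ?r\<^sup>2)"
      unfolding packet_Pair norm_mult norm_exp_eq_Re using bounds(1)[OF t] L(1)
      by (intro mult_mono) auto
    have e1: "1 + ?r \<le> exp ?r" by (rule exp_ge_add_one_self)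
    have "1 + ?r + ?r\<^sup>2 / 2 \<le> exp ?r" by (rule exp_lower_Taylor_quadratic) simp
    then have e2: "1 + ?r\<^sup>2 \<le> 2 * exp ?r" using norm_ge_zero[of y] by linarith
    have "(1 + ?r\<^sup>2) * (1 + ?r) * (1 + L) * cmod (packet (t, y))
        \<le> (2 * exp ?r) * exp ?r * (1 + L) * (L * exp (L * ?r - \<delta> / 2 * ?r\<^sup>2))"
      using e1 e2 p L(1) by (intro mult_mono) auto
    also have "\<dots> = 2 * L * (1 + L) * (exp ((L + 3) * ?r - \<delta> / 2 * ?r\<^sup>2) * exp (- ?r))"
      by (simp add: exp_add[symmetric] mult_ac) (simp add: algebra_simps)
    also have "\<dots> \<le> 2 * L * (1 + L) * (exp ((L + 3)\<^sup>2 / (4 * (\<delta> / 2))) * exp (- ?r))"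
      using quadratic_completion_le[of "\<delta> / 2" "L + 3" ?r] \<delta>(1) L(1) by (intro mult_left_mono mult_right_mono) auto
    finally show ?thesis by (simp add: K_def mult.assoc)
  qed
  show ?thesis
  proof (rule exI[of _ K], intro allI impI conjI)
    fix t y assume t: "\<bar>t\<bar> \<le> T"
    let ?r = "norm (y :: real ^ 'n)"
    have "1 \<le> (1 + ?r) * (1 + L)" using L(1) mult_mono[of 1 "1 + ?r" 1 "1 + L"] by simp
    then have "(1 + ?r\<^sup>2) * cmod (packet (t, y)) * 1 \<le> (1 + ?r\<^sup>2) * cmod (packet (t, y)) * ((1 + ?r) * (1 + L))"
      by (intro mult_left_mono) auto
    with main[OF t, of y] show "(1 + ?r\<^sup>2) * cmod (packet (t, y)) \<le> K * exp (- ?r)"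
      by (simp add: mult_ac)
    fix j
    have "cmod ((m t *v cvec y) $ j) \<le> (\<Sum>l\<in>UNIV. cmod (m t $ j $ l) * ?r)"
      unfolding matrix_vector_mult_def vec_lambda_beta
      by (intro sum_norm_le) (simp add: norm_mult component_le_norm_cart mult_left_mono)
    also have "\<dots> \<le> (\<Sum>i\<in>UNIV. \<Sum>l\<in>UNIV. cmod (m t $ i $ l)) * ?r"
      unfolding sum_distrib_right[symmetric]
      by (intro mult_right_mono member_le_sum[of j UNIV "\<lambda>i. \<Sum>l\<in>UNIV. cmod (m t $ i $ l)"]) (auto intro: sum_nonneg)
    also have "\<dots> \<le> L * ?r" by (intro mult_right_mono bounds t) simp
    finally have 1: "cmod ((m t *v cvec y) $ j) \<le> L * ?r" .
    have "cmod (b t $ j) \<le> (\<Sum>j\<in>UNIV. cmod (b t $ j))" by (rule member_le_sum) auto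
    then have "cmod (b t $ j) \<le> L" using bounds(2)[OF t] by linarith
    with 1 have "cmod (slope t y $ j) \<le> L + L * ?r"
      unfolding slope_def vector_minus_component by (intro norm_triangle_le_diff) linarith
    also have "\<dots> \<le> (1 + ?r) * (1 + L)" by (simp add: algebra_simps)
    finally have "(1 + ?r\<^sup>2) * cmod (packet (t, y)) * cmod (slope t y $ j) \<le> (1 + ?r\<^sup>2) * cmod (packet (t, y)) * ((1 + ?r) * (1 + L))"
      by (intro mult_left_mono) auto
    with main[OF t, of y] show "(1 + ?r\<^sup>2) * cmod (packet (t, y) * slope t y $ j) \<le> K * exp (- ?r)"
      by (simp add: norm_mult mult_ac)
  qed
qed

end

lemma locally_dominated_imp_L2_continuous:
  assumes g: "locally_dominated g" and cont: "\<And>t y. isCont (\<lambda>t. g t y) t"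
  shows "L2_continuous g"
  unfolding L2_continuous_def
proof (intro conjI allI)
  fix t :: real
  note L = locally_dominated_L2[OF g]
  show "L2 (g t)" by (rule L)
  obtain e G where e: "e > 0" and G: "integrable lebesgue (\<lambda>y. (G y)\<^sup>2)" "G \<in> borel_measurable lebesgue"
    and dom: "\<And>s y. s \<in> ball t e \<Longrightarrow> cmod (g s y) \<le> G y"
    using g unfolding locally_dominated_def by metis
  have "(\<lambda>n. L2_norm (\<lambda>y. g (T n) y - g t y)) \<longlonglongrightarrow> 0"
    if T: "T \<longlonglongrightarrow> t" "\<And>n. T n \<in> ball t e" for T
  proof -
    have "(\<lambda>n. \<integral>y. (cmod (g (T n) y - g t y))\<^sup>2 \<partial>lebesgue) \<longlonglongrightarrow> (\<integral>y. 0 \<partial>(lebesgue :: 'a measure))"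
    proof (rule integral_dominated_convergence)
      show "integrable lebesgue (\<lambda>y. 4 * (G y)\<^sup>2)" using G by simp
      show "(\<lambda>y. (cmod (g (T n) y - g t y))\<^sup>2) \<in> borel_measurable lebesgue" for n
        using L2_diff[OF L L] by (simp add: L2_def borel_measurable_integrable)
      show "AE y in lebesgue. (\<lambda>n. (cmod (g (T n) y - g t y))\<^sup>2) \<longlonglongrightarrow> 0"
      proof (rule AE_I2)
        fix y
        have "(\<lambda>n. (cmod (g (T n) y - g t y))\<^sup>2) \<longlonglongrightarrow> (cmod (g t y - g t y))\<^sup>2"
          by (intro tendsto_intros isCont_tendsto_compose[OF cont T(1)])
        then show "(\<lambda>n. (cmod (g (T n) y - g t y))\<^sup>2) \<longlonglongrightarrow> 0" by simp
      qed
      show "AE y in lebesgue. norm ((cmod (g (T n) y - g t y))\<^sup>2) \<le> 4 * (G y)\<^sup>2" for n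
      proof (rule AE_I2)
        fix y
        have "cmod (g (T n) y - g t y) \<le> cmod (g (T n) y) + cmod (g t y)" by (rule norm_triangle_ineq4)
        also have "\<dots> \<le> 2 * G y" using dom[OF T(2), of n y] dom[of t y] e by simp
        finally have "(cmod (g (T n) y - g t y))\<^sup>2 \<le> (2 * G y)\<^sup>2" by (intro power_mono) auto
        then show "norm ((cmod (g (T n) y - g t y))\<^sup>2) \<le> 4 * (G y)\<^sup>2" by (simp add: power_mult_distrib)
      qed
    qed simp
    from tendsto_real_sqrt[OF this] show ?thesis by (simp add: L2_norm_def)
  qed
  then have "((\<lambda>s. L2_norm (\<lambda>y. g s y - g t y)) \<longlongrightarrow> 0) (at t within ball t e)"
    unfolding tendsto_at_iff_sequentially by (auto simp: o_def)
  then show "((\<lambda>s. L2_norm (\<lambda>y. g s y - g t y)) \<longlongrightarrow> 0) (at t)"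
    using e by (simp add: at_within_open[of t "ball t e"])
qed

lemma exp_minus_norm_square_integrable:
  "integrable lebesgue (\<lambda>y::'a::euclidean_space. (K * exp (- norm y))\<^sup>2)"
    "(\<lambda>y::'a. K * exp (- norm y)) \<in> borel_measurable lebesgue"
proof -
  have c: "continuous_on UNIV (\<lambda>y::'a. K * exp (- norm y))" "continuous_on UNIV (\<lambda>y::'a. exp (- (2 * norm y)))"
    by (intro continuous_intros)+
  show "(\<lambda>y::'a. K * exp (- norm y)) \<in> borel_measurable lebesgue"
    by (rule borel_measurable_lebesgue_continuous[OF c(1)])
  have "integrable lebesgue (\<lambda>y::'a. K\<^sup>2 * exp (- (2 * norm y)))"
    using integrable_exp_minus_norm[of 2, where 'a = 'a] borel_measurable_continuous_onI[OF c(2)]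
    by (intro integrable_mult_right) (simp add: integrable_completion)
  moreover have "(K * exp (- norm y))\<^sup>2 = K\<^sup>2 * exp (- (2 * norm y))" for y :: 'a
    by (simp add: power_mult_distrib exp_double[symmetric])
  ultimately show "integrable lebesgue (\<lambda>y::'a. (K * exp (- norm y))\<^sup>2)" by simp
qed

lemma partial_deriv_cnj:
  assumes "smooth f" shows "partial_deriv j (\<lambda>y. cnj (f y)) = (\<lambda>y. cnj (partial_deriv j f y))"
proof
  fix y
  show "partial_deriv j (\<lambda>y. cnj (f y)) y = cnj (partial_deriv j f y)"
    using partial_deriv_eqI[OF bounded_linear.has_derivative[OF bounded_linear_cnj smooth_has_derivative[OF assms]]]
    by (simp add: partial_deriv_def)
qed

context wave_packet
begin

lemma packet_locally_dominated: "locally_dominated (\<lambda>t y. packet (t, y))"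
  unfolding locally_dominated_def
proof (intro conjI allI)
  fix t :: real
  show "(\<lambda>y. packet (t, y)) \<in> borel_measurable lebesgue"
    by (rule borel_measurable_lebesgue_continuous) (rule smooth_continuous[OF smooth_slice[OF smooth_packet]])
  obtain K where K: "\<forall>s y. \<bar>s\<bar> \<le> \<bar>t\<bar> + 1 \<longrightarrow> (1 + (norm y)\<^sup>2) * cmod (packet (s, y)) \<le> K * exp (- norm y) \<and>
     (\<forall>j. (1 + (norm y)\<^sup>2) * cmod (packet (s, y) * slope s y $ j) \<le> K * exp (- norm y))"
    using packet_dominated[of "\<bar>t\<bar> + 1"] by (rule exE)
  have "cmod (packet (s, y)) \<le> K * exp (- norm y)" if "s \<in> ball t 1" for s y
  proof -
    have "\<bar>s\<bar> \<le> \<bar>t\<bar> + 1" using that by (auto simp: dist_real_def)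
    then have "(1 + (norm y)\<^sup>2) * cmod (packet (s, y)) \<le> K * exp (- norm y)" using K by simp
    then show ?thesis
      by (rule order_trans[rotated]) (simp add: distrib_right)
  qed
  then show "\<exists>e>0. \<exists>G. integrable lebesgue (\<lambda>y. (G y)\<^sup>2) \<and> G \<in> borel_measurable lebesgue \<and>
      (\<forall>s\<in>ball t e. \<forall>y. cmod (packet (s, y)) \<le> G y)"
    using exp_minus_norm_square_integrable
    by (intro exI[of _ 1] conjI exI[of _ "\<lambda>y. K * exp (- norm y)"]) auto
qed

lemma L2_continuous_packet: "L2_continuous (\<lambda>t y. packet (t, y))"
  by (intro locally_dominated_imp_L2_continuous packet_locally_dominated isCont_slices smooth_packet)

lemma amplitude_equation_packet:
  assumes W: "\<And>y. W y = - (R *v y)"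
  shows "amplitude_equation W Q (\<lambda>t y. packet (t, y))"
proof (rule classical_solution_amplitude_equation[OF smooth_packet _ _ packet_equation[OF W]])
  show "linear W" unfolding linear_iff W[abs_def] by (simp add: matrix_vector_right_distrib matrix_vector_mult_scaleR)
  show "W (axis j 1) $ j = 0" for j
  proof -
    have "R $ j $ j = - R $ j $ j"
      using arg_cong[OF skew, of "\<lambda>Z. Z $ j $ j"] by (simp add: transpose_def)
    then show ?thesis
      by (simp add: W matrix_vector_mult_def axis_def if_distrib[of "\<lambda>a. _ * a"] cong: if_cong)
  qed
qed

text \<open>The Laplacian and the potential are real, while \<open>Omega_L\<close> carries a factor
  \<open>\<i>\<close> and changes sign under conjugation. So does the factor in front of the time
  derivative, and these are exactly the signs of the transposed equation.\<close>

lemma dual_solution_cnj_packet: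
  assumes W: "\<And>y. W y = - (R *v y)"
  shows "dual_solution W Q (\<lambda>p. cnj (packet p))"
  unfolding dual_solution_def
proof (intro conjI allI)
  show s: "smooth (\<lambda>p. cnj (packet p))"
    using smooth_packet by (simp add: smooth_iff differentiable_upto_cnj)
  note ss = smooth_slice[OF smooth_packet]
  show "- \<i> * time_deriv (\<lambda>p. cnj (packet p)) (t, y) = - (1/2) * laplacian (\<lambda>y. cnj (packet (t, y))) y
        + (1/2) * of_real (y \<bullet> (Q t *v y)) * cnj (packet (t, y)) - Omega_L W (\<lambda>y. cnj (packet (t, y))) y" for t y
  proof -
    have "((\<lambda>s. cnj (packet (s, y))) has_vector_derivative cnj (time_deriv packet (t, y))) (at t)"
      by (intro has_vector_derivative_cnj has_vector_derivative_time smooth_packet)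
    with has_vector_derivative_time[OF s, of y t]
    have t: "time_deriv (\<lambda>p. cnj (packet p)) (t, y) = cnj (time_deriv packet (t, y))"
      by (rule vector_derivative_unique_at)
    have l: "laplacian (\<lambda>y. cnj (packet (t, y))) y = cnj (laplacian (\<lambda>y. packet (t, y)) y)"
      by (simp add: laplacian_def partial_deriv_cnj ss smooth_partial_deriv)
    have o: "Omega_L W (\<lambda>y. cnj (packet (t, y))) y = - cnj (Omega_L W (\<lambda>y. packet (t, y)) y)"
      by (simp add: Omega_L_def partial_deriv_cnj ss)
    show ?thesis
      using arg_cong[OF packet_equation[OF W, of t y], of cnj] unfolding t l o by simp
  qed
  fix T :: real
  obtain K where K: "\<forall>t y. \<bar>t\<bar> \<le> T \<longrightarrow> (1 + (norm y)\<^sup>2) * cmod (packet (t, y)) \<le> K * exp (- norm y) \<and>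
     (\<forall>j. (1 + (norm y)\<^sup>2) * cmod (packet (t, y) * slope t y $ j) \<le> K * exp (- norm y))"
    using packet_dominated[of T] by (rule exE)
  show "\<exists>G. G \<in> borel_measurable lebesgue \<and> integrable lebesgue (\<lambda>y. (G y)\<^sup>2) \<and>
        (\<forall>t y. \<bar>t\<bar> \<le> T \<longrightarrow> (1 + (norm y)\<^sup>2) * cmod (cnj (packet (t, y))) \<le> G y \<and>
          (\<forall>j. (1 + (norm y)\<^sup>2) * cmod (partial_deriv j (\<lambda>y. cnj (packet (t, y))) y) \<le> G y))"
  proof (rule exI[of _ "\<lambda>y. K * exp (- norm y)"], intro conjI exp_minus_norm_square_integrable allI impI)
    fix t y assume t: "\<bar>t\<bar> \<le> T"
    show "(1 + (norm y)\<^sup>2) * cmod (cnj (packet (t, y))) \<le> K * exp (- norm y)"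
      using K t by simp
    show "(1 + (norm y)\<^sup>2) * cmod (partial_deriv j (\<lambda>y. cnj (packet (t, y))) y) \<le> K * exp (- norm y)" for j
      unfolding partial_deriv_cnj[OF ss] partial_deriv_packet complex_mod_cnj using K t by blast
  qed
qed

end

lemma antiderivative_exists:
  fixes f :: "real \<Rightarrow> complex"
  assumes f: "continuous_on UNIV f"
  shows "\<exists>F. \<forall>t. (F has_vector_derivative f t) (at t)"
proof (intro exI allI)
  fix t :: real
  have "((\<lambda>u. LBINT y=(0::real)..u. f y) has_vector_derivative f t) (at t within {- \<bar>t\<bar> - 1 .. \<bar>t\<bar> + 1})"
    by (rule interval_integral_FTC2) (auto intro: continuous_on_subset[OF f])
  moreover have "at t within {- \<bar>t\<bar> - 1 .. \<bar>t\<bar> + 1} = at t"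
    by (rule at_within_Icc_at) auto
  ultimately show "((\<lambda>u. LBINT y=(0::real)..u. f y) has_vector_derivative f t) (at t)"
    by simp
qed

section \<open>The Gaussian solution\<close>

lemma norm_cvec: "norm (cvec y) = norm y"
  by (simp add: norm_vec_def L2_set_def)

lemma has_vector_derivative_exp:
  fixes f :: "real \<Rightarrow> complex"
  assumes "(f has_vector_derivative f') (at t)"
  shows "((\<lambda>t. exp (f t)) has_vector_derivative f' * exp (f t)) (at t)"
  using field_vector_diff_chain_at[OF assms DERIV_exp] by (simp add: o_def)

lemma constant_of_has_vector_derivative_zero:
  fixes f :: "real \<Rightarrow> 'a::real_normed_vector"
  assumes "\<And>t. (f has_vector_derivative 0) (at t)" shows "f t = f s"
proof -
  have "\<exists>c. \<forall>x\<in>UNIV. f x = c"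
    by (rule has_derivative_zero_constant) (use assms in \<open>auto simp: has_vector_derivative_def\<close>)
  then show ?thesis by auto
qed

text \<open>The quotient of two branches is continuous on the connected line with values in
  \<open>{1, -1}\<close>, and equals 1 at time 0.\<close>

lemma sqrt_branch_unique:
  assumes "sqrt_branch s0 f s" "sqrt_branch s0 f s'" "\<And>t. f t \<noteq> 0" shows "s = s'"
proof
  fix t
  have nz: "s' t \<noteq> 0" for t
    using assms(2,3) unfolding sqrt_branch_def by (metis zero_power2)
  have "(\<lambda>t. s t / s' t) constant_on UNIV"
  proof (rule continuous_finite_range_constant)
    show "continuous_on UNIV (\<lambda>t. s t / s' t)"
      using assms nz by (intro continuous_on_divide) (auto simp: sqrt_branch_def)
    have "s t / s' t \<in> {1, -1}" for t
    proof -
      have "(s t / s' t)\<^sup>2 = 1"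
        using assms(1,2) nz[of t] unfolding sqrt_branch_def power_divide by (metis divide_self_if power_not_zero)
      then show ?thesis by (simp add: power2_eq_1_iff)
    qed
    then have "range (\<lambda>t. s t / s' t) \<subseteq> {1, -1}" by blast
    then show "finite (range (\<lambda>t. s t / s' t))"
      by (rule finite_subset) simp
  qed simp
  then have "s t / s' t = s 0 / s' 0" by (auto simp: constant_on_def)
  also have "\<dots> = 1" using assms(1,2) nz[of 0] by (simp add: sqrt_branch_def)
  finally show "s t = s' t" using nz[of t] by simp
qed

text \<open>\<open>rotation\<close> prescribes \<open>z\<close> at an arbitrary time, because the
  packets of the duality argument are prescribed at \<open>T\<close> and not at 0.\<close>

locale gaussian_flow = matrix_flow R Q A B
  for R :: "real ^ 'n ^ 'n" and Q A B +
  assumes smooth_Q: "\<And>j l. smooth (\<lambda>t. Q t $ j $ l)"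
    and rotation: "\<And>T z0. \<exists>z. z T = z0 \<and> (\<forall>t. (z has_vector_derivative - (cmat R *v z t)) (at t))"
begin

lemma continuous_A: "continuous_on X A"
  using has_vector_derivative_continuous[OF derivative_A] continuous_at_imp_continuous_on by blast

lemma continuous_M: "continuous_on X (\<lambda>t. trace (M t))"
proof -
  have "continuous_on X M"
    using has_vector_derivative_continuous[OF derivative_M] continuous_at_imp_continuous_on by blast
  then show ?thesis unfolding trace_def by (intro continuous_intros)
qed

text \<open>The real part of the form is \<open>|A^-1 y|^2\<close>, which is bounded below by a
  bound on \<open>A\<close>; and \<open>A\<close> is bounded on compact time intervals by
  continuity.\<close>

lemma coercive_M: "\<exists>\<delta>>0. \<forall>t y. \<bar>t\<bar> \<le> T \<longrightarrow> \<delta> * (norm y)\<^sup>2 \<le> Re (cquad (M t) y)"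
proof -
  obtain L where L: "L > 0" "\<And>t. norm t \<le> T \<Longrightarrow> norm (A t) \<le> L"
    using continuous_bounded_on_cball[OF continuous_A] by blast
  obtain K where K: "K > 0" "\<And>X (x :: complex ^ 'n). norm ((X :: complex ^ 'n ^ 'n) *v x) \<le> norm X * norm x * K"
    using bounded_bilinear.pos_bounded[OF bounded_bilinear_matrix_vector_mult] by blast
  have "1 / (L * K)\<^sup>2 * (norm y)\<^sup>2 \<le> Re (cquad (M t) y)" if "\<bar>t\<bar> \<le> T" for t y
  proof -
    let ?x = "N t *v cvec y"
    have "norm y = norm (A t *v ?x)"
      by (simp add: matrix_vector_mul_assoc norm_cvec)
    also have "\<dots> \<le> norm (A t) * norm ?x * K" by (rule K(2))
    also have "\<dots> \<le> L * norm ?x * K"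
      using L(2)[of t] that K(1) by (intro mult_right_mono) auto
    finally have "norm y \<le> L * K * norm ?x" by (simp add: mult_ac)
    then have "(norm y)\<^sup>2 \<le> (L * K * norm ?x)\<^sup>2" by (intro power_mono) auto
    moreover have "Re (cquad (M t) y) = (norm ?x)\<^sup>2"
      unfolding M_def N_def by (rule lagrangian_pair_Re_cquad[OF lagrangian_pair])
    ultimately show ?thesis
      using L(1) K(1) by (simp add: power_mult_distrib divide_le_eq mult_ac)
  qed
  then show ?thesis
    using L(1) K(1) by (intro exI[of _ "1 / (L * K)\<^sup>2"]) auto
qed

text \<open>A linear equation with variable coefficients is reduced to a pure rotation:
  differentiating \<open>transpose (N t)\<close> produces the two wanted terms and a term
  \<open>transpose (N t) ** cmat R\<close>, which the rotation of \<open>z\<close> cancels.\<close>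

lemma slope_flow_exists:
  "\<exists>b. b T = \<beta> \<and> (\<forall>t. (b has_vector_derivative (- (imat (M t) *v b t) - cmat R *v b t)) (at t))"
proof -
  obtain z where z: "z T = transpose (A T) *v \<beta>" "\<And>t. (z has_vector_derivative - (cmat R *v z t)) (at t)"
    using rotation by blast
  define b where "b t = transpose (N t) *v z t" for t
  have "b T = transpose (A T ** N T) *v \<beta>"
    unfolding b_def z(1) matrix_transpose_mul matrix_vector_mul_assoc ..
  then have "b T = \<beta>" by simp
  moreover have "(b has_vector_derivative (- (imat (M t) *v b t) - cmat R *v b t)) (at t)" for t
    unfolding b_def
    by (rule has_vector_derivative_eq_rhs[OF has_vector_derivative_matrix_vector_mult[OF
          has_vector_derivative_transpose[OF derivative_N] z(2)]])
      (simp add: matrix_algebra transpose_M matrix_vector_mult_diff_rdistrib matrix_vector_mult_add_rdistrib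
        matrix_vector_minus matrix_vector_mul_assoc vec.neg del: transpose_matrix_vector)
  ultimately show ?thesis by blast
qed

text \<open>The amplitude obeys a scalar linear equation, so it is an exponential and never
  vanishes; dividing by it is later essential.\<close>

lemma wave_packet_exists:
  assumes b: "\<And>t. (b has_vector_derivative (- (imat (M t) *v b t) - cmat R *v b t)) (at t)" and "c0 \<noteq> 0"
  shows "\<exists>c. c 0 = c0 \<and> (\<forall>t. c t \<noteq> 0) \<and> wave_packet R Q M b c"
proof -
  have "continuous_on UNIV b"
    using has_vector_derivative_continuous[OF b] continuous_at_imp_continuous_on by blast
  then have "continuous_on UNIV (\<lambda>t. \<i> / 2 * (bdot (b t) (b t) - trace (M t)))"
    unfolding bdot_def by (intro continuous_intros continuous_M)
  then obtain F where F: "\<And>t. (F has_vector_derivative \<i> / 2 * (bdot (b t) (b t) - trace (M t))) (at t)"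
    using antiderivative_exists by blast
  let ?c = "\<lambda>t. c0 * exp (- F 0) * exp (F t)"
  have "(?c has_vector_derivative \<i> / 2 * (bdot (b t) (b t) - trace (M t)) * ?c t) (at t)" for t
    using has_vector_derivative_mult_right[OF has_vector_derivative_exp[OF F[of t]], of "c0 * exp (- F 0)"]
    by (simp add: mult_ac)
  then have "wave_packet R Q M b ?c"
    by (intro wave_packet.intro skew smooth_Q transpose_M derivative_M b coercive_M)
  then show ?thesis
    using assms(2) by (intro exI[of _ ?c]) (simp add: mult.assoc exp_add[symmetric])
qed

text \<open>For \<open>b = 0\<close> the logarithmic derivative of \<open>c\<close> is
  \<open>- \<i>/2\<close> times the trace of \<open>M\<close>, that of \<open>det A\<close> is
  \<open>\<i>\<close> times this trace. Hence \<open>det A\<close> times the square of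
  \<open>c\<close> is constant, equal to 1, and \<open>1 / c\<close> is a continuous square
  root.\<close>

theorem sqrt_branch_and_amplitude:
  assumes s0: "s0\<^sup>2 = det (A 0)"
  obtains s where "sqrt_branch s0 (\<lambda>t. det (A t)) s"
    "wave_packet R Q M (\<lambda>_. 0) (\<lambda>t. 1 / s t)" "\<And>t. s t \<noteq> 0"
proof -
  have s00: "s0 \<noteq> 0" using s0 det_A_nz[of 0] by auto
  have "((\<lambda>_. 0) has_vector_derivative (- (imat (M t) *v 0) - cmat R *v 0)) (at t)" for t by simp
  from wave_packet_exists[OF this, of "1 / s0"] s00
  obtain c where c: "c 0 = 1 / s0" "\<And>t. c t \<noteq> 0" "wave_packet R Q M (\<lambda>_. 0) c" by auto
  interpret wave_packet R Q M "\<lambda>_. 0" c by (rule c(3))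
  have "((\<lambda>t. det (A t) * (c t * c t)) has_vector_derivative
      det (A t) * (c t * (\<i> / 2 * (bdot (0 :: complex ^ 'n) 0 - trace (M t)) * c t) + \<i> / 2 * (bdot (0 :: complex ^ 'n) 0 - trace (M t)) * c t * c t)
      + \<i> * trace (M t) * det (A t) * (c t * c t)) (at t)" for t
    using c' by (intro has_vector_derivative_mult derivative_det_A) simp_all
  then have "((\<lambda>t. det (A t) * (c t * c t)) has_vector_derivative 0) (at t)" for t
    by (rule has_vector_derivative_eq_rhs) (simp add: bdot_def algebra_simps)
  then have "det (A t) * (c t * c t) = det (A 0) * (c 0 * c 0)" for t
    by (rule constant_of_has_vector_derivative_zero)
  then have det: "det (A t) * (c t * c t) = 1" for t
    using s00 by (simp add: c(1) s0[symmetric] power2_eq_square)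
  have "sqrt_branch s0 (\<lambda>t. det (A t)) (\<lambda>t. 1 / c t)"
    unfolding sqrt_branch_def
  proof (intro conjI allI)
    show "continuous_on UNIV (\<lambda>t. 1 / c t)"
      by (intro continuous_intros continuous_coefficients) (simp add: c)
    show "(1 / c t)\<^sup>2 = det (A t)" for t
      using det[of t] c(2)[of t] by (simp add: power2_eq_square field_simps)
    show "1 / c 0 = s0" by (simp add: c)
  qed
  then show ?thesis by (rule that) (use c in simp_all)
qed

theorem amplitude_solution_unique:
  assumes W: "\<And>y. W y = - (R *v y)"
    and u: "wave_packet R Q M (\<lambda>_. 0) c" "\<And>t. c t \<noteq> 0"
    and v: "L2_continuous v" "amplitude_equation W Q v"
    and v0: "AE y in lebesgue. v 0 y = wave_packet.packet M (\<lambda>_. 0) c (0, y)"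
  shows "AE y in lebesgue. v T y = wave_packet.packet M (\<lambda>_. 0) c (T, y)"
proof -
  interpret u: wave_packet R Q M "\<lambda>_. 0" c by (rule u(1))
  let ?u = "\<lambda>t y. u.packet (t, y)"
  have orth: "y \<bullet> W y = 0" for y
  proof -
    have "y \<bullet> (R *v y) = (y v* R) \<bullet> y"
      by (simp add: dot_lmul_matrix)
    also have "y v* R = - (R *v y)"
      using skew by (metis transpose_matrix_vector matrix_vector_minus)
    also have "(- (R *v y)) \<bullet> y = - (y \<bullet> (R *v y))" by (simp add: inner_commute)
    finally show ?thesis by (simp add: W)
  qed
  have vL: "L2 (v t)" for t using v(1) by (simp add: L2_continuous_def)
  have uL: "L2 (?u t)" for t using u.L2_continuous_packet by (simp add: L2_continuous_def)
  have cuL: "L2 (\<lambda>y. cnj (?u t y))" for t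
    using uL[of t] unfolding L2_def
    by (auto intro!: borel_measurable_continuous_on[OF continuous_on_cnj[OF continuous_on_id], of _ lebesgue, simplified])
  \<comment> \<open>Multiplying by the conjugate Gaussian makes the difference integrable, so that
    Fourier injectivity applies; as the Gaussian has no zero, it can be divided out
    afterwards.\<close>
  let ?h = "\<lambda>y. (v T y - ?u T y) * cnj (?u T y)"
  have "AE y in lebesgue. ?h y = 0"
  proof (rule Fourier_injective)
    show "integrable lebesgue ?h" by (intro L2_mult_integrable L2_diff vL uL cuL)
    fix \<beta> :: "real ^ 'n"
    \<comment> \<open>The value \<open>- \<i> \<beta>\<close> makes the conjugate of
      \<open>exp (b . y)\<close> at time \<open>T\<close> equal to the character
      \<open>cis (\<beta> \<bullet> y)\<close>.\<close>
    obtain b where b: "b T = (\<chi> j. - \<i> * of_real (\<beta> $ j))"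
      "\<And>t. (b has_vector_derivative (- (imat (M t) *v b t) - cmat R *v b t)) (at t)"
      using slope_flow_exists by blast
    obtain k where k: "\<And>t. k t \<noteq> 0" "wave_packet R Q M b k"
      using wave_packet_exists[OF b(2), of 1] by auto
    interpret w: wave_packet R Q M b k by (rule k(2))
    let ?\<Phi> = "\<lambda>p. cnj (w.packet p)"
    note dual = w.dual_solution_cnj_packet[OF W]
    \<comment> \<open>Both \<open>v\<close> and the Gaussian are \<open>L2_continuous\<close> weak
      solutions, so both pairings are conserved; they agree at time 0 and hence at
      \<open>T\<close>.\<close>
    have "(\<integral>y. v T y * ?\<Phi> (T, y) \<partial>lebesgue) = (\<integral>y. v 0 y * ?\<Phi> (0, y) \<partial>lebesgue)"
      by (rule pairing_constant[OF v orth dual])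
    also have "\<dots> = (\<integral>y. ?u 0 y * ?\<Phi> (0, y) \<partial>lebesgue)"
    proof (rule integral_cong_AE)
      have L: "L2 (\<lambda>y. ?\<Phi> (0, y))" by (rule locally_dominated_L2[OF dual_solution_locally_dominated[OF dual]])
      show "(\<lambda>y. v 0 y * ?\<Phi> (0, y)) \<in> borel_measurable lebesgue" "(\<lambda>y. ?u 0 y * ?\<Phi> (0, y)) \<in> borel_measurable lebesgue"
        by (intro borel_measurable_integrable L2_mult_integrable vL uL L)+
      show "AE y in lebesgue. v 0 y * ?\<Phi> (0, y) = ?u 0 y * ?\<Phi> (0, y)"
        using v0 by eventually_elim simp
    qed
    also have "\<dots> = (\<integral>y. ?u T y * ?\<Phi> (T, y) \<partial>lebesgue)"
      by (rule pairing_constant[OF u.L2_continuous_packet u.amplitude_equation_packet[OF W] orth dual])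
    finally have eq: "(\<integral>y. v T y * ?\<Phi> (T, y) \<partial>lebesgue) = (\<integral>y. ?u T y * ?\<Phi> (T, y) \<partial>lebesgue)" .
    have L: "L2 (\<lambda>y. ?\<Phi> (T, y))" by (rule locally_dominated_L2[OF dual_solution_locally_dominated[OF dual]])
    have "(\<integral>y. (v T y - ?u T y) * ?\<Phi> (T, y) \<partial>lebesgue) = 0"
      using eq L2_mult_integrable[OF vL L, of T] L2_mult_integrable[OF uL L, of T] by (simp add: left_diff_distrib)
    \<comment> \<open>The packets have the same quadratic exponent, so \<open>?\<Phi>\<close> is the
      conjugate Gaussian times a character and a nonzero constant.\<close>
    moreover have "(v T y - ?u T y) * ?\<Phi> (T, y) = cnj (k T / c T) * (?h y * cis (\<beta> \<bullet> y))" for y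
    proof -
      have "cnj (bdot (b T) (cvec y)) = \<i> * of_real (\<beta> \<bullet> y)"
        by (simp add: bdot_def b(1) inner_vec_def sum_distrib_left mult.assoc)
      then have cis: "cnj (exp (bdot (b T) (cvec y))) = cis (\<beta> \<bullet> y)"
        by (simp add: exp_cnj cis_conv_exp)
      define g where "g = exp (- (1/2) * cquad (M T) y)"
      have up: "u.packet (T, y) = c T * g"
        by (simp add: u.packet_Pair g_def bdot_def)
      have wp: "w.packet (T, y) = k T * (g * exp (bdot (b T) (cvec y)))"
        unfolding w.packet_Pair g_def exp_add ..
      show ?thesis
        unfolding up wp complex_cnj_mult cis using u(2)[of T] by simp
    qed
    ultimately have "cnj (k T / c T) * (\<integral>y. ?h y * cis (\<beta> \<bullet> y) \<partial>lebesgue) = 0"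
      unfolding integral_mult_right_zero[symmetric] by (simp only:)
    then show "(\<integral>y. ?h y * cis (\<beta> \<bullet> y) \<partial>lebesgue) = 0" using k(1)[of T] u(2)[of T] by simp
  qed
  then show ?thesis
  proof eventually_elim
    case (elim y)
    then show ?case using u(2)[of T] by (simp add: u.packet_Pair)
  qed
qed

end

text \<open>If \<open>R\<^sup>3 = - \<omega>\<^sup>2 R\<close>, then \<open>exp (- t R) = 1 - f(t) R + g(t) R\<^sup>2\<close> with \<open>g' = f\<close> and \<open>f' = 1 - \<omega>\<^sup>2 g\<close>.\<close>

lemma rotation_flow_exists:
  fixes R :: "real ^ 'n ^ 'n"
  assumes cube: "R ** (R ** R) = - (\<omega>\<^sup>2 *\<^sub>R R)"
  shows "\<exists>z. z T = z0 \<and> (\<forall>t. (z has_vector_derivative - (cmat R *v z t)) (at t))"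
proof -
  obtain f g :: "real \<Rightarrow> real" where fg: "f 0 = 0" "g 0 = 0"
    and f': "\<And>t. (f has_real_derivative 1 - \<omega>\<^sup>2 * g t) (at t)" and g': "\<And>t. (g has_real_derivative f t) (at t)"
  \<comment> \<open>The trigonometric formulas divide by \<open>\<omega>\<close>; at
    \<open>\<omega> = 0\<close> their limits \<open>t\<close> and \<open>t^2 / 2\<close> take
    over.\<close>
  proof (cases "\<omega> = 0")
    case True
    show ?thesis
      by (rule that[of "\<lambda>t. t" "\<lambda>t. t\<^sup>2 / 2"]) (auto simp: True intro!: derivative_eq_intros)
  next
    case False
    show ?thesis
      by (rule that[of "\<lambda>t. sin (\<omega> * t) / \<omega>" "\<lambda>t. (1 - cos (\<omega> * t)) / \<omega>\<^sup>2"])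
        (use False in \<open>auto simp: power2_eq_square intro!: derivative_eq_intros\<close>)
  qed
  let ?R = "cmat R"
  define z where "z t = z0 - f (t - T) *\<^sub>R (?R *v z0) + g (t - T) *\<^sub>R (?R *v (?R *v z0))" for t
  have shift: "((\<lambda>t. h (t - T)) has_vector_derivative h' (t - T)) (at t)"
    if "\<And>t. (h has_real_derivative h' t) (at t)" for h h' :: "real \<Rightarrow> real" and t
    using DERIV_shift[of h "h' (t - T)" t "- T"] that[of "t - T"]
    by (simp add: has_real_derivative_iff_has_vector_derivative[symmetric])
  have "?R ** (?R ** ?R) = cmat (R ** (R ** R))" by (simp add: cmat_mult)
  also have "\<dots> = - (\<omega>\<^sup>2 *\<^sub>R ?R)"
    by (simp add: cube vec_eq_iff) (simp add: scaleR_conv_of_real[where 'a = complex])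
  finally have "(?R ** (?R ** ?R)) *v z0 = (- (\<omega>\<^sup>2 *\<^sub>R ?R)) *v z0" by (rule arg_cong)
  then have R3: "?R *v (?R *v (?R *v z0)) = - (\<omega>\<^sup>2 *\<^sub>R (?R *v z0))"
    by (simp add: matrix_vector_minus bounded_bilinear.scaleR_left[OF bounded_bilinear_matrix_vector_mult] flip: matrix_vector_mul_assoc)
  have "(z has_vector_derivative - (?R *v z t)) (at t)" for t
  proof -
    have "(z has_vector_derivative (0 - (1 - \<omega>\<^sup>2 * g (t - T)) *\<^sub>R (?R *v z0) + f (t - T) *\<^sub>R (?R *v (?R *v z0)))) (at t)"
      unfolding z_def
      by (intro has_vector_derivative_add has_vector_derivative_diff has_vector_derivative_const
          bounded_linear.has_vector_derivative[OF bounded_linear_scaleR_left] shift[OF f'] shift[OF g'])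
    moreover have "- (?R *v z t) = 0 - (1 - \<omega>\<^sup>2 * g (t - T)) *\<^sub>R (?R *v z0) + f (t - T) *\<^sub>R (?R *v (?R *v z0))"
      unfolding z_def by (simp add: matrix_vector_right_distrib matrix_vector_mult_diff_distrib
          bounded_bilinear.scaleR_right[OF bounded_bilinear_matrix_vector_mult] R3 algebra_simps)
    ultimately show ?thesis by simp
  qed
  moreover have "z T = z0" by (simp add: z_def fg)
  ultimately show ?thesis by blast
qed

text \<open>Independent of the dimension: the rotation enters only through skewness, the cubic
  relation and \<open>W y = - R y\<close>. Since the branch is constructed and shown to be unique,
  the claim about all branches reduces to the constructed one.\<close>

lemma gaussian_amplitude:
  fixes R :: "real ^ 'n::{finite,linorder} ^ 'n::{finite,linorder}" and V :: "real ^ 'n::{finite,linorder} \<Rightarrow> real"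
  assumes skew: "transpose R = - R" and cube: "R ** (R ** R) = - (\<omega>\<^sup>2 *\<^sub>R R)"
    and W: "\<And>y. W y = - (R *v y)"
    and V: "smooth V" and q: "smooth q"
    and M: "property_M A0 B0" and s0: "s0\<^sup>2 = det A0"
    and v: "amplitude_solution k W (\<lambda>t. hessian V (q t)) (gaussian s0 A0 B0) v"
    and AB: "matrix_solution R (\<lambda>t. hessian V (q t)) A0 B0 A B"
  shows "(\<forall>t. property_M (A t) (B t)) \<and>
        (\<exists>!s. sqrt_branch s0 (\<lambda>t. det (A t)) s) \<and>
        (\<forall>s. sqrt_branch s0 (\<lambda>t. det (A t)) s \<longrightarrow>
          (\<forall>t. AE y in lebesgue. v t y = gaussian (s t) (A t) (B t) y))"
proof -
  have 0: "A 0 = A0" "B 0 = B0" using AB by (auto simp: matrix_solution_def)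
  interpret gaussian_flow R "\<lambda>t. hessian V (q t)" A B
  proof
    show "matrix_solution R (\<lambda>t. hessian V (q t)) (A 0) (B 0) A B" using AB 0 by simp
    show "lagrangian_pair (A 0) (B 0)" using M 0 by (simp add: property_M_iff_lagrangian_pair)
    show "smooth (\<lambda>t. hessian V (q t) $ j $ l)" for j l
    proof -
      have "smooth (iter_deriv [axis j 1, axis l 1] V)"
        by (rule smooth_iter_deriv[OF V]) simp
      then have "smooth (\<lambda>t. iter_deriv [axis j 1, axis l 1] V (q t))"
        unfolding smooth_iff using q[unfolded smooth_iff] by (blast intro: differentiable_upto_compose)
      then show ?thesis by (simp add: hessian_def partial_deriv_def)
    qed
  qed (rule skew transpose_hessian[OF V] rotation_flow_exists[OF cube])+
  obtain s where s: "sqrt_branch s0 (\<lambda>t. det (A t)) s" "wave_packet R (\<lambda>t. hessian V (q t)) M (\<lambda>_. 0) (\<lambda>t. 1 / s t)"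
    "\<And>t. s t \<noteq> 0"
    using sqrt_branch_and_amplitude[of s0] s0 0 by auto
  have unique: "s' = s" if "sqrt_branch s0 (\<lambda>t. det (A t)) s'" for s'
    using that s(1) by (rule sqrt_branch_unique) (rule det_A_nz)
  interpret wave_packet R "\<lambda>t. hessian V (q t)" M "\<lambda>_. 0" "\<lambda>t. 1 / s t" by (rule s(2))
  have packet: "packet (t, y) = gaussian (s t) (A t) (B t) y" for t y
    by (simp add: packet_Pair gaussian_def M_def N_def bdot_def)
  have "AE y in lebesgue. v T y = packet (T, y)" for T
  proof (rule amplitude_solution_unique[OF W s(2)])
    show "L2_continuous v" "amplitude_equation W (\<lambda>t. hessian V (q t)) v"
      using v continuous_in_Sigma_imp_L2_continuous by (auto simp: amplitude_solution_def)
    show "AE y in lebesgue. v 0 y = packet (0, y)"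
      using v s(1) by (simp add: packet 0 amplitude_solution_def sqrt_branch_def)
  qed (use s(3) in simp)
  then have "\<forall>t. AE y in lebesgue. v t y = gaussian (s t) (A t) (B t) y"
    unfolding packet by blast
  moreover have "\<forall>t. property_M (A t) (B t)"
    by (simp add: property_M_iff_lagrangian_pair lagrangian_pair)
  ultimately show ?thesis using s(1) unique by blast
qed

lemma rot2_properties:
  "transpose (rot2 \<Omega>) = - rot2 \<Omega>" "rot2 \<Omega> ** (rot2 \<Omega> ** rot2 \<Omega>) = - ((\<Omega> $ 3)\<^sup>2 *\<^sub>R rot2 \<Omega>)"
  "wedge2 \<Omega> y = - (rot2 \<Omega> *v y)"
  by (simp_all add: rot2_def wedge2_def vec_eq_iff forall_2 transpose_def matrix_matrix_mult_def
      matrix_vector_mult_def sum_2 power2_eq_square)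

text \<open>The cubic relation reflects that the cross product with \<open>\<Omega>\<close>
  annihilates \<open>\<Omega>\<close> and squares to \<open>- |\<Omega>|^2\<close> on its orthogonal
  complement.\<close>

lemma rot3_properties:
  "transpose (rot3 \<Omega>) = - rot3 \<Omega>" "rot3 \<Omega> ** (rot3 \<Omega> ** rot3 \<Omega>) = - ((norm \<Omega>)\<^sup>2 *\<^sub>R rot3 \<Omega>)"
  "cross3 \<Omega> y = - (rot3 \<Omega> *v y)"
  by (simp_all add: rot3_def cross3_def vec_eq_iff forall_3 transpose_def matrix_matrix_mult_def
      matrix_vector_mult_def sum_3 power2_norm_eq_inner inner_vec_def algebra_simps)

theorem corollary2p8:
  shows
    "(\<forall>(\<Omega> :: real ^ 3) (V :: real ^ 2 \<Rightarrow> real) q0 p0 q p A0 B0 s0 k v A B.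
        \<Omega> $ 1 = 0 \<and> \<Omega> $ 2 = 0 \<longrightarrow>
        subquadratic V \<longrightarrow>
        hamiltonian_solution (wedge2 \<Omega>) V q0 p0 q p \<longrightarrow>
        property_M A0 B0 \<longrightarrow>
        s0\<^sup>2 = det A0 \<longrightarrow>
        amplitude_solution k (wedge2 \<Omega>) (\<lambda>t. hessian V (q t)) (gaussian s0 A0 B0) v \<longrightarrow>
        matrix_solution (rot2 \<Omega>) (\<lambda>t. hessian V (q t)) A0 B0 A B \<longrightarrow>
        (\<forall>t. property_M (A t) (B t)) \<and>
        (\<exists>!s. sqrt_branch s0 (\<lambda>t. det (A t)) s) \<and>
        (\<forall>s. sqrt_branch s0 (\<lambda>t. det (A t)) s \<longrightarrow>
          (\<forall>t. AE y in lebesgue. v t y = gaussian (s t) (A t) (B t) y)))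
     \<and>
     (\<forall>(\<Omega> :: real ^ 3) (V :: real ^ 3 \<Rightarrow> real) q0 p0 q p A0 B0 s0 k v A B.
        subquadratic V \<longrightarrow>
        hamiltonian_solution (cross3 \<Omega>) V q0 p0 q p \<longrightarrow>
        property_M A0 B0 \<longrightarrow>
        s0\<^sup>2 = det A0 \<longrightarrow>
        amplitude_solution k (cross3 \<Omega>) (\<lambda>t. hessian V (q t)) (gaussian s0 A0 B0) v \<longrightarrow>
        matrix_solution (rot3 \<Omega>) (\<lambda>t. hessian V (q t)) A0 B0 A B \<longrightarrow>
        (\<forall>t. property_M (A t) (B t)) \<and>
        (\<exists>!s. sqrt_branch s0 (\<lambda>t. det (A t)) s) \<and>
        (\<forall>s. sqrt_branch s0 (\<lambda>t. det (A t)) s \<longrightarrow>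
          (\<forall>t. AE y in lebesgue. v t y = gaussian (s t) (A t) (B t) y)))"
  unfolding subquadratic_def hamiltonian_solution_def
  by (intro conjI[of "All _" "All _"] allI impI; elim conjE)
    (rule gaussian_amplitude[OF rot2_properties], assumption+,
     rule gaussian_amplitude[OF rot3_properties], assumption+)

end
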